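(* Let $\mathcal{T}$ be a self-affine tiling in $\mathbb{R}^d$ with expansion map $Q$ and digit sets $\mathcal{D}_{ij}$ ($1\le i,j\le m$), such that $\Xi(\mathcal{T})$ is a Meyer set. Let $\xi$ be a coloured point of $\mathcal{T}$ with $\xi\in\Phi(\xi)$, and let $\mathcal{B}=\{\alpha_1,\dots,\alpha_d\}\subset\Xi(\mathcal{T})$ be a basis of $\mathbb{R}^d$ such that $\xi+\alpha_1,\dots,\xi+\alpha_d\in\Phi^{\ell}(\xi)$ for some positive integer $\ell$. Let $k$ be a positive integer with $\|Q^{-k}\|<1$, and let $R$, the finite directed multigraph $\mathcal{G}$ of potential overlaps, and its induced subgraphs $\mathcal{G}_{coin}$ and $\mathcal{G}_{res}$ be as defined in the context. Then the following are equivalent: (i) $\mathcal{T}$ admits an overlap coincidence; (ii) $\rho(\mathcal{G}_{coin})>\rho(\mathcal{G}_{res})$.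
   Context: **Tilings.** Fix types (colours) $\{1,\dots,m\}$. A tile in $\mathbb{R}^d$ is a pair $T=(A,i)$, where $A=\mathrm{supp}(T)$ is a compact set equal to the closure of its interior and $i$ is its type; $g+T=(g+A,i)$ for $g\in\mathbb{R}^d$. A patch is a finite set of tiles with mutually disjoint interiors. A tiling of $\mathbb{R}^d$ is a set $\mathcal{T}$ of tiles whose supports cover $\mathbb{R}^d$, distinct tiles having disjoint interiors; any two tiles of $\mathcal{T}$ of the same type are translates of each other. $\Xi(\mathcal{T})=\{x\in\mathbb{R}^d:\exists\,T,T'\in\mathcal{T},\ T'=x+T\}$. $\mathcal{T}$ has finite local complexity (FLC) if for each $r>0$ there are, up to translation, only finitely many patches of $\mathcal{T}$ whose support lies in some ball of radius $r$. $\mathcal{T}$ is repetitive if for every compact $K\subset\mathbb{R}^d$ the set $\{t\in\mathbb{R}^d:\mathcal{T}\sqcap K=(t+\mathcal{T})\sqcap K\}$ is relatively dense, where $\mathcal{T}\sqcap K$ is the set of tiles whose supports meet $K$. **Self-affine tilings.** A linear map $Q:\mathbb{R}^d\to\mathbb{R}^d$ is expansive if all its eigenvalues lie outside the closed unit disk. A tile-substitution $\Omega$ with expansive map $Q$ on prototiles $T_i=(A_i,i)$, $i\le m$, is given by finite digit sets $\mathcal{D}_{ij}\subset\mathbb{R}^d$ (some possibly empty) via $\Omega(T_j)=\{u+T_i:u\in\mathcal{D}_{ij},\ i\le m\}$, where $QA_j=\bigcup_{i=1}^m(\mathcal{D}_{ij}+A_i)$ and all sets on the right have disjoint interiors. It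 extends by $\Omega(x+T_j)=Qx+\Omega(T_j)$ and to sets of tiles by unions. It is primitive if the matrix $(\#\mathcal{D}_{ij})$ is primitive. A self-affine tiling is a repetitive tiling $\mathcal{T}$ with FLC and $\Omega(\mathcal{T})=\mathcal{T}$ for a primitive tile-substitution $\Omega$; its tiles are translates of the $T_i$. **Meyer set.** A Delone set (relatively dense and uniformly discrete) $\Lambda\subset\mathbb{R}^d$ such that $\Lambda-\Lambda$ is uniformly discrete. **Coloured points.** Put $\Lambda_i=\{u\in\mathbb{R}^d:u+T_i\in\mathcal{T}\}$. A coloured point of $\mathcal{T}$ is a point $u\in\Lambda_i$ together with its colour $i$; translation preserves colour. For a point $x$ of colour $j$, $\Phi(x)$ is the set of points $Qx+d$ of colour $i$, over all $i\le m$, $d\in\mathcal{D}_{ij}$; $\Phi^n$ denotes iteration (applied to sets by unions). Let $(\mathcal{D}^n)_{ij}=\bigcup_{n_1,\dots,n_{n-1}\le m}(\mathcal{D}_{in_1}+Q\mathcal{D}_{n_1n_2}+\cdots+Q^{n-1}\mathcal{D}_{n_{n-1}j})$, so that $\Phi^n(x)$ consists of the points $Q^nx+d$ of colour $i$ with $d\in(\mathcal{D}^n)_{ij}$. **Overlaps and overlap coincidence.** An overlap is a triple $(u,y,v)$ with $u+T_i,v+T_j\in\mathcal{T}$, $y\in\Xi(\mathcal{T})$ and $(u+A_i-y)^\circ\cap(v+A_j)^\circ\ne\emptyset$. It is a coincidence if $u-y=v$ and $u+T_i,v+T_i\in\mathcal{T}$ for some $i$ (i.e. same colour). For an overlap $\mathcal{O}=(u,y,v)$,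 $\Phi^\ell\mathcal{O}=\{(u',Q^\ell y,v'):u'\in\Phi^\ell(u),\ v'\in\Phi^\ell(v),\ (u',Q^\ell y,v')\text{ is an overlap}\}$. $\mathcal{T}$ admits an overlap coincidence if there is a positive integer $\ell$ such that for each overlap $\mathcal{O}$ in $\mathcal{T}$, $\Phi^\ell\mathcal{O}$ contains a coincidence. **Potential overlaps.** $|\cdot|$ is the Euclidean norm and $\|\cdot\|$ the induced operator norm. Let $e^{(k)}=\max\{|d-d'|:d\in(\mathcal{D}^k)_{ij},\ d'\in(\mathcal{D}^k)_{pq},\ 1\le i,j,p,q\le m\}$ and $R=\dfrac{e^{(k)}\|Q^{-k}\|}{1-\|Q^{-k}\|}$. A potential overlap is a triple $(u,y,v)$ with $u+T_i,v+T_j\in\mathcal{T}$ for some $i,j$, $y\in\Xi(\mathcal{T})$ and $|u-y-v|\le R$; it is said to occur by the translation $y$. Potential overlaps $(u,y,v)$ and $(u',y',v')$ are equivalent if $u,u'$ have the same colour $i$, $v,v'$ have the same colour $j$, and $u-y=g+u'-y'$, $v=g+v'$ for some $g\in\mathbb{R}^d$; thus the class of $(u,y,v)$ is identified with $(i,z,j)$, $z=u-y-v$, $|z|\le R$. **The graph $\mathcal{G}$.** Its vertices are all equivalence classes $(i,z,j)$ of potential overlaps occurring by the translations $Q^n\alpha$, $\alpha\in\mathcal{B}$, $n\ge 0$ (there are finitely many). The number of edges from $(i,z,j)$ to $(p,z',q)$ is $\#\{(d_{pi},d_{qj})\in\mathcal{D}_{pi}\times\mathcal{D}_{qj}: z'=Qz+d_{pi}-d_{qj}\}$.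 A vertex $(i,z,j)$ is a coincidence if $i=j$ and $z=0$. $\mathcal{G}_{coin}$ is the subgraph induced on the vertices from which there is a path leading to a coincidence, and $\mathcal{G}_{res}$ is the subgraph induced on the remaining vertices. $\rho(G)$ is the spectral radius of the adjacency matrix of $G$, counting multiplicities of edges (the empty graph having spectral radius $0$). *)

theory Defs
  imports
    "HOL-Analysis.Analysis"
    "Jordan_Normal_Form.Spectral_Radius"
    "Graph_Theory.Graph_Theory"
begin

text \<open>\<open>$\<close>, \<open>mat\<close> and \<open>vec\<close> refer to the type-indexed vectors and matrices of HOL-Analysis.\<close>

no_notation Matrix.vec_index (infixl "$" 100)

hide_const (open) Matrix.mat Matrix.vec

section \<open>Point sets\<close>

definition relatively_dense :: "'a::metric_space set \<Rightarrow> bool" where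
  "relatively_dense S \<longleftrightarrow> (\<exists>r>0. \<forall>x. \<exists>s\<in>S. dist x s \<le> r)"

definition delone_set :: "'a::metric_space set \<Rightarrow> bool" where
  "delone_set S \<longleftrightarrow> relatively_dense S \<and> uniform_discrete S"

definition meyer_set :: "'a::real_normed_vector set \<Rightarrow> bool" where
  "meyer_set S \<longleftrightarrow> delone_set S \<and> uniform_discrete {x - y | x y. x \<in> S \<and> y \<in> S}"

section \<open>Tilings\<close>

text \<open>Colours form an arbitrary finite type; the number m of colours is its cardinality.\<close>

type_synonym ('d, 'c) tile = "(real^'d) set \<times> 'c"

definition is_tile :: "('d::finite, 'c) tile \<Rightarrow> bool" where
  "is_tile t \<longleftrightarrow> compact (fst t) \<and> fst t = closure (interior (fst t))"

definition translate_tile :: "real^'d \<Rightarrow> ('d::finite, 'c) tile \<Rightarrow> ('d, 'c) tile" where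
  "translate_tile g t = ((+) g ` fst t, snd t)"

definition disjoint_interiors :: "('d::finite, 'c) tile set \<Rightarrow> bool" where
  "disjoint_interiors P \<longleftrightarrow>
     (\<forall>t\<in>P. \<forall>t'\<in>P. t \<noteq> t' \<longrightarrow> interior (fst t) \<inter> interior (fst t') = {})"

definition is_patch :: "('d::finite, 'c) tile set \<Rightarrow> bool" where
  "is_patch P \<longleftrightarrow> finite P \<and> (\<forall>t\<in>P. is_tile t) \<and> disjoint_interiors P"

definition is_tiling :: "('d::finite, 'c) tile set \<Rightarrow> bool" where
  "is_tiling T \<longleftrightarrow>
     (\<forall>t\<in>T. is_tile t) \<and> (\<Union>t\<in>T. fst t) = UNIV \<and> disjoint_interiors T \<and>
     (\<forall>t\<in>T. \<forall>t'\<in>T. snd t = snd t' \<longrightarrow> (\<exists>x. t' = translate_tile x t))"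

definition Xi :: "('d::finite, 'c) tile set \<Rightarrow> (real^'d) set" where
  "Xi T = {x. \<exists>t\<in>T. \<exists>t'\<in>T. t' = translate_tile x t}"

text \<open>Finiteness up to translation is expressed by a finite set of representatives.\<close>

definition FLC :: "('d::finite, 'c) tile set \<Rightarrow> bool" where
  "FLC T \<longleftrightarrow>
     (\<forall>r>0. \<exists>F. finite F \<and>
        (\<forall>P. P \<subseteq> T \<and> is_patch P \<and> (\<exists>c. (\<Union>t\<in>P. fst t) \<subseteq> ball c r) \<longrightarrow>
           (\<exists>P0\<in>F. \<exists>g. P = translate_tile g ` P0)))"

definition tiles_meeting :: "('d::finite, 'c) tile set \<Rightarrow> (real^'d) set \<Rightarrow> ('d, 'c) tile set" where
  "tiles_meeting T K = {t\<in>T. fst t \<inter> K \<noteq> {}}"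

definition repetitive :: "('d::finite, 'c) tile set \<Rightarrow> bool" where
  "repetitive T \<longleftrightarrow>
     (\<forall>K. compact K \<longrightarrow>
        relatively_dense {x. tiles_meeting T K = tiles_meeting (translate_tile x ` T) K})"

section \<open>Self-affine tilings\<close>

text \<open>All complex eigenvalues of the real linear map are considered.\<close>

definition expansive :: "(real^'d \<Rightarrow> real^'d::finite) \<Rightarrow> bool" where
  "expansive Q \<longleftrightarrow> linear Q \<and>
     (\<forall>(c::complex) (w::complex^'d). w \<noteq> 0 \<and>
        (\<chi> r s. complex_of_real (matrix Q $ r $ s)) *v w = c *s w \<longrightarrow> cmod c > 1)"

text \<open>A substitution is given by the expansive map \<open>Q\<close>, the supports \<open>A i\<close> of the prototiles and
  the digit sets \<open>D i j\<close>.\<close>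

definition prototile :: "('c \<Rightarrow> (real^'d) set) \<Rightarrow> 'c \<Rightarrow> ('d::finite, 'c) tile" where
  "prototile A i = (A i, i)"

definition subst_prototile ::
  "('c \<Rightarrow> (real^'d) set) \<Rightarrow> ('c \<Rightarrow> 'c \<Rightarrow> (real^'d) set) \<Rightarrow> 'c \<Rightarrow> ('d::finite, 'c) tile set" where
  "subst_prototile A D j = {translate_tile u (prototile A i) | u i. u \<in> D i j}"

definition subst_tiles ::
  "(real^'d \<Rightarrow> real^'d) \<Rightarrow> ('c \<Rightarrow> (real^'d) set) \<Rightarrow> ('c \<Rightarrow> 'c \<Rightarrow> (real^'d) set) \<Rightarrow>
   ('d::finite, 'c) tile set \<Rightarrow> ('d, 'c) tile set" where
  "subst_tiles Q A D S =
     \<Union>{translate_tile (Q x) ` subst_prototile A D j | x j. translate_tile x (prototile A j) \<in> S}"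

definition tile_substitution ::
  "(real^'d \<Rightarrow> real^'d) \<Rightarrow> ('c::finite \<Rightarrow> (real^'d::finite) set) \<Rightarrow>
   ('c \<Rightarrow> 'c \<Rightarrow> (real^'d) set) \<Rightarrow> bool" where
  "tile_substitution Q A D \<longleftrightarrow>
     expansive Q \<and> (\<forall>i. is_tile (prototile A i)) \<and> (\<forall>i j. finite (D i j)) \<and>
     (\<forall>j. Q ` A j = (\<Union>i. \<Union>u\<in>D i j. (+) u ` A i)) \<and>
     (\<forall>j i i'. \<forall>u\<in>D i j. \<forall>u'\<in>D i' j. (i, u) \<noteq> (i', u') \<longrightarrow>
        interior ((+) u ` A i) \<inter> interior ((+) u' ` A i') = {})"

definition primitive_matrix :: "nat^'c^'c::finite \<Rightarrow> bool" where
  "primitive_matrix M \<longleftrightarrow> (\<exists>n>0. \<forall>i j. 0 < (((**) M ^^ n) (mat 1)) $ i $ j)"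

definition primitive_substitution :: "('c::finite \<Rightarrow> 'c \<Rightarrow> (real^'d) set) \<Rightarrow> bool" where
  "primitive_substitution D \<longleftrightarrow> primitive_matrix (\<chi> i j. card (D i j))"

definition self_affine_tiling ::
  "(real^'d \<Rightarrow> real^'d) \<Rightarrow> ('c::finite \<Rightarrow> (real^'d::finite) set) \<Rightarrow>
   ('c \<Rightarrow> 'c \<Rightarrow> (real^'d) set) \<Rightarrow> ('d, 'c) tile set \<Rightarrow> bool" where
  "self_affine_tiling Q A D T \<longleftrightarrow>
     tile_substitution Q A D \<and> primitive_substitution D \<and>
     is_tiling T \<and> repetitive T \<and> FLC T \<and>
     (\<forall>t\<in>T. \<exists>x i. t = translate_tile x (prototile A i)) \<and>
     subst_tiles Q A D T = T"

section \<open>Coloured points\<close>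

text \<open>The same point may carry several colours, so the colour is recorded explicitly.\<close>

type_synonym ('d, 'c) cpoint = "(real^'d) \<times> 'c"

definition coloured_points ::
  "('c \<Rightarrow> (real^'d) set) \<Rightarrow> ('d::finite, 'c) tile set \<Rightarrow> ('d, 'c) cpoint set" where
  "coloured_points A T = {(u, i). translate_tile u (prototile A i) \<in> T}"

definition translate_cpoint :: "real^'d \<Rightarrow> ('d::finite, 'c) cpoint \<Rightarrow> ('d, 'c) cpoint" where
  "translate_cpoint g x = (g + fst x, snd x)"

definition Phi ::
  "(real^'d \<Rightarrow> real^'d) \<Rightarrow> ('c \<Rightarrow> 'c \<Rightarrow> (real^'d) set) \<Rightarrow>
   ('d::finite, 'c) cpoint \<Rightarrow> ('d, 'c) cpoint set" where
  "Phi Q D x = {(Q (fst x) + d, i) | d i. d \<in> D i (snd x)}"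

definition Phi_pow ::
  "(real^'d \<Rightarrow> real^'d) \<Rightarrow> ('c \<Rightarrow> 'c \<Rightarrow> (real^'d) set) \<Rightarrow> nat \<Rightarrow>
   ('d::finite, 'c) cpoint \<Rightarrow> ('d, 'c) cpoint set" where
  "Phi_pow Q D n x = ((\<lambda>S. \<Union>y\<in>S. Phi Q D y) ^^ n) {x}"

text \<open>Unfolding the recursion gives, for \<open>n \<ge> 1\<close>, the union over all colour sequences of the sums
  \<open>D i n1 + Q (D n1 n2) + \<dots> + Q ^ (n - 1) (D n' j)\<close>.\<close>

primrec digits_pow ::
  "(real^'d \<Rightarrow> real^'d) \<Rightarrow> ('c \<Rightarrow> 'c \<Rightarrow> (real^'d) set) \<Rightarrow> nat \<Rightarrow>
   'c \<Rightarrow> 'c \<Rightarrow> (real^'d::finite) set" where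
  "digits_pow Q D 0 i j = (if i = j then {0} else {})"
| "digits_pow Q D (Suc n) i j =
     (\<Union>l. {d + Q d' | d d'. d \<in> D i l \<and> d' \<in> digits_pow Q D n l j})"

section \<open>Overlaps\<close>

type_synonym ('d, 'c) cpoint_triple = "('d, 'c) cpoint \<times> (real^'d) \<times> ('d, 'c) cpoint"

fun is_overlap ::
  "('c \<Rightarrow> (real^'d) set) \<Rightarrow> ('d::finite, 'c) tile set \<Rightarrow> ('d, 'c) cpoint_triple \<Rightarrow> bool" where
  "is_overlap A T ((u, i), y, (v, j)) \<longleftrightarrow>
     (u, i) \<in> coloured_points A T \<and> (v, j) \<in> coloured_points A T \<and> y \<in> Xi T \<and>
     interior ((+) (u - y) ` A i) \<inter> interior ((+) v ` A j) \<noteq> {}"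

fun is_coincidence :: "('d::finite, 'c) cpoint_triple \<Rightarrow> bool" where
  "is_coincidence ((u, i), y, (v, j)) \<longleftrightarrow> u - y = v \<and> i = j"

fun Phi_overlap ::
  "(real^'d \<Rightarrow> real^'d) \<Rightarrow> ('c \<Rightarrow> (real^'d) set) \<Rightarrow> ('c \<Rightarrow> 'c \<Rightarrow> (real^'d) set) \<Rightarrow>
   ('d::finite, 'c) tile set \<Rightarrow> nat \<Rightarrow> ('d, 'c) cpoint_triple \<Rightarrow> ('d, 'c) cpoint_triple set" where
  "Phi_overlap Q A D T l (x, y, x') =
     {(w, (Q ^^ l) y, w') | w w'. w \<in> Phi_pow Q D l x \<and> w' \<in> Phi_pow Q D l x' \<and>
        is_overlap A T (w, (Q ^^ l) y, w')}"

definition admits_overlap_coincidence ::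
  "(real^'d \<Rightarrow> real^'d) \<Rightarrow> ('c \<Rightarrow> (real^'d) set) \<Rightarrow> ('c \<Rightarrow> 'c \<Rightarrow> (real^'d) set) \<Rightarrow>
   ('d::finite, 'c) tile set \<Rightarrow> bool" where
  "admits_overlap_coincidence Q A D T \<longleftrightarrow>
     (\<exists>l>0. \<forall>X. is_overlap A T X \<longrightarrow> (\<exists>Y\<in>Phi_overlap Q A D T l X. is_coincidence Y))"

section \<open>Potential overlaps\<close>

definition digit_spread ::
  "(real^'d \<Rightarrow> real^'d) \<Rightarrow> ('c::finite \<Rightarrow> 'c \<Rightarrow> (real^'d::finite) set) \<Rightarrow> nat \<Rightarrow> real" where
  "digit_spread Q D k =
     Max {norm (d - d') | d d' i j p q. d \<in> digits_pow Q D k i j \<and> d' \<in> digits_pow Q D k p q}"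

text \<open>\<open>inv_into UNIV Q\<close> is the inverse function of \<open>Q\<close>; the short notation for it is shadowed by the group
  inverse of HOL-Algebra.\<close>

definition overlap_radius ::
  "(real^'d \<Rightarrow> real^'d) \<Rightarrow> ('c::finite \<Rightarrow> 'c \<Rightarrow> (real^'d::finite) set) \<Rightarrow> nat \<Rightarrow> real" where
  "overlap_radius Q D k =
     digit_spread Q D k * onorm (inv_into UNIV Q ^^ k) / (1 - onorm (inv_into UNIV Q ^^ k))"

fun is_potential_overlap ::
  "real \<Rightarrow> ('c \<Rightarrow> (real^'d) set) \<Rightarrow> ('d::finite, 'c) tile set \<Rightarrow> ('d, 'c) cpoint_triple \<Rightarrow> bool" where
  "is_potential_overlap R A T ((u, i), y, (v, j)) \<longleftrightarrow>
     (u, i) \<in> coloured_points A T \<and> (v, j) \<in> coloured_points A T \<and> y \<in> Xi T \<and>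
     norm (u - y - v) \<le> R"

fun po_equiv :: "('d::finite, 'c) cpoint_triple \<Rightarrow> ('d, 'c) cpoint_triple \<Rightarrow> bool" where
  "po_equiv ((u, i), y, (v, j)) ((u', i'), y', (v', j')) \<longleftrightarrow>
     i = i' \<and> j = j' \<and> (\<exists>g. u - y = g + u' - y' \<and> v = g + v')"

type_synonym ('d, 'c) po_class = "'c \<times> (real^'d) \<times> 'c"

fun po_class :: "('d::finite, 'c) cpoint_triple \<Rightarrow> ('d, 'c) po_class" where
  "po_class ((u, i), y, (v, j)) = (i, u - y - v, j)"

lemma po_equiv_iff: "po_equiv X Y \<longleftrightarrow> po_class X = po_class Y"
proof -
  obtain u i y v j where X: "X = ((u, i), y, (v, j))" by (metis prod.collapse)
  obtain u' i' y' v' j' where Y: "Y = ((u', i'), y', (v', j'))" by (metis prod.collapse)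
  have "(\<exists>g. u - y = g + u' - y' \<and> v = g + v') \<longleftrightarrow> u - y - v = u' - y' - v'"
  proof
    assume "u - y - v = u' - y' - v'"
    then have "u - y = (v - v') + u' - y' \<and> v = (v - v') + v'"
      by (simp add: algebra_simps)
    then show "\<exists>g. u - y = g + u' - y' \<and> v = g + v'" by blast
  qed auto
  then show ?thesis by (auto simp: X Y)
qed

section \<open>The graph of potential overlaps\<close>

definition po_vertices ::
  "(real^'d \<Rightarrow> real^'d) \<Rightarrow> ('c::finite \<Rightarrow> (real^'d::finite) set) \<Rightarrow>
   ('c \<Rightarrow> 'c \<Rightarrow> (real^'d) set) \<Rightarrow> ('d, 'c) tile set \<Rightarrow> (real^'d) set \<Rightarrow> nat \<Rightarrow>
   ('d, 'c) po_class set" where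
  "po_vertices Q A D T B k =
     {po_class (x, (Q ^^ n) \<alpha>, x') | x n \<alpha> x'.
        \<alpha> \<in> B \<and> is_potential_overlap (overlap_radius Q D k) A T (x, (Q ^^ n) \<alpha>, x')}"

text \<open>An arc consists of its tail, a pair of digits and its head; parallel arcs are
  distinguished by the digits.\<close>

type_synonym ('d, 'c) po_arc =
  "('d, 'c) po_class \<times> ((real^'d) \<times> (real^'d)) \<times> ('d, 'c) po_class"

definition po_graph ::
  "(real^'d \<Rightarrow> real^'d) \<Rightarrow> ('c::finite \<Rightarrow> (real^'d::finite) set) \<Rightarrow>
   ('c \<Rightarrow> 'c \<Rightarrow> (real^'d) set) \<Rightarrow> ('d, 'c) tile set \<Rightarrow> (real^'d) set \<Rightarrow> nat \<Rightarrow>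
   (('d, 'c) po_class, ('d, 'c) po_arc) pre_digraph" where
  "po_graph Q A D T B k =
     \<lparr> verts = po_vertices Q A D T B k,
       arcs = {((i, z, j), (d, d'), (p, z', q)) | i z j d d' p z' q.
                 (i, z, j) \<in> po_vertices Q A D T B k \<and> (p, z', q) \<in> po_vertices Q A D T B k \<and>
                 d \<in> D p i \<and> d' \<in> D q j \<and> z' = Q z + d - d'},
       tail = fst,
       head = (\<lambda>e. snd (snd e)) \<rparr>"

definition coincidence_class :: "('d::finite, 'c) po_class \<Rightarrow> bool" where
  "coincidence_class w \<longleftrightarrow> fst w = snd (snd w) \<and> fst (snd w) = 0"

text \<open>Paths may have length 0, so coincidences themselves belong to the first set.\<close>

definition coin_vertices ::
  "(('d::finite, 'c) po_class, 'e) pre_digraph \<Rightarrow> ('d, 'c) po_class set" where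
  "coin_vertices G = {w \<in> verts G. \<exists>w'\<in>verts G. coincidence_class w' \<and> w \<rightarrow>\<^sup>*\<^bsub>G\<^esub> w'}"

definition coin_subgraph ::
  "(('d::finite, 'c) po_class, 'e) pre_digraph \<Rightarrow> (('d, 'c) po_class, 'e) pre_digraph" where
  "coin_subgraph G = G \<restriction> coin_vertices G"

definition res_subgraph ::
  "(('d::finite, 'c) po_class, 'e) pre_digraph \<Rightarrow> (('d, 'c) po_class, 'e) pre_digraph" where
  "res_subgraph G = G \<restriction> (verts G - coin_vertices G)"

definition adjacency_mat :: "('a, 'e) pre_digraph \<Rightarrow> 'a list \<Rightarrow> complex mat" where
  "adjacency_mat G vs = Matrix.mat (length vs) (length vs)
     (\<lambda>(r, s). of_nat (card {e \<in> arcs G. tail G e = vs ! r \<and> head G e = vs ! s}))"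

text \<open>The spectral radius does not depend on the chosen enumeration of the (finitely many)
  vertices. The empty graph is treated separately because the maximum defining \<open>spectral_radius\<close> is unspecified there.\<close>

definition graph_spectral_radius :: "('a, 'e) pre_digraph \<Rightarrow> real" where
  "graph_spectral_radius G =
     (if verts G = {} then 0
      else spectral_radius (adjacency_mat G (SOME vs. distinct vs \<and> set vs = verts G)))"

end

theory Submission
  imports Defs
begin

text \<open>Let \<open>\<beta>\<close> be the Perron--Frobenius eigenvalue of the substitution matrix, so that a supertile of
  level \<open>n\<close> has of the order of \<open>\<beta>\<^sup>n\<close> tiles. A walk in the graph ends in a pair of tiles of two
  supertiles at bounded distance, hence there are \<open>O(\<beta>\<^sup>n)\<close> walks of length \<open>n\<close>; coincidences alone
  already contribute that many, so the coincidence part has spectral radius \<open>\<beta>\<close>. A genuine overlap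
  has of the order of \<open>\<beta>\<^sup>n\<close> overlapping descendants, whereas a potential overlap without common
  interior only has descendants near the boundary of a supertile, exponentially fewer. Therefore the
  residual part has radius less than \<open>\<beta>\<close> iff every overlap by a translation \<open>Q\<^sup>n \<alpha>\<close>, \<open>\<alpha> \<in> B\<close>, leads
  to a coincidence.

  In that case the tiling and its translate by \<open>Q\<^sup>n \<alpha>\<close> disagree only on an exponentially small
  proportion of tiles. Sums of such vectors are then almost periods, and since \<open>B\<close> is a basis they
  are relatively dense. For a return vector \<open>y\<close> write \<open>Q\<^sup>n y = p + h\<close> with an almost period \<open>p\<close> and
  \<open>h\<close> bounded. By the Meyer property only finitely many \<open>h\<close> occur, so some \<open>h\<close> recurs. As
  \<open>Q\<^sup>n y\<close> maps a supertile of level \<open>n\<close> into the tiling, so does \<open>h\<close> almost; by primitivity \<open>h\<close> and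
  hence \<open>Q\<^sup>n y\<close> are almost periods, and no overlap by \<open>y\<close> can avoid coincidences forever.\<close>

section \<open>Walks and the spectral radius\<close>

text \<open>Sizes are measured by counting descendants, weighted by a left Perron-Frobenius
  eigenvector, so no volume of a tile and no measure of its boundary enters. Exponential smallness
  always comes from one mechanism, \<open>decaying\<close>: a family of descendants closed under
  going m levels up, in which every member loses a descendant within m levels, grows at a rate below
  \<beta>. It serves for points near the boundary of a supertile and for points without a
  counterpart after a translation. The obstacle is the passage from \<open>B\<close> to all return
  vectors. The graph sees only the translations Q^n \<alpha>, and an expansion of Q^n y in digits
  from \<open>B\<close> leaves a remainder that is bounded but not small. This remainder is a return
  vector minus an almost period, and an almost period with a small enough error is itself a return
  vector; so the remainder lies in Xi - Xi, where bounded sets are finite. Few exceptions for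
  infinitely many n then suffice, because a pair that never coincides forces many exceptions for all
  large n.\<close>

primrec walks :: "('a, 'e) pre_digraph \<Rightarrow> nat \<Rightarrow> 'a \<Rightarrow> nat" where
  "walks G 0 v = 1"
| "walks G (Suc n) v = (\<Sum>e | e \<in> arcs G \<and> tail G e = v. walks G n (head G e))"

lemma adjacency_mat_carrier: "adjacency_mat G vs \<in> carrier_mat (length vs) (length vs)"
  by (simp add: adjacency_mat_def)

lemma adjacency_mat_index:
  "r < length vs \<Longrightarrow> s < length vs \<Longrightarrow> adjacency_mat G vs $$ (r, s) =
    of_nat (card {e \<in> arcs G. tail G e = vs ! r \<and> head G e = vs ! s})"
  by (simp add: adjacency_mat_def)

lemma walks_Suc_adjacency:
  assumes "fin_digraph G" "distinct vs" "set vs = verts G"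
  shows "walks G (Suc n) v =
    (\<Sum>s<length vs. card {e \<in> arcs G. tail G e = v \<and> head G e = vs ! s} * walks G n (vs ! s))"
proof -
  interpret fin_digraph G by fact
  let ?E = "{e \<in> arcs G. tail G e = v}"
  have "walks G (Suc n) v = (\<Sum>e\<in>?E. walks G n (head G e))"
    by simp
  also have "\<dots> = (\<Sum>w\<in>verts G. \<Sum>e | e \<in> ?E \<and> head G e = w. walks G n (head G e))"
    by (rule sum.group[symmetric]) auto
  also have "\<dots> = (\<Sum>w\<in>set vs. card {e \<in> arcs G. tail G e = v \<and> head G e = w} * walks G n w)"
    unfolding assms(3) by (intro sum.cong refl) (simp add: conj_assoc)
  also have "\<dots> = (\<Sum>s<length vs.
      card {e \<in> arcs G. tail G e = v \<and> head G e = vs ! s} * walks G n (vs ! s))"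
    by (rule sum.reindex_bij_betw[symmetric, OF bij_betw_nth]) (use assms in auto)
  finally show ?thesis .
qed

text \<open>In absolute value an eigenvector is at most \<open>m\<close> times the all-ones vector,
  and powers of the nonnegative matrix turn the all-ones vector into the walk counts. A coordinate
  where the eigenvector does not vanish gives the bound.\<close>

lemma eigenvalue_walks_bound:
  assumes "fin_digraph G" "distinct vs" "set vs = verts G"
    and "eigenvector (adjacency_mat G vs) v k"
  shows "\<exists>r<length vs. \<exists>c>0. \<forall>n. c * cmod k ^ n \<le> real (walks G n (vs ! r))"
proof -
  let ?M = "adjacency_mat G vs" and ?N = "length vs"
  have v: "v \<in> carrier_vec ?N" "v \<noteq> 0\<^sub>v ?N" and ev: "?M *\<^sub>v v = k \<cdot>\<^sub>v v"
    using assms(4) by (auto simp: eigenvector_def adjacency_mat_def)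
  define f where "f s = vec_index v s" for s
  have "\<exists>r<?N. f r \<noteq> 0"
  proof (rule ccontr)
    assume "\<not> ?thesis"
    then have "v = 0\<^sub>v ?N"
      using v(1) by (intro eq_vecI) (auto simp: f_def)
    with v(2) show False by simp
  qed
  then obtain r where r: "r < ?N" "f r \<noteq> 0" by blast
  define m where "m = Max ((\<lambda>s. cmod (f s)) ` {..<?N})"
  have m: "cmod (f s) \<le> m" if "s < ?N" for s
    unfolding m_def using that by (intro Max_ge) auto
  have step: "k * f q = (\<Sum>s<?N. ?M $$ (q, s) * f s)" if "q < ?N" for q
  proof -
    have "k * f q = vec_index (k \<cdot>\<^sub>v v) q"
      using that v(1) by (simp add: f_def)
    also have "\<dots> = vec_index (?M *\<^sub>v v) q"
      by (simp add: ev)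
    also have "\<dots> = (\<Sum>s<?N. ?M $$ (q, s) * f s)"
      using that v(1) adjacency_mat_carrier[of G vs]
      by (auto simp: scalar_prod_def f_def lessThan_atLeast0 intro!: sum.cong)
    finally show ?thesis .
  qed
  have bound: "cmod k ^ n * cmod (f q) \<le> real (walks G n (vs ! q)) * m" if "q < ?N" for n q
    using that
  proof (induction n arbitrary: q)
    case 0
    then show ?case using m by simp
  next
    case (Suc n)
    let ?a = "\<lambda>s. card {e \<in> arcs G. tail G e = vs ! q \<and> head G e = vs ! s}"
    have "cmod k ^ Suc n * cmod (f q) = cmod k ^ n * cmod (k * f q)"
      by (simp add: norm_mult)
    also have "\<dots> \<le> cmod k ^ n * (\<Sum>s<?N. real (?a s) * cmod (f s))"
      unfolding step[OF Suc.prems]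
      by (intro mult_left_mono sum_norm_le)
        (auto simp: norm_mult adjacency_mat_index[OF Suc.prems])
    also have "\<dots> = (\<Sum>s<?N. real (?a s) * (cmod k ^ n * cmod (f s)))"
      by (simp add: sum_distrib_left mult_ac)
    also have "\<dots> \<le> (\<Sum>s<?N. real (?a s) * (real (walks G n (vs ! s)) * m))"
      by (intro sum_mono mult_left_mono Suc.IH) auto
    also have "\<dots> = real (walks G (Suc n) (vs ! q)) * m"
      unfolding walks_Suc_adjacency[OF assms(1-3)]
      by (simp add: sum_distrib_right sum_distrib_left mult_ac)
    finally show ?case .
  qed
  have mpos: "0 < m"
    using m[OF r(1)] r(2) by (meson less_le_trans zero_less_norm_iff)
  show ?thesis
  proof (intro exI conjI allI)
    show "r < ?N" by fact
    show "0 < cmod (f r) / m" using r mpos by simp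
    show "cmod (f r) / m * cmod k ^ n \<le> real (walks G n (vs ! r))" for n
      using bound[OF r(1), of n] mpos by (simp add: field_simps)
  qed
qed

lemma graph_spectral_radius_eq:
  assumes "fin_digraph G" "verts G \<noteq> {}"
  obtains vs where "distinct vs" "set vs = verts G"
    "graph_spectral_radius G = spectral_radius (adjacency_mat G vs)"
proof -
  interpret fin_digraph G by fact
  let ?vs = "SOME vs. distinct vs \<and> set vs = verts G"
  have "distinct ?vs \<and> set ?vs = verts G"
    using finite_distinct_list[OF finite_verts] by (metis (mono_tags, lifting) someI_ex)
  then show ?thesis
    using that[of ?vs] assms(2) by (simp add: graph_spectral_radius_def)
qed

lemma power_le_imp_le:
  fixes a b c C :: real
  assumes "0 < c" "0 < b" "\<And>n. c * a ^ n \<le> C * b ^ n"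
  shows "a \<le> b"
proof (rule ccontr)
  assume "\<not> a \<le> b"
  then have "1 < a / b" using assms(2) by simp
  then obtain n where "C / c < (a / b) ^ n"
    using real_arch_pow by blast
  then have "C * b ^ n < c * a ^ n"
    using assms(1,2) by (simp add: field_simps power_divide)
  with assms(3)[of n] show False by simp
qed

lemma graph_spectral_radius_le:
  assumes "fin_digraph G" "0 < \<gamma>"
    and "\<And>n v. v \<in> verts G \<Longrightarrow> real (walks G n v) \<le> C * \<gamma> ^ n"
  shows "graph_spectral_radius G \<le> \<gamma>"
proof (cases "verts G = {}")
  case True
  then show ?thesis using assms(2) by (simp add: graph_spectral_radius_def)
next
  case False
  obtain vs where vs: "distinct vs" "set vs = verts G"
    "graph_spectral_radius G = spectral_radius (adjacency_mat G vs)"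
    by (rule graph_spectral_radius_eq[OF assms(1) False])
  have len: "0 < length vs" using False vs(2) by auto
  obtain k where k: "eigenvalue (adjacency_mat G vs) k" "graph_spectral_radius G = cmod k"
    using spectral_radius_mem_max(1)[OF adjacency_mat_carrier len] vs(3)
    by (auto simp: spectrum_def)
  then obtain v where v: "eigenvector (adjacency_mat G vs) v k"
    by (auto simp: eigenvalue_def)
  from eigenvalue_walks_bound[OF assms(1) vs(1,2) v]
  obtain r c where rc: "r < length vs" "0 < c" "\<forall>n. c * cmod k ^ n \<le> real (walks G n (vs ! r))"
    by (elim exE conjE)
  have "vs ! r \<in> verts G" using nth_mem[OF rc(1)] by (simp only: vs(2))
  then have "c * cmod k ^ n \<le> C * \<gamma> ^ n" for n
    using rc(3)[rule_format, of n] assms(3)[of "vs ! r" n] by simp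
  from power_le_imp_le[OF rc(2) assms(2) this] show ?thesis
    by (simp add: k(2))
qed

text \<open>\<open>pow_mat\<close> appends its factors on the right, so the factor next to the
  vector is split off, and the initial length \<open>m\<close> has to vary in the induction.\<close>

lemma mult_mat_vec_walks:
  assumes "fin_digraph G" "distinct vs" "set vs = verts G"
  shows "(adjacency_mat G vs ^\<^sub>m n) *\<^sub>v Matrix.vec (length vs) (\<lambda>s. of_nat (walks G m (vs ! s))) =
    Matrix.vec (length vs) (\<lambda>s. of_nat (walks G (m + n) (vs ! s)))"
proof (induction n arbitrary: m)
  case 0
  then show ?case using adjacency_mat_carrier[of G vs] by simp
next
  case (Suc n)
  let ?M = "adjacency_mat G vs" and ?N = "length vs"
  let ?w = "\<lambda>m. Matrix.vec (length vs) (\<lambda>s. complex_of_nat (walks G m (vs ! s)))"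
  note M = adjacency_mat_carrier[of G vs]
  have step: "?M *\<^sub>v ?w m = ?w (Suc m)"
  proof (rule eq_vecI)
    fix q assume "q < dim_vec (?w (Suc m))"
    then have q: "q < ?N" by simp
    have "vec_index (?M *\<^sub>v ?w m) q = (\<Sum>s<?N. ?M $$ (q, s) * of_nat (walks G m (vs ! s)))"
      using q M by (auto simp: scalar_prod_def lessThan_atLeast0 intro!: sum.cong)
    also have "\<dots> = of_nat (walks G (Suc m) (vs ! q))"
      unfolding walks_Suc_adjacency[OF assms]
      by (simp add: adjacency_mat_index[OF q])
    finally show "vec_index (?M *\<^sub>v ?w m) q = vec_index (?w (Suc m)) q"
      using q by simp
  qed (use M in simp)
  have "(?M ^\<^sub>m Suc n) *\<^sub>v ?w m = (?M ^\<^sub>m n) *\<^sub>v (?M *\<^sub>v ?w m)"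
    unfolding pow_mat.simps
    by (rule assoc_mult_mat_vec[where ?n\<^sub>1.0 = ?N and ?n\<^sub>2.0 = ?N and ?n\<^sub>3.0 = ?N]) (use M in \<open>auto intro: pow_carrier_mat\<close>)
  then show ?case
    using Suc.IH[of "Suc m"] by (simp only: step) simp
qed

lemma spectrum_smult_mat:
  assumes "M \<in> carrier_mat n n" "(a::complex) \<noteq> 0" "k \<in> spectrum (a \<cdot>\<^sub>m M)"
  shows "k / a \<in> spectrum M"
proof -
  obtain v where v: "v \<in> carrier_vec n" "v \<noteq> 0\<^sub>v n" "(a \<cdot>\<^sub>m M) *\<^sub>v v = k \<cdot>\<^sub>v v"
    using assms by (auto simp: spectrum_def eigenvalue_def eigenvector_def)
  have "(a \<cdot>\<^sub>m M) *\<^sub>v v = a \<cdot>\<^sub>v (M *\<^sub>v v)"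
    using v(1) assms(1) by (intro eq_vecI) auto
  with v(3) have "a \<cdot>\<^sub>v (M *\<^sub>v v) = k \<cdot>\<^sub>v v"
    by simp
  then have "(1 / a) \<cdot>\<^sub>v (a \<cdot>\<^sub>v (M *\<^sub>v v)) = (1 / a) \<cdot>\<^sub>v (k \<cdot>\<^sub>v v)"
    by simp
  then have "M *\<^sub>v v = (k / a) \<cdot>\<^sub>v v"
    using assms(2) by (simp add: smult_smult_assoc)
  then show ?thesis
    using v assms(1) by (auto simp: spectrum_def eigenvalue_def eigenvector_def)
qed

lemma smult_pow_mat:
  assumes "M \<in> carrier_mat n n"
  shows "((a::complex) \<cdot>\<^sub>m M) ^\<^sub>m k = (a ^ k) \<cdot>\<^sub>m (M ^\<^sub>m k)"
proof (induction k)
  case 0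
  then show ?case using assms by (intro eq_matI) auto
next
  case (Suc k)
  have "(a \<cdot>\<^sub>m M) ^\<^sub>m Suc k = (a ^ k \<cdot>\<^sub>m (M ^\<^sub>m k)) * (a \<cdot>\<^sub>m M)"
    by (simp add: Suc)
  also have "\<dots> = (a ^ Suc k) \<cdot>\<^sub>m ((M ^\<^sub>m k) * M)"
    using assms pow_carrier_mat[OF assms, of k]
    by (intro eq_matI) (auto simp: mult.assoc)
  finally show ?case by simp
qed

text \<open>After division by \<gamma> the matrix has radius below 1 and its powers are bounded. The
  strict gap absorbs the polynomial factors that Jordan blocks may contribute at the radius
  itself.\<close>

lemma walks_bound:
  assumes "fin_digraph G" "0 < \<gamma>" "graph_spectral_radius G < \<gamma>"
  obtains C where "\<And>n v. v \<in> verts G \<Longrightarrow> real (walks G n v) \<le> C * \<gamma> ^ n"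
proof (cases "verts G = {}")
  case True
  then show ?thesis using that by blast
next
  case False
  obtain vs where vs: "distinct vs" "set vs = verts G"
    "graph_spectral_radius G = spectral_radius (adjacency_mat G vs)"
    by (rule graph_spectral_radius_eq[OF assms(1) False])
  let ?M = "adjacency_mat G vs" and ?N = "length vs"
  note M = adjacency_mat_carrier[of G vs]
  have len: "0 < ?N" using False vs(2) by auto
  define a where "a = complex_of_real (1 / \<gamma>)"
  have a: "a \<noteq> 0" "cmod a = 1 / \<gamma>" using assms(2) by (auto simp: a_def norm_divide)
  have aM: "a \<cdot>\<^sub>m ?M \<in> carrier_mat ?N ?N" using M by simp
  have "spectral_radius (a \<cdot>\<^sub>m ?M) < 1"
  proof -
    obtain k where k: "k \<in> spectrum (a \<cdot>\<^sub>m ?M)" "spectral_radius (a \<cdot>\<^sub>m ?M) = cmod k"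
      using spectral_radius_mem_max(1)[OF aM len] by auto
    have "cmod (k / a) \<le> spectral_radius ?M"
      using spectrum_smult_mat[OF M a(1) k(1)] spectral_radius_mem_max(2)[OF M len] by blast
    then have "cmod k * \<gamma> < \<gamma>"
      using assms(3) vs(3) by (simp add: norm_divide a(2))
    then show ?thesis using assms(2) k(2) by simp
  qed
  from spectral_radius_jnf_norm_bound_less_1_upper_triangular[OF aM this]
  obtain c where c: "\<And>n. norm_bound ((a \<cdot>\<^sub>m ?M) ^\<^sub>m n) c" by blast
  have entry: "cmod ((?M ^\<^sub>m n) $$ (r, s)) \<le> c * \<gamma> ^ n" if "r < ?N" "s < ?N" for n r s
  proof -
    have "cmod (((a \<cdot>\<^sub>m ?M) ^\<^sub>m n) $$ (r, s)) \<le> c"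
      using c[unfolded norm_bound_def, rule_format, of r n s] that
        carrier_matD[OF pow_carrier_mat[OF aM, of n]] by simp
    also have "((a \<cdot>\<^sub>m ?M) ^\<^sub>m n) $$ (r, s) = a ^ n * (?M ^\<^sub>m n) $$ (r, s)"
      using that carrier_matD[OF pow_carrier_mat[OF M, of n]]
      by (simp add: smult_pow_mat[OF M] del: index_mat)
    finally show ?thesis
      using assms(2) a(2) by (simp add: norm_mult norm_power field_simps)
  qed
  have "real (walks G n v) \<le> (real ?N * c) * \<gamma> ^ n" if v: "v \<in> verts G" for n v
  proof -
    obtain r where r: "r < ?N" "vs ! r = v"
      using v vs(2) by (metis in_set_conv_nth)
    \<comment> \<open>There is one walk of length 0 from each vertex, so this is the all-ones vector
      and the product yields row sums.\<close>
    let ?one = "Matrix.vec ?N (\<lambda>s. complex_of_nat (walks G 0 (vs ! s)))"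
    have "complex_of_nat (walks G n v) =
        vec_index (Matrix.vec ?N (\<lambda>s. of_nat (walks G (0 + n) (vs ! s)))) r"
      using r by simp
    also have "\<dots> = vec_index ((?M ^\<^sub>m n) *\<^sub>v ?one) r"
      by (simp only: mult_mat_vec_walks[OF assms(1) vs(1,2)])
    also have "\<dots> = (\<Sum>s<?N. (?M ^\<^sub>m n) $$ (r, s))"
      using r carrier_matD[OF pow_carrier_mat[OF M, of n]]
      by (auto simp: scalar_prod_def lessThan_atLeast0 intro!: sum.cong)
    finally have "real (walks G n v) = cmod (\<Sum>s<?N. (?M ^\<^sub>m n) $$ (r, s))"
      by (metis norm_of_nat)
    also have "\<dots> \<le> (\<Sum>s<?N. c * \<gamma> ^ n)"
      by (intro sum_norm_le entry) (use r in auto)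
    finally show ?thesis by simp
  qed
  then show ?thesis by (rule that)
qed

section \<open>Tiles and supertiles\<close>

lemma linear_funpow: "linear f \<Longrightarrow> linear (f ^^ n)" for f :: "'a::real_vector \<Rightarrow> 'a"
proof (induction n)
  case 0
  then show ?case by (simp add: linear_id del: id_apply)
next
  case (Suc n)
  then show ?case using linear_compose[of "f ^^ n" f] by (simp only: funpow.simps)
qed

text \<open>A nonzero kernel vector, read as a complex vector, would be an eigenvector for 0, which
  is not outside the unit disk.\<close>

lemma expansive_inj:
  assumes "expansive (Q :: real^'d::finite \<Rightarrow> real^'d)"
  shows "inj Q"
proof -
  have lin: "linear Q" using assms by (simp add: expansive_def)
  have "x = 0" if "Q x = 0" for x
  proof (rule ccontr)
    assume "x \<noteq> 0"
    define w :: "complex^'d" where "w = (\<chi> s. complex_of_real (x $ s))"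
    have "w \<noteq> 0" using \<open>x \<noteq> 0\<close> by (simp add: w_def Finite_Cartesian_Product.vec_eq_iff)
    moreover have "(\<chi> r s. complex_of_real (matrix Q $ r $ s)) *v w = 0 *s w"
    proof -
      have "(\<Sum>s\<in>UNIV. complex_of_real (matrix Q $ r $ s) * complex_of_real (x $ s)) = 0" for r
      proof -
        have "(\<Sum>s\<in>UNIV. matrix Q $ r $ s * x $ s) = (matrix Q *v x) $ r"
          by (simp add: matrix_vector_mult_def)
        also have "\<dots> = 0" using that lin by (simp add: matrix_works)
        finally show ?thesis
          by (metis (no_types, lifting) of_real_0 of_real_mult of_real_sum sum.cong)
      qed
      then show ?thesis by (simp add: Finite_Cartesian_Product.vec_eq_iff matrix_vector_mult_def w_def)
    qed
    ultimately have "cmod 0 > 1" using assms unfolding expansive_def by blast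
    then show False by simp
  qed
  then show ?thesis using lin by (simp add: linear_injective_0)
qed

text \<open>Otherwise S is mapped into itself by the translation by u - v, and the orbit of a point
  under it is unbounded. This is why support and colour of a tile determine its coloured
  point.\<close>

lemma translation_compact_eq:
  fixes S :: "'a::real_normed_vector set"
  assumes "compact S" "S \<noteq> {}" "(+) u ` S = (+) v ` S"
  shows "u = v"
proof (rule ccontr)
  assume "u \<noteq> v"
  define g where "g = u - v"
  have g: "g \<noteq> 0" using \<open>u \<noteq> v\<close> by (simp add: g_def)
  have step: "g + s \<in> S" if "s \<in> S" for s
  proof -
    have "u + s \<in> (+) v ` S" using that assms(3) by blast
    then obtain t where "t \<in> S" "u + s = v + t" by auto
    then have "g + s = t" by (simp add: g_def algebra_simps)
    with \<open>t \<in> S\<close> show ?thesis by simp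
  qed
  obtain s where s: "s \<in> S" using assms(2) by blast
  have iter: "of_nat n *\<^sub>R g + s \<in> S" for n
  proof (induction n)
    case (Suc n)
    then show ?case using step[of "of_nat n *\<^sub>R g + s"] by (simp add: algebra_simps)
  qed (use s in simp)
  obtain B where B: "\<And>x. x \<in> S \<Longrightarrow> norm x \<le> B"
    using compact_imp_bounded[OF assms(1)] by (auto simp: bounded_iff)
  obtain n where "B + norm s < real n * norm g"
    using reals_Archimedean3[of "norm g"] g by auto
  moreover have "real n * norm g \<le> norm (of_nat n *\<^sub>R g + s) + norm s"
    using norm_triangle_ineq4[of "of_nat n *\<^sub>R g + s" s] by simp
  ultimately show False using B[OF iter[of n]] by linarith
qed

section \<open>Iterated substitution of coloured points\<close>

lemma Phi_pow_0 [simp]: "Phi_pow Q D 0 x = {x}"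
  by (simp add: Phi_pow_def)

lemma Phi_pow_Suc: "Phi_pow Q D (Suc n) x = (\<Union>y\<in>Phi_pow Q D n x. Phi Q D y)"
  by (simp add: Phi_pow_def)

lemma Phi_pow_1 [simp]: "Phi_pow Q D (Suc 0) x = Phi Q D x"
  by (simp add: Phi_pow_Suc)

lemma Phi_pow_add: "Phi_pow Q D (m + n) x = (\<Union>y\<in>Phi_pow Q D m x. Phi_pow Q D n y)"
  by (induction n) (auto simp: Phi_pow_Suc)

lemma Phi_pow_Suc': "Phi_pow Q D (Suc n) x = (\<Union>y\<in>Phi Q D x. Phi_pow Q D n y)"
  using Phi_pow_add[of Q D 1 n x] by simp

lemma Phi_pow_trans:
  "a \<in> Phi_pow Q D m x \<Longrightarrow> b \<in> Phi_pow Q D n a \<Longrightarrow> b \<in> Phi_pow Q D (m + n) x"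
  by (auto simp: Phi_pow_add)

lemma translate_cpoint_simps [simp]:
  "fst (translate_cpoint g x) = g + fst x" "snd (translate_cpoint g x) = snd x"
  "translate_cpoint 0 x = x"
  "translate_cpoint g (translate_cpoint h x) = translate_cpoint (g + h) x"
  "translate_cpoint g x = translate_cpoint g y \<longleftrightarrow> x = y"
  by (auto simp: translate_cpoint_def algebra_simps prod_eq_iff)

lemma Phi_pow_digits:
  assumes "linear Q"
  shows "Phi_pow Q D n x = {((Q ^^ n) (fst x) + d, i) | d i. d \<in> digits_pow Q D n i (snd x)}"
proof (induction n)
  case 0
  then show ?case by (auto simp: prod_eq_iff split: if_splits)
next
  case (Suc n)
  show ?case (is "_ = ?R")
  proof
    show "Phi_pow Q D (Suc n) x \<subseteq> ?R"
      by (fastforce simp: Phi_pow_Suc Suc Phi_def linear_add[OF assms] algebra_simps)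
    show "?R \<subseteq> Phi_pow Q D (Suc n) x"
    proof clarify
      fix d i assume "d \<in> digits_pow Q D (Suc n) i (snd x)"
      then obtain l e e' where e: "d = e + Q e'" "e \<in> D i l" "e' \<in> digits_pow Q D n l (snd x)"
        by auto
      have "((Q ^^ n) (fst x) + e', l) \<in> Phi_pow Q D n x" using e by (auto simp: Suc)
      moreover have "((Q ^^ Suc n) (fst x) + d, i) \<in> Phi Q D ((Q ^^ n) (fst x) + e', l)"
        using e by (auto simp: Phi_def linear_add[OF assms] algebra_simps)
      ultimately show "((Q ^^ Suc n) (fst x) + d, i) \<in> Phi_pow Q D (Suc n) x"
        by (auto simp: Phi_pow_Suc)
    qed
  qed
qed

lemma Phi_pow_translate:
  assumes "linear Q"
  shows "Phi_pow Q D n (translate_cpoint g x) = translate_cpoint ((Q ^^ n) g) ` Phi_pow Q D n x"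
  by (auto simp: Phi_pow_digits[OF assms] translate_cpoint_def image_iff add.assoc
      linear_add[OF linear_funpow[OF assms]])

lemma finite_digits_pow:
  assumes "\<And>i j. finite (D i j)"
  shows "finite (digits_pow Q D n i (j::'c::finite))"
proof (induction n arbitrary: i)
  case (Suc n)
  have "{d + Q d' | d d'. d \<in> D i l \<and> d' \<in> digits_pow Q D n l j} =
     (\<lambda>(d, d'). d + Q d') ` (D i l \<times> digits_pow Q D n l j)" for l by auto
  then show ?case using Suc assms by auto
qed auto

lemma matrix_power_pos_imp_digits:
  assumes "0 < (((**) (\<chi> i j. card (D i j)) ^^ n) (mat 1) :: nat^'c^'c::finite) $ i $ j"
  shows "digits_pow Q D n i j \<noteq> {}"
  using assms
proof (induction n arbitrary: i)
  case 0
  then show ?case by (auto simp: Finite_Cartesian_Product.mat_def split: if_splits)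
next
  case (Suc n)
  let ?M = "\<chi> i j. card (D i j)"
  have "0 < (\<Sum>l\<in>UNIV. card (D i l) * (((**) ?M ^^ n) (mat 1)) $ l $ j)"
    using Suc.prems unfolding funpow.simps o_apply
    by (subst (asm) matrix_matrix_mult_def) simp
  then obtain l where l: "0 < card (D i l) * (((**) ?M ^^ n) (mat 1)) $ l $ j"
    by (metis (no_types, lifting) gr_zeroI sum.neutral)
  then have "D i l \<noteq> {}" "digits_pow Q D n l j \<noteq> {}"
    using Suc.IH[of l] by auto
  then show ?case by (auto simp del: Union_iff)
qed

section \<open>The tiling as a set of coloured points; descendants and ancestors\<close>

locale meyer_self_affine =
  fixes Q :: "real^'d::finite \<Rightarrow> real^'d"
    and A :: "'c::finite \<Rightarrow> (real^'d) set"
    and D :: "'c \<Rightarrow> 'c \<Rightarrow> (real^'d) set"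
    and T :: "('d, 'c) tile set"
    and k :: nat
  assumes sat: "self_affine_tiling Q A D T"
    and meyer: "meyer_set (Xi T)"
    and k_pos: "k > 0"
    and contr: "onorm (inv_into UNIV Q ^^ k) < 1"
begin

abbreviation L :: "('d, 'c) cpoint set" where "L \<equiv> coloured_points A T"
abbreviation ph :: "nat \<Rightarrow> ('d, 'c) cpoint \<Rightarrow> ('d, 'c) cpoint set" where "ph \<equiv> Phi_pow Q D"
abbreviation tr :: "real^'d \<Rightarrow> ('d, 'c) cpoint \<Rightarrow> ('d, 'c) cpoint" where "tr \<equiv> translate_cpoint"
abbreviation Qi :: "real^'d \<Rightarrow> real^'d" where "Qi \<equiv> inv_into UNIV Q"

definition tset :: "('d, 'c) cpoint \<Rightarrow> (real^'d) set" where
  "tset x = (+) (fst x) ` A (snd x)"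

definition tint :: "('d, 'c) cpoint \<Rightarrow> (real^'d) set" where
  "tint x = interior (tset x)"

text \<open>The points need not belong to \<open>L\<close>: one of them is usually a point of the
  tiling moved back by a return vector.\<close>

definition ov :: "('d, 'c) cpoint \<Rightarrow> ('d, 'c) cpoint \<Rightarrow> bool" where
  "ov x y \<longleftrightarrow> tint x \<inter> tint y \<noteq> {}"

lemma subst: "tile_substitution Q A D"
  and tiling: "is_tiling T"
  and subst_T: "subst_tiles Q A D T = T"
  and T_prototile: "t \<in> T \<Longrightarrow> \<exists>x i. t = translate_tile x (prototile A i)"
  using sat by (auto simp: self_affine_tiling_def)

lemma linear_Q: "linear Q" and inj_Q: "inj Q" and finite_D: "finite (D i j)"
  and compact_A: "compact (A i)" and A_closure: "closure (interior (A i)) = A i"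
  using subst expansive_inj by (auto simp: tile_substitution_def expansive_def is_tile_def prototile_def)

lemma surj_Q: "surj Q"
  using linear_injective_imp_surjective[OF linear_Q inj_Q] by simp

lemma linear_Qn: "linear (Q ^^ n)"
  by (rule linear_funpow[OF linear_Q])

lemma bij_Qn: "bij (Q ^^ n)"
  using inj_Q surj_Q by (simp add: bij_fn bij_def)

lemma linear_Qi: "linear Qi"
  using inj_linear_imp_inv_linear[OF linear_Q inj_Q] .

lemma linear_Qin: "linear (Qi ^^ n)"
  by (rule linear_funpow[OF linear_Qi])

lemma Qi_Q [simp]: "Qi (Q x) = x" and Q_Qi [simp]: "Q (Qi x) = x"
  using inj_Q surj_Q by (auto simp: surj_f_inv_f)

lemma Qin_Qn [simp]: "(Qi ^^ n) ((Q ^^ n) x) = x"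
  by (induction n arbitrary: x) (auto simp: funpow_swap1)

lemma Qn_Qin [simp]: "(Q ^^ n) ((Qi ^^ n) x) = x"
  by (induction n arbitrary: x) (auto simp: funpow_swap1)

lemma tset_image: "(Q ^^ n) ` tset x = (\<Union>a\<in>ph n x. tset a)"
proof (induction n arbitrary: x)
  case (Suc n)
  have "Q ` tset x = (\<Union>a\<in>Phi Q D x. tset a)"
  proof -
    have "Q ` tset x = (+) (Q (fst x)) ` (Q ` A (snd x))"
      by (auto simp: tset_def image_image linear_add[OF linear_Q])
    also have "Q ` A (snd x) = (\<Union>i. \<Union>u\<in>D i (snd x). (+) u ` A i)"
      using subst by (simp add: tile_substitution_def)
    also have "(+) (Q (fst x)) ` (\<Union>i. \<Union>u\<in>D i (snd x). (+) u ` A i) =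
        (\<Union>i. \<Union>u\<in>D i (snd x). tset (Q (fst x) + u, i))"
      by (simp add: tset_def image_UN image_image add.assoc)
    also have "\<dots> = (\<Union>a\<in>Phi Q D x. tset a)"
      by (auto simp: Phi_def)
    finally show ?thesis .
  qed
  then have "(Q ^^ Suc n) ` tset x = (\<Union>a\<in>Phi Q D x. (Q ^^ n) ` tset a)"
    by (simp only: funpow_Suc_right image_comp[symmetric] image_UN)
  then show ?case by (simp add: Suc Phi_pow_Suc' del: funpow.simps)
qed simp

lemma ph_L: "x \<in> L \<Longrightarrow> ph n x \<subseteq> L"
proof (induction n)
  case (Suc n)
  have "Phi Q D y \<subseteq> L" if "y \<in> L" for y
  proof
    fix a assume "a \<in> Phi Q D y"
    then obtain d i where a: "a = (Q (fst y) + d, i)" "d \<in> D i (snd y)" by (auto simp: Phi_def)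
    have "translate_tile (Q (fst y)) (translate_tile d (prototile A i)) \<in> subst_tiles Q A D T"
    proof -
      have "translate_tile (fst y) (prototile A (snd y)) \<in> T"
        using that by (simp add: coloured_points_def case_prod_beta)
      then have "translate_tile (Q (fst y)) ` subst_prototile A D (snd y) \<subseteq> subst_tiles Q A D T"
        unfolding subst_tiles_def by blast
      moreover have "translate_tile d (prototile A i) \<in> subst_prototile A D (snd y)"
        unfolding subst_prototile_def using a(2) by blast
      ultimately show ?thesis by blast
    qed
    then show "a \<in> L"
      by (simp add: subst_T a coloured_points_def translate_tile_def image_image add.assoc)
  qed
  with Suc show ?case by (auto simp: Phi_pow_Suc)
qed simp

lemma ph_colour: "\<exists>m>0. \<forall>x i. \<exists>a\<in>ph m x. snd a = i"
proof -
  obtain m where m: "m > 0" "\<And>i j. 0 < (((**) (\<chi> i j. card (D i j)) ^^ m) (mat 1) :: nat^'c^'c) $ i $ j"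
    using sat by (auto simp: self_affine_tiling_def primitive_substitution_def primitive_matrix_def)
  have "\<exists>a\<in>ph m x. snd a = i" for x i
    using matrix_power_pos_imp_digits[OF m(2), of Q i "snd x"]
    by (fastforce simp: Phi_pow_digits[OF linear_Q])
  with m(1) show ?thesis by blast
qed

lemma ph_nonempty: "ph n x \<noteq> {}"
proof -
  obtain m where m: "m > 0" "\<forall>x i. \<exists>a\<in>ph m x. snd a = i" using ph_colour by blast
  have "Phi Q D y \<noteq> {}" for y
  proof -
    obtain m' where "m = Suc m'" using m(1) gr0_implies_Suc by blast
    with m(2)[rule_format, of y undefined] show ?thesis by (auto simp: Phi_pow_Suc')
  qed
  then show ?thesis by (induction n) (auto simp: Phi_pow_Suc)
qed

lemma finite_ph [simp]: "finite (ph n x)"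
proof -
  have "ph n x = (\<Union>i. (\<lambda>d. ((Q ^^ n) (fst x) + d, i)) ` digits_pow Q D n i (snd x))"
    by (auto simp: Phi_pow_digits[OF linear_Q])
  then show ?thesis by (simp add: finite_digits_pow finite_D)
qed

lemma tile_cover: "\<exists>x\<in>L. p \<in> tset x"
proof -
  have "p \<in> (\<Union>t\<in>T. fst t)" using tiling by (simp add: is_tiling_def)
  then obtain t where t: "t \<in> T" "p \<in> fst t" by blast
  obtain u i where "t = translate_tile u (prototile A i)" using T_prototile[OF t(1)] by blast
  with t show ?thesis
    by (intro bexI[of _ "(u, i)"]) (auto simp: coloured_points_def tset_def translate_tile_def prototile_def)
qed

text \<open>\<open>is_tile\<close> admits the empty set. By primitivity an empty prototile would
  have descendants of every colour, all of them empty, and nothing would cover the space.\<close>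

lemma A_nonempty: "A i \<noteq> {}"
proof
  assume "A i = {}"
  obtain m where m: "\<forall>x i. \<exists>a\<in>ph m x. snd a = i" using ph_colour by blast
  have "tset a = {}" if "a \<in> ph m (0, i)" for a
    using tset_image[of m "(0, i)"] \<open>A i = {}\<close> that by (auto simp: tset_def)
  then have "A j = {}" for j
    using m[rule_format, of "(0, i)" j] by (auto simp: tset_def)
  then show False using tile_cover[of 0] by (auto simp: tset_def)
qed

lemma tset_closure: "tset x = closure (tint x)"
  by (simp add: tset_def tint_def interior_translation closure_translation A_closure)

lemma tint_nonempty: "tint x \<noteq> {}"
  using tset_closure[of x] A_nonempty[of "snd x"] by (auto simp: tset_def)

lemma open_tint: "open (tint x)"
  by (simp add: tint_def)

lemma tint_subset: "tint x \<subseteq> tset x"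
  by (simp add: tint_def interior_subset)

lemma tint_tr: "tint (tr g x) = (+) g ` tint x"
  by (simp add: tint_def tset_def image_image add.assoc interior_translation[symmetric])

lemma ov_tr: "ov (tr g x) (tr g y) \<longleftrightarrow> ov x y"
  by (auto simp: ov_def tint_tr)

lemma ov_sym: "ov x y \<longleftrightarrow> ov y x"
  by (auto simp: ov_def)

lemma ov_refl: "ov x x"
  using tint_nonempty by (simp add: ov_def)

lemma open_Qn: "open U \<Longrightarrow> open ((Q ^^ n) ` U)"
  by (intro open_surjective_linear_image linear_Qn bij_is_surj bij_Qn)

lemma tint_image: "(Q ^^ n) ` tint x = interior ((Q ^^ n) ` tset x)"
  unfolding tint_def
  by (rule interior_injective_linear_image[symmetric]) (use linear_Qn bij_Qn in \<open>auto simp: bij_def\<close>)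

lemma tint_descend: "a \<in> ph n x \<Longrightarrow> tint a \<subseteq> (Q ^^ n) ` tint x"
  unfolding tint_image unfolding tint_def tset_image by (intro interior_mono) auto

text \<open>The interior of a descendant lies in the inflated interior of its ancestor, and Q^n is
  injective, so a common point can be pulled back.\<close>

lemma ov_ancestor:
  assumes "a \<in> ph n x" "b \<in> ph n y" "ov a b"
  shows "ov x y"
proof -
  obtain p where p: "p \<in> tint a" "p \<in> tint b" using assms(3) by (auto simp: ov_def)
  obtain q r where "q \<in> tint x" "p = (Q ^^ n) q" "r \<in> tint y" "p = (Q ^^ n) r"
    using tint_descend[OF assms(1)] tint_descend[OF assms(2)] p by blast
  moreover from this have "q = r" using bij_Qn[of n] by (auto simp: bij_def inj_eq)
  ultimately show ?thesis by (auto simp: ov_def)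
qed

lemma open_meets_tint: "open U \<Longrightarrow> p \<in> U \<Longrightarrow> p \<in> tset x \<Longrightarrow> tint x \<inter> U \<noteq> {}"
  unfolding tset_closure using closure_iff_nhds_not_empty[of p "tint x"] by blast

lemma open_meets_L:
  assumes "open U" "U \<noteq> {}"
  shows "\<exists>x\<in>L. tint x \<inter> U \<noteq> {}"
  using assms tile_cover open_meets_tint by (metis ex_in_conv)

lemma open_meets_ph:
  assumes "open U" "U \<noteq> {}" "U \<subseteq> (Q ^^ n) ` tset x"
  shows "\<exists>a\<in>ph n x. tint a \<inter> U \<noteq> {}"
proof -
  obtain p where p: "p \<in> U" using assms(2) by blast
  then have "p \<in> (\<Union>a\<in>ph n x. tset a)" using assms(3) unfolding tset_image by blast
  then obtain a where "a \<in> ph n x" "p \<in> tset a" by blast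
  with open_meets_tint[OF assms(1) p] show ?thesis by blast
qed

text \<open>Descendants chosen independently may miss each other. So \<open>a\<close> is chosen to
  meet the inflated intersection, and then \<open>b\<close> to meet the open set that
  \<open>a\<close> cuts out of it.\<close>

lemma ov_descend:
  assumes "ov x y"
  obtains a b where "a \<in> ph n x" "b \<in> ph n y" "ov a b"
proof -
  let ?U = "(Q ^^ n) ` (tint x \<inter> tint y)"
  have U: "open ?U" "?U \<noteq> {}" "?U \<subseteq> (Q ^^ n) ` tset x" "?U \<subseteq> (Q ^^ n) ` tset y"
  proof -
    show "open ?U" by (intro open_Qn open_Int open_tint)
    show "?U \<noteq> {}" using assms by (simp add: ov_def)
    show "?U \<subseteq> (Q ^^ n) ` tset x" "?U \<subseteq> (Q ^^ n) ` tset y"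
      using tint_subset[of x] tint_subset[of y] by (auto intro!: image_mono)
  qed
  obtain a where a: "a \<in> ph n x" "tint a \<inter> ?U \<noteq> {}"
    using open_meets_ph[OF U(1-3)] by blast
  have "open (tint a \<inter> ?U)" using open_tint U(1) by blast
  then obtain b where "b \<in> ph n y" "tint b \<inter> (tint a \<inter> ?U) \<noteq> {}"
    using open_meets_ph[of "tint a \<inter> ?U" n y] a(2) U(4) by blast
  with a(1) show ?thesis by (intro that[of a b]) (auto simp: ov_def)
qed

lemma L_ov_eq:
  assumes "x \<in> L" "y \<in> L" "ov x y"
  shows "x = y"
proof -
  have xy: "(tset x, snd x) \<in> T" "(tset y, snd y) \<in> T"
    using assms by (auto simp: coloured_points_def tset_def translate_tile_def prototile_def)
  have "tset x = tset y" "snd x = snd y"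
  proof -
    have "(tset x, snd x) = (tset y, snd y)"
    proof (rule ccontr)
      assume "\<not> ?thesis"
      with xy have "interior (tset x) \<inter> interior (tset y) = {}"
        using tiling unfolding is_tiling_def disjoint_interiors_def by (metis fst_conv)
      with assms(3) show False by (simp add: ov_def tint_def)
    qed
    then show "tset x = tset y" "snd x = snd y" by simp_all
  qed
  then show ?thesis
    using translation_compact_eq[OF compact_A A_nonempty] by (simp add: tset_def prod_eq_iff)
qed

lemma L_parent:
  assumes "b \<in> L"
  shows "\<exists>x\<in>L. b \<in> ph n x"
  using assms
proof (induction n arbitrary: b)
  case (Suc n)
  obtain x where x: "x \<in> L" "b \<in> ph n x" using Suc by blast
  let ?t = "translate_tile (fst x) (prototile A (snd x))"
  have "?t \<in> subst_tiles Q A D T"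
    using x(1) by (simp add: subst_T coloured_points_def case_prod_beta)
  then obtain u j d i where y: "(u, j) \<in> L" "d \<in> D i j"
    "?t = translate_tile (Q u) (translate_tile d (prototile A i))"
    by (auto simp: subst_tiles_def subst_prototile_def coloured_points_def)
  then have i: "i = snd x" and "(+) (fst x) ` A i = (+) (Q u + d) ` A i"
    by (auto simp: translate_tile_def prototile_def image_image add.assoc)
  then have "fst x = Q u + d"
    using translation_compact_eq[OF compact_A A_nonempty] by blast
  then have "x \<in> Phi Q D (u, j)"
    using y(2) i by (auto simp: Phi_def prod_eq_iff)
  then show ?case using y(1) x(2) by (auto simp: Phi_pow_Suc')
qed auto

text \<open>\<open>x\<close> and \<open>y\<close> need only lie in a common translate of the tiling,
  as the first members of the pairs in the graph do.\<close>

lemma ph_disjoint: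
  assumes "tr g x \<in> L" "tr g y \<in> L" "a \<in> ph n x" "a \<in> ph n y"
  shows "x = y"
  using L_ov_eq[OF assms(1,2)] ov_ancestor[OF assms(3,4) ov_refl] by (simp add: ov_tr)

lemma ph_unique: "x \<in> L \<Longrightarrow> y \<in> L \<Longrightarrow> a \<in> ph n x \<Longrightarrow> a \<in> ph n y \<Longrightarrow> x = y"
  using ph_disjoint[of 0] by simp

lemma ph_tr: "ph n (tr g x) = tr ((Q ^^ n) g) ` ph n x"
  by (rule Phi_pow_translate[OF linear_Q])

text \<open>\<open>b\<close> has some ancestor y in \<open>L\<close>. Pulled back, the interior of
  \<open>b\<close> lies in both x and y, so these overlap and are equal.\<close>

lemma ph_tint_unique:
  assumes "x \<in> L" "b \<in> L" "tint b \<subseteq> (Q ^^ n) ` tint x"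
  shows "b \<in> ph n x"
proof -
  obtain y where y: "y \<in> L" "b \<in> ph n y" using L_parent[OF assms(2)] by blast
  have "tint b \<subseteq> (Q ^^ n) ` tint y" by (rule tint_descend[OF y(2)])
  with assms(3) have "tint b \<subseteq> (Q ^^ n) ` (tint x \<inter> tint y)"
    using bij_Qn[of n] by (simp add: bij_def image_Int)
  then have "ov x y" using tint_nonempty[of b] by (auto simp: ov_def)
  with L_ov_eq[OF assms(1) y(1)] y(2) show ?thesis by simp
qed

section \<open>Metric estimates and local finiteness\<close>

lemma ex_tile_radius: "\<exists>a>0. \<forall>i. \<forall>p\<in>A i. norm p \<le> a"
proof -
  have "bounded (\<Union>i. A i)"
    using compact_A by (intro bounded_UN finite_class.finite_UNIV ballI compact_imp_bounded)
  then show ?thesis unfolding bounded_pos by auto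
qed

definition tile_radius :: real where
  "tile_radius = (SOME a. a > 0 \<and> (\<forall>i. \<forall>p\<in>A i. norm p \<le> a))"

lemma tile_radius_pos: "tile_radius > 0"
  and tile_radius: "p \<in> A i \<Longrightarrow> norm p \<le> tile_radius"
  using someI_ex[OF ex_tile_radius] by (auto simp: tile_radius_def)

lemma tset_dist: "p \<in> tset x \<Longrightarrow> norm (p - fst x) \<le> tile_radius"
  using tile_radius by (auto simp: tset_def)

lemma tint_dist: "p \<in> tint x \<Longrightarrow> norm (p - fst x) \<le> tile_radius"
  using tset_dist tint_subset by blast

lemma ov_dist:
  assumes "ov x y"
  shows "norm (fst x - fst y) \<le> 2 * tile_radius"
proof -
  obtain p where p: "p \<in> tint x" "p \<in> tint y" using assms by (auto simp: ov_def)
  have "norm (fst x - fst y) \<le> norm (p - fst y) + norm (p - fst x)"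
    using norm_triangle_ineq4[of "p - fst y" "p - fst x"] by (simp add: algebra_simps)
  then show ?thesis using tint_dist[OF p(1)] tint_dist[OF p(2)] by linarith
qed

lemma bounded_linear_Qin: "bounded_linear (Qi ^^ n)"
  using linear_Qin by (simp add: linear_conv_bounded_linear)

lemma Qin_le: "norm ((Qi ^^ n) v) \<le> onorm (Qi ^^ n) * norm v"
  by (rule onorm[OF bounded_linear_Qin])

lemma onorm_Qin_nonneg: "0 \<le> onorm (Qi ^^ n)"
  by (rule onorm_pos_le[OF bounded_linear_Qin])

text \<open>Only the k-th power of the inverse is known to contract, so n is divided by k and the
  finitely many remainders are absorbed by the constant.\<close>

lemma Qin_decay:
  obtains C where "C > 0" "\<And>n v. norm ((Qi ^^ n) v) \<le> C * onorm (Qi ^^ k) ^ (n div k) * norm v"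
proof -
  let ?r = "onorm (Qi ^^ k)"
  define C where "C = 1 + (\<Sum>s<k. onorm (Qi ^^ s))"
  have C: "onorm (Qi ^^ s) \<le> C" if "s < k" for s
    using member_le_sum[of s "{..<k}" "\<lambda>s. onorm (Qi ^^ s)"] that onorm_Qin_nonneg
    by (simp add: C_def)
  have "C > 0"
    unfolding C_def by (intro add_pos_nonneg sum_nonneg onorm_Qin_nonneg) simp
  have pow: "norm ((Qi ^^ (k * q)) v) \<le> ?r ^ q * norm v" for q v
  proof (induction q)
    case (Suc q)
    have "(Qi ^^ (k * Suc q)) v = (Qi ^^ k) ((Qi ^^ (k * q)) v)"
      by (simp add: funpow_add)
    then have "norm ((Qi ^^ (k * Suc q)) v) \<le> ?r * norm ((Qi ^^ (k * q)) v)"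
      using Qin_le by simp
    also have "\<dots> \<le> ?r * (?r ^ q * norm v)"
      by (intro mult_left_mono Suc onorm_Qin_nonneg)
    finally show ?case by simp
  qed simp
  have "norm ((Qi ^^ n) v) \<le> C * ?r ^ (n div k) * norm v" for n v
  proof -
    have "(Qi ^^ n) v = (Qi ^^ (n mod k)) ((Qi ^^ (k * (n div k))) v)"
      by (metis add.commute comp_apply funpow_add mult_div_mod_eq)
    then have "norm ((Qi ^^ n) v) \<le> onorm (Qi ^^ (n mod k)) * norm ((Qi ^^ (k * (n div k))) v)"
      using Qin_le by simp
    also have "\<dots> \<le> C * (?r ^ (n div k) * norm v)"
      using k_pos \<open>C > 0\<close> by (intro mult_mono C pow) auto
    finally show ?thesis by simp
  qed
  with \<open>C > 0\<close> show ?thesis by (rule that)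
qed

lemma Qin_bounded: "\<exists>C>0. \<forall>n v. norm ((Qi ^^ n) v) \<le> C * norm v"
proof -
  obtain C where C: "C > 0" "\<And>n v. norm ((Qi ^^ n) v) \<le> C * onorm (Qi ^^ k) ^ (n div k) * norm v"
    using Qin_decay by blast
  have "norm ((Qi ^^ n) v) \<le> C * norm v" for n v
  proof -
    have "C * onorm (Qi ^^ k) ^ (n div k) * norm v \<le> C * 1 * norm v"
      using C(1) contr onorm_Qin_nonneg
      by (intro mult_right_mono mult_left_mono power_le_one) auto
    with C(2)[of n v] show ?thesis by simp
  qed
  with C(1) show ?thesis by blast
qed

lemma Qin_small:
  assumes "\<epsilon> > 0"
  shows "\<exists>m. \<forall>n\<ge>m. \<forall>v. norm ((Qi ^^ n) v) \<le> \<epsilon> * norm v"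
proof -
  let ?r = "onorm (Qi ^^ k)"
  obtain C where C: "C > 0" "\<And>n v. norm ((Qi ^^ n) v) \<le> C * ?r ^ (n div k) * norm v"
    using Qin_decay by blast
  obtain q where q: "?r ^ q < \<epsilon> / C"
    using real_arch_pow_inv[of "\<epsilon> / C" ?r] contr assms C(1) by auto
  have "norm ((Qi ^^ n) v) \<le> \<epsilon> * norm v" if "n \<ge> k * q" for n v
  proof -
    have "q \<le> n div k"
      using that k_pos by (simp add: less_eq_div_iff_mult_less_eq mult.commute)
    then have "?r ^ (n div k) \<le> ?r ^ q"
      using contr onorm_Qin_nonneg by (intro power_decreasing) auto
    then have "C * ?r ^ (n div k) \<le> C * ?r ^ q"
      using C(1) by (intro mult_left_mono) auto
    also have "\<dots> \<le> \<epsilon>"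
      using q C(1) by (simp add: field_simps)
    finally have "C * ?r ^ (n div k) \<le> \<epsilon>" .
    then have "C * ?r ^ (n div k) * norm v \<le> \<epsilon> * norm v"
      by (intro mult_right_mono) auto
    with C(2)[of n v] show ?thesis by simp
  qed
  then show ?thesis by blast
qed

lemma Qn_contains_ball:
  assumes "open U" "U \<noteq> {}" "\<rho> > 0"
  shows "\<exists>m. \<forall>n\<ge>m. \<exists>p. ball p \<rho> \<subseteq> (Q ^^ n) ` U"
proof -
  obtain p e where p: "e > 0" "ball p e \<subseteq> U"
    using assms(1,2) open_contains_ball by blast
  obtain m where m: "\<And>n v. n \<ge> m \<Longrightarrow> norm ((Qi ^^ n) v) \<le> e / \<rho> * norm v"
    using Qin_small[of "e / \<rho>"] p(1) assms(3) by auto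
  have "ball ((Q ^^ n) p) \<rho> \<subseteq> (Q ^^ n) ` U" if "n \<ge> m" for n
  proof
    fix q assume q: "q \<in> ball ((Q ^^ n) p) \<rho>"
    let ?v = "(Qi ^^ n) (q - (Q ^^ n) p)"
    have "norm ?v \<le> e / \<rho> * norm (q - (Q ^^ n) p)" by (rule m[OF that])
    also have "\<dots> < e / \<rho> * \<rho>"
      using q p(1) assms(3) by (intro mult_strict_left_mono) (auto simp: dist_norm norm_minus_commute)
    finally have "p + ?v \<in> U" using p(2) assms(3) by (auto simp: dist_norm)
    moreover have "(Q ^^ n) (p + ?v) = q" by (simp add: linear_add[OF linear_Qn])
    ultimately show "q \<in> (Q ^^ n) ` U" by (metis image_eqI)
  qed
  then show ?thesis by blast
qed

section \<open>Finiteness from the Meyer property\<close>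

abbreviation Xid :: "(real^'d) set" where
  "Xid \<equiv> {x - y | x y. x \<in> Xi T \<and> y \<in> Xi T}"

text \<open>The Meyer hypothesis enters the proof only through this finiteness.\<close>

lemma finite_Xid: "finite {h \<in> Xid. norm h \<le> \<rho>}"
proof -
  have "uniform_discrete {h \<in> Xid. norm h \<le> \<rho>}"
    by (rule uniform_discrete_subset[of Xid]) (use meyer in \<open>auto simp: meyer_set_def\<close>)
  moreover have "bounded {h \<in> Xid. norm h \<le> \<rho>}" by (auto simp: bounded_iff)
  ultimately show ?thesis using uniform_discrete_finite_iff by blast
qed

lemma Xi_iff: "g \<in> Xi T \<longleftrightarrow> (\<exists>x\<in>L. tr g x \<in> L)"
proof
  assume "g \<in> Xi T"
  then obtain t where t: "t \<in> T" "translate_tile g t \<in> T" by (auto simp: Xi_def)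
  obtain u i where "t = translate_tile u (prototile A i)" using T_prototile[OF t(1)] by blast
  with t show "\<exists>x\<in>L. tr g x \<in> L"
    by (intro bexI[of _ "(u, i)"])
      (auto simp: coloured_points_def translate_tile_def translate_cpoint_def image_image add.assoc)
next
  assume "\<exists>x\<in>L. tr g x \<in> L"
  then obtain x where x: "x \<in> L" "tr g x \<in> L" by blast
  let ?t = "translate_tile (fst x) (prototile A (snd x))"
  have "?t \<in> T" "translate_tile g ?t \<in> T"
    using x by (simp_all add: coloured_points_def case_prod_beta translate_tile_def image_image add.assoc)
  then show "g \<in> Xi T" unfolding Xi_def by blast
qed

lemma colour_diff_Xi:
  assumes "x \<in> L" "y \<in> L" "snd x = snd y"
  shows "fst x - fst y \<in> Xi T"
proof -
  have "tr (fst x - fst y) y = x" using assms(3) by (simp add: prod_eq_iff)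
  with assms show ?thesis unfolding Xi_iff by metis
qed

lemma L_nonempty: "\<exists>x. x \<in> L"
  using tile_cover by blast

lemma zero_Xi: "0 \<in> Xi T"
  using L_nonempty by (auto simp: Xi_iff)

lemma Q_Xi: "g \<in> Xi T \<Longrightarrow> (Q ^^ n) g \<in> Xi T"
proof -
  assume "g \<in> Xi T"
  then obtain x where x: "x \<in> L" "tr g x \<in> L" by (auto simp: Xi_iff)
  obtain a where a: "a \<in> ph n x" using ph_nonempty[of n x] by blast
  then have "a \<in> L" "tr ((Q ^^ n) g) a \<in> L"
    using ph_L[OF x(1), of n] ph_L[OF x(2), of n] by (auto simp: ph_tr)
  then show "(Q ^^ n) g \<in> Xi T" by (auto simp: Xi_iff)
qed

text \<open>Points of one colour differ by elements of Xi, hence of Xi - Xi because 0 is in Xi.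
  Relative to one point of its colour, each point of the ball is given by one of finitely many
  vectors, whose number does not depend on the centre.\<close>

lemma L_locally_finite:
  "\<exists>K. \<forall>p. finite {x \<in> L. norm (fst x - p) \<le> \<rho>} \<and> card {x \<in> L. norm (fst x - p) \<le> \<rho>} \<le> K"
proof -
  let ?H = "{h \<in> Xid. norm h \<le> 2 * \<rho>}"
  have col: "finite {x \<in> L. norm (fst x - p) \<le> \<rho> \<and> snd x = i} \<and>
      card {x \<in> L. norm (fst x - p) \<le> \<rho> \<and> snd x = i} \<le> card ?H" for p i
  proof (cases "{x \<in> L. norm (fst x - p) \<le> \<rho> \<and> snd x = i} = {}")
    case True
    show ?thesis unfolding True by simp
  next
    case False
    then obtain x0 where x0: "x0 \<in> L" "norm (fst x0 - p) \<le> \<rho>" "snd x0 = i" by blast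
    have "{x \<in> L. norm (fst x - p) \<le> \<rho> \<and> snd x = i} \<subseteq> (\<lambda>h. tr h x0) ` ?H"
    proof
      fix x assume x: "x \<in> {x \<in> L. norm (fst x - p) \<le> \<rho> \<and> snd x = i}"
      have "fst x - fst x0 \<in> Xid"
      proof -
        have "fst x - fst x0 \<in> Xi T" using x x0 by (intro colour_diff_Xi) auto
        with zero_Xi have "(fst x - fst x0) - 0 \<in> Xid" by blast
        then show ?thesis by simp
      qed
      moreover have "norm (fst x - fst x0) \<le> 2 * \<rho>"
        using norm_triangle_ineq4[of "fst x - p" "fst x0 - p"] x x0 by simp
      moreover have "x = tr (fst x - fst x0) x0" using x x0 by (simp add: prod_eq_iff)
      ultimately show "x \<in> (\<lambda>h. tr h x0) ` ?H" by blast
    qed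
    then show ?thesis
      using finite_Xid[of "2 * \<rho>"] by (meson card_image_le card_mono finite_imageI finite_subset le_trans)
  qed
  have "{x \<in> L. norm (fst x - p) \<le> \<rho>} = (\<Union>i. {x \<in> L. norm (fst x - p) \<le> \<rho> \<and> snd x = i})" for p
    by blast
  moreover have "card (\<Union>i. {x \<in> L. norm (fst x - p) \<le> \<rho> \<and> snd x = i}) \<le> CARD('c) * card ?H" for p
  proof -
    have "card (\<Union>i. {x \<in> L. norm (fst x - p) \<le> \<rho> \<and> snd x = i}) \<le>
        (\<Sum>i\<in>UNIV. card {x \<in> L. norm (fst x - p) \<le> \<rho> \<and> snd x = i})"
      by (rule card_UN_le) simp
    also have "\<dots> \<le> (\<Sum>i::'c\<in>UNIV. card ?H)"
      by (intro sum_mono conjunct2[OF col])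
    finally show ?thesis by simp
  qed
  ultimately show ?thesis using col by (intro exI[of _ "CARD('c) * card ?H"]) auto
qed

text \<open>The tile containing \<open>(Qi ^^ m) p\<close> has, by primitivity, a level-m descendant
  of each colour, and Q^m with m fixed stretches the distances involved by a bounded factor.\<close>

lemma L_relatively_dense: "\<exists>r>0. \<forall>p i. \<exists>x\<in>L. snd x = i \<and> norm (fst x - p) \<le> r"
proof -
  obtain m where m: "\<forall>x i. \<exists>a\<in>ph m x. snd a = i" using ph_colour by blast
  have "bounded (\<Union>i. \<Union>j. digits_pow Q D m i j)"
    by (intro finite_imp_bounded finite_UN_I finite_class.finite_UNIV finite_digits_pow finite_D)
  then obtain b where b': "\<forall>d\<in>\<Union>i. \<Union>j. digits_pow Q D m i j. norm d \<le> b"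
    by (auto simp only: bounded_iff)
  have b: "norm d \<le> b" if "d \<in> digits_pow Q D m i j" for i j d
    using b' that by blast
  obtain c where c: "c > 0" "\<And>v. norm ((Q ^^ m) v) \<le> norm v * c"
    using bounded_linear.pos_bounded linear_Qn[of m] by (auto simp: linear_conv_bounded_linear)
  let ?r = "tile_radius * c + \<bar>b\<bar>"
  have "\<exists>x\<in>L. snd x = i \<and> norm (fst x - p) \<le> ?r" for p i
  proof -
    obtain y where y: "y \<in> L" "(Qi ^^ m) p \<in> tset y" using tile_cover by blast
    obtain x where x: "x \<in> ph m y" "snd x = i" using m by blast
    then obtain d where d: "fst x = (Q ^^ m) (fst y) + d" "norm d \<le> b"
      using b by (auto simp: Phi_pow_digits[OF linear_Q])
    have "fst x - p = d - (Q ^^ m) ((Qi ^^ m) p - fst y)"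
      using d(1) by (simp add: linear_diff[OF linear_Qn])
    then have "norm (fst x - p) \<le> norm d + norm ((Q ^^ m) ((Qi ^^ m) p - fst y))"
      by (simp add: norm_triangle_ineq4)
    also have "\<dots> \<le> \<bar>b\<bar> + tile_radius * c"
      using d(2) c(2)[of "(Qi ^^ m) p - fst y"] mult_right_mono[OF tset_dist[OF y(2)], of c] c(1)
      by linarith
    finally show ?thesis using x ph_L[OF y(1)] by (intro bexI[of _ x]) auto
  qed
  moreover have "?r > 0" using c(1) tile_radius_pos by (simp add: add_pos_nonneg)
  ultimately show ?thesis by blast
qed

text \<open>The class of an overlap whose translation has already been subtracted from its first
  point.\<close>

definition cls :: "('d, 'c) cpoint \<Rightarrow> ('d, 'c) cpoint \<Rightarrow> ('d, 'c) po_class" where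
  "cls x y = (snd x, fst x - fst y, snd y)"

text \<open>Lagarias' argument: up to the bounded corrections by points of one fixed colour, the
  difference \<open>fst x - fst y\<close> lies in \<open>Xi - Xi\<close>.\<close>

lemma finite_cls:
  "finite {cls x y | x y. y \<in> L \<and> (\<exists>g\<in>Xi T. tr g x \<in> L) \<and> norm (fst x - fst y) \<le> \<rho>}"
proof -
  obtain r where r: "r > 0" "\<And>p i. \<exists>x\<in>L. snd x = i \<and> norm (fst x - p) \<le> r"
    using L_relatively_dense by blast
  define F where "F = (\<Union>i. \<Union>j. {fst x - fst y | x y. x \<in> L \<and> y \<in> L \<and> snd x = i \<and> snd y = j \<and>
      norm (fst x - fst y) \<le> r})"
  have "finite {fst x - fst y | x y. x \<in> L \<and> y \<in> L \<and> snd x = i \<and> snd y = j \<and>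
      norm (fst x - fst y) \<le> r}" (is "finite ?F") for i j
  proof -
    \<comment> \<open>Two fixed reference points turn a difference between different colours into an
      element of Xi - Xi, up to a constant.\<close>
    obtain a b where ab: "a \<in> L" "snd a = i" "b \<in> L" "snd b = j" using r(2) by metis
    have "?F \<subseteq> (\<lambda>h. fst a - fst b + h) ` {h \<in> Xid. norm h \<le> r + norm (fst a - fst b)}"
    proof
      fix f assume "f \<in> ?F"
      then obtain x y where xy: "x \<in> L" "y \<in> L" "snd x = i" "snd y = j" "f = fst x - fst y" "norm f \<le> r"
        by auto
      let ?h = "(fst x - fst a) - (fst y - fst b)"
      have "?h \<in> Xid"
        using colour_diff_Xi[of x a] colour_diff_Xi[of y b] xy(1-4) ab by auto
      moreover have h: "f = fst a - fst b + ?h" using xy by simp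
      moreover have "norm ?h \<le> r + norm (fst a - fst b)"
      proof -
        have "?h = f - (fst a - fst b)" using xy(5) by simp
        then have "norm ?h \<le> norm f + norm (fst a - fst b)"
          by (simp only: norm_triangle_ineq4)
        then show ?thesis using xy(6) by linarith
      qed
      ultimately show "f \<in> (\<lambda>h. fst a - fst b + h) ` {h \<in> Xid. norm h \<le> r + norm (fst a - fst b)}"
        by blast
    qed
    then show ?thesis using finite_Xid finite_surj by blast
  qed
  then have F: "finite F" by (simp add: F_def)
  let ?H = "{h \<in> Xid. norm h \<le> \<rho> + 2 * r}"
  let ?S = "{cls x y | x y. y \<in> L \<and> (\<exists>g\<in>Xi T. tr g x \<in> L) \<and> norm (fst x - fst y) \<le> \<rho>}"
  have "?S \<subseteq> (\<lambda>(i, a, b, h, j). (i, a - b + h, j)) ` (UNIV \<times> F \<times> F \<times> ?H \<times> UNIV)"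
  proof
    fix s assume "s \<in> ?S"
    then obtain x y g where s: "s = cls x y" and y: "y \<in> L" and g: "g \<in> Xi T" and x: "tr g x \<in> L"
      and n: "norm (fst x - fst y) \<le> \<rho>" by blast
    obtain z where z: "z \<in> L" "tr g z \<in> L" using g by (auto simp: Xi_iff)
    obtain x1 where x1: "x1 \<in> L" "snd x1 = snd z" "norm (fst x1 - fst (tr g x)) \<le> r" using r(2) by blast
    obtain y1 where y1: "y1 \<in> L" "snd y1 = snd z" "norm (fst y1 - fst y) \<le> r" using r(2) by blast
    define a where "a = fst (tr g x) - fst x1"
    define b where "b = fst y - fst y1"
    \<comment> \<open>\<open>x1\<close> is compared with the translate of \<open>z\<close> and
      \<open>y1\<close> with \<open>z\<close> itself: both differences are return vectors, and the
      \<open>g\<close> in \<open>a\<close> cancels against the \<open>g\<close> in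
      \<open>h\<close>.\<close>
    define h where "h = (fst x1 - fst (tr g z)) - (fst y1 - fst z)"
    have na: "norm a \<le> r" using x1(3) unfolding a_def by (simp only: norm_minus_commute)
    have nb: "norm b \<le> r" using y1(3) unfolding b_def by (simp only: norm_minus_commute)
    have "a \<in> F" using x x1(1) na unfolding F_def a_def by blast
    moreover have "b \<in> F" using y y1(1) nb unfolding F_def b_def by blast
    moreover have eq: "fst x - fst y = a - b + h" by (simp add: a_def b_def h_def)
    moreover have "h \<in> Xid"
    proof -
      have "fst x1 - fst (tr g z) \<in> Xi T" "fst y1 - fst z \<in> Xi T"
        using colour_diff_Xi[OF x1(1) z(2)] colour_diff_Xi[OF y1(1) z(1)] x1(2) y1(2) by simp_all
      then show ?thesis unfolding h_def by blast
    qed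
    moreover have "norm h \<le> \<rho> + 2 * r"
    proof -
      have "h = (fst x - fst y) - (a - b)" using eq by simp
      then have "norm h \<le> norm (fst x - fst y) + norm (a - b)" by (simp add: norm_triangle_ineq4)
      moreover have "norm (a - b) \<le> norm a + norm b" by (rule norm_triangle_ineq4)
      ultimately show ?thesis using n na nb by linarith
    qed
    ultimately show "s \<in> (\<lambda>(i, a, b, h, j). (i, a - b + h, j)) ` (UNIV \<times> F \<times> F \<times> ?H \<times> UNIV)"
      unfolding s cls_def by (intro image_eqI[of _ _ "(snd x, a, b, h, snd y)"]) auto
  qed
  then show ?thesis
    by (rule finite_subset) (intro finite_imageI finite_cartesian_product F finite_Xid finite_class.finite_UNIV)
qed

section \<open>The radius R bounds all overlaps\<close>

lemma ph_diff_spread: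
  assumes "a \<in> ph k x" "b \<in> ph k y"
  shows "norm ((Q ^^ k) (fst x - fst y)) \<le> norm (fst a - fst b) + digit_spread Q D k"
proof -
  obtain d where d: "fst a = (Q ^^ k) (fst x) + d" "d \<in> digits_pow Q D k (snd a) (snd x)"
    using assms(1) by (auto simp: Phi_pow_digits[OF linear_Q])
  obtain e where e: "fst b = (Q ^^ k) (fst y) + e" "e \<in> digits_pow Q D k (snd b) (snd y)"
    using assms(2) by (auto simp: Phi_pow_digits[OF linear_Q])
  let ?S = "{norm (d - d') | d d' i j p q. d \<in> digits_pow Q D k i j \<and> d' \<in> digits_pow Q D k p q}"
  let ?U = "\<Union>i. \<Union>j. digits_pow Q D k i j"
  have "?S \<subseteq> (\<lambda>(d, d'). norm (d - d')) ` (?U \<times> ?U)"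
  proof clarify
    fix d d' i j p q assume "d \<in> digits_pow Q D k i j" "d' \<in> digits_pow Q D k p q"
    then have "(d, d') \<in> ?U \<times> ?U" by blast
    then show "norm (d - d') \<in> (\<lambda>(d, d'). norm (d - d')) ` (?U \<times> ?U)" by force
  qed
  moreover have "finite ?U" by (simp add: finite_digits_pow finite_D)
  ultimately have fin: "finite ?S" by (meson finite_SigmaI finite_surj)
  have "norm (d - e) \<le> digit_spread Q D k"
    unfolding digit_spread_def by (rule Max_ge[OF fin]) (use d e in blast)
  moreover have "(Q ^^ k) (fst x - fst y) = (fst a - fst b) - (d - e)"
    by (simp add: d(1) e(1) linear_diff[OF linear_Qn])
  ultimately show ?thesis
    using norm_triangle_ineq4[of "fst a - fst b" "d - e"] by simp
qed

text \<open>With r the norm of the k-th power of the inverse and e the digit spread, R is the fixed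
  point of t -> r (t + e). Hence an excess over R is at most r^n times the excess of some
  overlapping descendants k n levels below, and that excess is bounded because overlapping tiles
  stay within two tile radii.\<close>

lemma ov_overlap_radius:
  assumes "ov x y"
  shows "norm (fst x - fst y) \<le> overlap_radius Q D k"
proof (rule ccontr)
  let ?r = "onorm (Qi ^^ k)" and ?e = "digit_spread Q D k" and ?R = "overlap_radius Q D k"
  define t where "t = norm (fst x - fst y) - ?R"
  assume "\<not> ?thesis"
  then have t: "t > 0" by (simp add: t_def)
  have R: "?R = ?r * ?e + ?r * ?R"
    using contr by (simp add: overlap_radius_def field_simps)
  have ex: "\<exists>a b. ov a b \<and> t \<le> ?r ^ n * (norm (fst a - fst b) - ?R)" for n
  proof (induction n)
    case 0
    show ?case using assms by (intro exI[of _ x] exI[of _ y]) (simp add: t_def)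
  next
    case (Suc n)
    then obtain a b where ab: "ov a b" "t \<le> ?r ^ n * (norm (fst a - fst b) - ?R)" by blast
    obtain a' b' where ab': "a' \<in> ph k a" "b' \<in> ph k b" "ov a' b'" using ov_descend[OF ab(1)] by blast
    have "norm (fst a - fst b) \<le> ?r * norm ((Q ^^ k) (fst a - fst b))"
      using Qin_le[of k "(Q ^^ k) (fst a - fst b)"] by simp
    also have "\<dots> \<le> ?r * (norm (fst a' - fst b') + ?e)"
      by (intro mult_left_mono ph_diff_spread ab' onorm_Qin_nonneg)
    finally have "norm (fst a - fst b) - ?R \<le> ?r * (norm (fst a' - fst b') - ?R)"
      using R by (simp add: algebra_simps)
    then have "?r ^ n * (norm (fst a - fst b) - ?R) \<le> ?r ^ n * (?r * (norm (fst a' - fst b') - ?R))"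
      by (intro mult_left_mono zero_le_power onorm_Qin_nonneg)
    with ab(2) ab'(3) show ?case by (intro exI[of _ a'] exI[of _ b']) (simp add: mult_ac)
  qed
  have le: "t \<le> ?r ^ n * \<bar>2 * tile_radius - ?R\<bar>" for n
  proof -
    obtain a b where ab: "ov a b" "t \<le> ?r ^ n * (norm (fst a - fst b) - ?R)" using ex[of n] by blast
    have "norm (fst a - fst b) - ?R \<le> \<bar>2 * tile_radius - ?R\<bar>"
      using ov_dist[OF ab(1)] by linarith
    then have "?r ^ n * (norm (fst a - fst b) - ?R) \<le> ?r ^ n * \<bar>2 * tile_radius - ?R\<bar>"
      by (intro mult_left_mono zero_le_power onorm_Qin_nonneg)
    with ab(2) show ?thesis by linarith
  qed
  have "(\<lambda>n. ?r ^ n * \<bar>2 * tile_radius - ?R\<bar>) \<longlonglongrightarrow> 0 * \<bar>2 * tile_radius - ?R\<bar>"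
    by (intro tendsto_mult tendsto_const LIMSEQ_power_zero) (use contr onorm_Qin_nonneg in simp)
  then have "t \<le> 0" using le by (intro LIMSEQ_le_const[of _ 0]) auto
  with t show False by simp
qed

section \<open>Perron--Frobenius weights\<close>

lemma sum_Phi: "(\<Sum>a\<in>Phi Q D x. f (snd a)) = (\<Sum>i\<in>UNIV. f i * real (card (D i (snd x))))"
proof -
  have fin: "finite (Phi Q D x)" using finite_ph[of 1 x] by simp
  have "(\<Sum>a\<in>Phi Q D x. f (snd a)) = (\<Sum>i\<in>UNIV. \<Sum>a | a \<in> Phi Q D x \<and> snd a = i. f (snd a))"
    by (rule sum.group[symmetric]) (use fin in auto)
  also have "\<dots> = (\<Sum>i\<in>UNIV. f i * real (card (D i (snd x))))"
  proof (rule sum.cong[OF refl])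
    fix i
    have "{a \<in> Phi Q D x. snd a = i} = (\<lambda>d. (Q (fst x) + d, i)) ` D i (snd x)"
      by (auto simp: Phi_def)
    then have "card {a \<in> Phi Q D x. snd a = i} = card (D i (snd x))"
      by (simp add: card_image inj_on_def)
    then show "(\<Sum>a | a \<in> Phi Q D x \<and> snd a = i. f (snd a)) = f i * real (card (D i (snd x)))"
      by (simp add: mult.commute)
  qed
  finally show ?thesis .
qed

lemma sum_ph_add:
  fixes f :: "('d, 'c) cpoint \<Rightarrow> real"
  assumes "x \<in> L"
  shows "sum f (ph (m + n) x) = (\<Sum>y\<in>ph m x. sum f (ph n y))"
  unfolding Phi_pow_add
proof (rule sum.UNION_disjoint)
  show "\<forall>i\<in>ph m x. \<forall>j\<in>ph m x. i \<noteq> j \<longrightarrow> ph n i \<inter> ph n j = {}"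
  proof (intro ballI impI)
    fix i j assume "i \<in> ph m x" "j \<in> ph m x" "i \<noteq> j"
    then show "ph n i \<inter> ph n j = {}"
      using ph_unique[of i j _ n] ph_L[OF assms] by blast
  qed
qed auto

lemma sum_ph_weights:
  assumes "\<And>j. (\<Sum>i\<in>UNIV. w i * real (card (D i j))) = \<beta> * w j" "x \<in> L"
  shows "(\<Sum>a\<in>ph n x. w (snd a)) = \<beta> ^ n * w (snd x)"
proof (induction n)
  case (Suc n)
  have "(\<Sum>a\<in>ph (Suc n) x. w (snd a)) = (\<Sum>y\<in>ph n x. \<Sum>a\<in>ph 1 y. w (snd a))"
    using sum_ph_add[OF assms(2), of "\<lambda>a. w (snd a)" n 1] by simp
  also have "\<dots> = (\<Sum>y\<in>ph n x. \<beta> * w (snd y))"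
    by (simp add: sum_Phi assms(1))
  also have "\<dots> = \<beta> ^ Suc n * w (snd x)"
    by (simp add: sum_distrib_left[symmetric] Suc)
  finally show ?case .
qed simp

lemma ex_digit: "\<exists>j. D i j \<noteq> {}"
proof -
  obtain m where m: "m > 0" "\<forall>x i. \<exists>a\<in>ph m x. snd a = i" using ph_colour by blast
  obtain m' where m': "m = Suc m'" using m(1) gr0_implies_Suc by blast
  obtain a where a: "a \<in> ph m undefined" "snd a = i" using m(2) by blast
  then obtain y where "a \<in> Phi Q D y" unfolding m' Phi_pow_Suc by blast
  then have "D i (snd y) \<noteq> {}" using a(2) by (auto simp: Phi_def)
  then show ?thesis by blast
qed

text \<open>Brouwer's theorem on the standard simplex, for the map v -> vM divided by its sum, where
  M is the substitution matrix. The divisor does not vanish, since by \<open>ex_digit\<close> every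
  row of M has a nonzero entry.\<close>

lemma ex_weights_nonneg:
  "\<exists>w \<beta>. \<beta> > 0 \<and> (\<forall>i. w i \<ge> 0) \<and> (\<exists>i. w i > 0) \<and>
     (\<forall>j. (\<Sum>i\<in>UNIV. w i * real (card (D i j))) = \<beta> * w j)"
proof -
  define S :: "(real^'c) set" where "S = {v. (\<forall>i. 0 \<le> v $ i) \<and> (\<Sum>i\<in>UNIV. v $ i) = 1}"
  define g :: "real^'c \<Rightarrow> 'c \<Rightarrow> real" where "g v j = (\<Sum>i\<in>UNIV. v $ i * real (card (D i j)))" for v j
  define s where "s v = (\<Sum>j\<in>UNIV. g v j)" for v
  define f :: "real^'c \<Rightarrow> real^'c" where "f v = (\<chi> j. g v j / s v)" for v
  have g_nonneg: "0 \<le> g v j" if "v \<in> S" for v j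
    unfolding g_def using that by (intro sum_nonneg mult_nonneg_nonneg) (simp_all add: S_def)
  have s_pos: "0 < s v" if v: "v \<in> S" for v
  proof -
    obtain i where i: "0 < v $ i"
    proof (rule ccontr)
      assume "\<not> thesis"
      then have "\<And>i. v $ i \<le> 0" using that by (meson not_le)
      then have "(\<Sum>i\<in>UNIV. v $ i) \<le> 0" by (simp add: sum_nonpos)
      with v show False by (simp add: S_def)
    qed
    obtain j where "D i j \<noteq> {}" using ex_digit by blast
    then have "0 < v $ i * real (card (D i j))" using i finite_D by (simp add: card_gt_0_iff)
    also have "\<dots> \<le> g v j"
      unfolding g_def using v by (intro member_le_sum) (auto simp: S_def)
    also have "\<dots> \<le> s v"
      unfolding s_def by (intro member_le_sum) (auto intro: g_nonneg[OF v])
    finally show ?thesis .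
  qed
  have cont_g: "continuous_on S (\<lambda>v. g v j)" for j
    unfolding g_def by (intro continuous_intros)
  have "continuous_on S f"
    unfolding f_def s_def
    by (intro continuous_on_vec_lambda continuous_on_divide continuous_on_sum cont_g)
      (use s_pos in \<open>force simp: s_def\<close>)
  moreover have "f \<in> S \<rightarrow> S"
    using g_nonneg s_pos
    by (force simp: f_def S_def s_def sum_divide_distrib[symmetric] intro!: divide_nonneg_pos)
  moreover have "convex S"
    unfolding convex_def S_def
    by (auto simp: sum.distrib sum_distrib_left[symmetric])
  moreover have "compact S"
  proof -
    have "closed S"
      unfolding S_def by (intro closed_Collect_conj closed_Collect_all closed_Collect_le closed_Collect_eq continuous_intros)
    moreover have "norm v \<le> 1" if "v \<in> S" for v
      using norm_le_l1_cart[of v] that by (simp add: S_def)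
    then have "bounded S" by (auto simp: bounded_iff)
    ultimately show ?thesis by (simp add: compact_eq_bounded_closed)
  qed
  moreover have "S \<noteq> {}"
  proof -
    have "axis undefined 1 \<in> S"
      by (simp add: S_def axis_def)
    then show ?thesis by blast
  qed
  ultimately obtain v where v: "v \<in> S" "f v = v"
    using brouwer by blast
  have "g v j = s v * v $ j" for j
  proof -
    have "v $ j = g v j / s v" using v(2) by (metis f_def vec_lambda_beta)
    then show ?thesis using s_pos[OF v(1)] by simp
  qed
  then have "\<forall>j. (\<Sum>i\<in>UNIV. v $ i * real (card (D i j))) = s v * v $ j"
    by (simp add: g_def)
  moreover have "\<exists>i. v $ i > 0"
  proof (rule ccontr)
    assume "\<not> ?thesis"
    then have "(\<Sum>i\<in>UNIV. v $ i) \<le> 0" by (simp add: sum_nonpos not_less)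
    with v(1) show False by (simp add: S_def)
  qed
  ultimately show ?thesis
    using s_pos[OF v(1)] v(1) by (intro exI[of _ "\<lambda>i. v $ i"] exI[of _ "s v"]) (auto simp: S_def)
qed

text \<open>By primitivity a supertile over colour j contains a point of a colour with positive
  weight, and its total weight is a power of \<beta> times the weight of j.\<close>

lemma ex_weights:
  "\<exists>w \<beta>. \<beta> > 0 \<and> (\<forall>i. w i > 0) \<and> (\<forall>j. (\<Sum>i\<in>UNIV. w i * real (card (D i j))) = \<beta> * w j)"
proof -
  obtain w \<beta> where w: "\<beta> > 0" "\<forall>i. w i \<ge> 0" "\<exists>i. w i > 0"
    "\<forall>j. (\<Sum>i\<in>UNIV. w i * real (card (D i j))) = \<beta> * w j"
    using ex_weights_nonneg by blast
  obtain i where i: "w i > 0" using w(3) by blast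
  obtain m where m: "\<forall>x i. \<exists>a\<in>ph m x. snd a = i" using ph_colour by blast
  have "w j > 0" for j
  proof -
    obtain x where x: "x \<in> L" "snd x = j" using L_relatively_dense by metis
    obtain a where a: "a \<in> ph m x" "snd a = i" using m by blast
    have "w i \<le> (\<Sum>a\<in>ph m x. w (snd a))"
      using member_le_sum[of a "ph m x" "\<lambda>a. w (snd a)"] a w(2) by simp
    also have "\<dots> = \<beta> ^ m * w j"
      using sum_ph_weights[of w \<beta> x m] w(4) x by simp
    finally have "0 < \<beta> ^ m * w j" using i by linarith
    then show ?thesis using w(1) by (simp add: zero_less_mult_iff)
  qed
  with w show ?thesis by blast
qed

end

text \<open>By \<open>eigen\<close> the total weight of a supertile grows by exactly the factor
  \<beta> per level, and it is additive over the parts, so weights do the work of tile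
  volumes.\<close>

locale weighted_self_affine = meyer_self_affine Q A D T k
  for Q :: "real^'d::finite \<Rightarrow> real^'d" and A :: "'c::finite \<Rightarrow> (real^'d) set" and D T k +
  fixes w :: "'c \<Rightarrow> real" and \<beta> :: real
  assumes w_pos: "w i > 0" and \<beta>_pos: "\<beta> > 0"
    and eigen: "(\<Sum>i\<in>UNIV. w i * real (card (D i j))) = \<beta> * w j"
begin

definition wt :: "('d, 'c) cpoint set \<Rightarrow> real" where
  "wt S = (\<Sum>a\<in>S. w (snd a))"

definition wmin :: real where "wmin = Min (range w)"
definition wmax :: real where "wmax = Max (range w)"
text \<open>The price of passing between weights and cardinalities.\<close>

definition \<kappa> :: real where "\<kappa> = wmax / wmin"

lemma wmin_le: "wmin \<le> w i" and wmax_ge: "w i \<le> wmax"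
  by (auto simp: wmin_def wmax_def)

lemma wmin_pos: "wmin > 0"
  using w_pos by (simp add: wmin_def)

lemma wmax_pos: "wmax > 0"
  using w_pos wmax_ge less_le_trans by blast

lemma \<kappa>_pos: "\<kappa> > 0"
  by (simp add: \<kappa>_def wmin_pos wmax_pos)

lemma wt_ph: "x \<in> L \<Longrightarrow> wt (ph n x) = \<beta> ^ n * w (snd x)"
  unfolding wt_def by (rule sum_ph_weights[OF eigen])

lemma wt_ge_card: "real (card S) * wmin \<le> wt S"
  unfolding wt_def using sum_bounded_below[of S wmin "\<lambda>a. w (snd a)"] wmin_le by simp

lemma wt_le_card: "wt S \<le> real (card S) * wmax"
  unfolding wt_def using sum_bounded_above[of S "\<lambda>a. w (snd a)" wmax] wmax_ge by simp

lemma card_ph_le: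
  assumes "x \<in> L"
  shows "real (card (ph n x)) \<le> \<kappa> * \<beta> ^ n"
proof -
  have "real (card (ph n x)) * wmin \<le> \<beta> ^ n * wmax"
  proof -
    have "\<beta> ^ n * w (snd x) \<le> \<beta> ^ n * wmax"
      using \<beta>_pos by (intro mult_left_mono wmax_ge) simp
    then show ?thesis using wt_ge_card[of "ph n x"] wt_ph[OF assms, of n] by linarith
  qed
  then show ?thesis using wmin_pos by (simp add: \<kappa>_def field_simps)
qed

lemma card_ph_ge:
  assumes "x \<in> L"
  shows "\<beta> ^ n / \<kappa> \<le> real (card (ph n x))"
proof -
  have "\<beta> ^ n * wmin \<le> real (card (ph n x)) * wmax"
  proof -
    have "\<beta> ^ n * wmin \<le> \<beta> ^ n * w (snd x)"
      using \<beta>_pos by (intro mult_left_mono wmin_le) simp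
    then show ?thesis using wt_le_card[of "ph n x"] wt_ph[OF assms, of n] by linarith
  qed
  then show ?thesis using wmin_pos wmax_pos by (simp add: \<kappa>_def field_simps)
qed

text \<open>The second condition bounds a level by the descendants of the members m levels above;
  the third removes at least one descendant of each of these members. Only this is used of S, so one
  rate serves all such families.\<close>

definition decaying :: "nat \<Rightarrow> ('d, 'c) cpoint \<Rightarrow> (nat \<Rightarrow> ('d, 'c) cpoint set) \<Rightarrow> bool" where
  "decaying m x S \<longleftrightarrow> (\<forall>n. S n \<subseteq> ph n x \<and> S (n + m) \<subseteq> (\<Union>a\<in>S n. ph m a) \<and>
     (\<forall>a\<in>S n. \<exists>b\<in>ph m a. b \<notin> S (n + m)))"

lemma decay_step:
  assumes "x \<in> L" and S: "decaying m x S"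
  shows "wt (S (n + m)) \<le> (\<beta> ^ m - 1 / \<kappa>) * wt (S n)"
proof -
  have sub: "S n \<subseteq> ph n x" "S (n + m) \<subseteq> (\<Union>a\<in>S n. ph m a)"
    and loss: "\<forall>a\<in>S n. \<exists>b. b \<in> ph m a \<and> b \<notin> S (n + m)"
    using S unfolding decaying_def by blast+
  have fin: "finite (S n)" using sub(1) finite_ph finite_subset by blast
  have L: "S n \<subseteq> L" using sub(1) ph_L[OF assms(1)] by blast
  from loss obtain g where g: "\<forall>a\<in>S n. g a \<in> ph m a \<and> g a \<notin> S (n + m)" by metis
  have "S (n + m) \<subseteq> (\<Union>a\<in>S n. ph m a - {g a})" using sub(2) g by blast
  then have "wt (S (n + m)) \<le> wt (\<Union>a\<in>S n. ph m a - {g a})"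
    unfolding wt_def using fin by (intro sum_mono2) (auto simp: less_imp_le w_pos)
  also have "\<dots> = (\<Sum>a\<in>S n. wt (ph m a - {g a}))"
    unfolding wt_def
  proof (rule sum.UNION_disjoint)
    show "\<forall>i\<in>S n. \<forall>j\<in>S n. i \<noteq> j \<longrightarrow> (ph m i - {g i}) \<inter> (ph m j - {g j}) = {}"
    proof (intro ballI impI)
      fix i j assume "i \<in> S n" "j \<in> S n" "i \<noteq> j"
      then show "(ph m i - {g i}) \<inter> (ph m j - {g j}) = {}"
        using ph_unique[of i j _ m] L by blast
    qed
  qed (use fin in auto)
  also have "\<dots> \<le> (\<Sum>a\<in>S n. (\<beta> ^ m - 1 / \<kappa>) * w (snd a))"
  proof (rule sum_mono)
    fix a assume a: "a \<in> S n"
    have "wt (ph m a - {g a}) = wt (ph m a) - w (snd (g a))"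
      unfolding wt_def using g a by (simp add: sum_diff1)
    also have "\<dots> \<le> \<beta> ^ m * w (snd a) - wmin"
      using wt_ph[of a m] L a wmin_le[of "snd (g a)"] by auto
    \<comment> \<open>The lost descendant weighs at least \<open>wmin\<close>; expressing this as a
      fraction of the weight of \<open>a\<close> itself makes the loss a constant factor.\<close>
    also have "\<dots> \<le> \<beta> ^ m * w (snd a) - w (snd a) / \<kappa>"
    proof -
      have "wmin * w (snd a) \<le> wmin * wmax"
        using wmin_pos by (intro mult_left_mono wmax_ge) simp
      then have "w (snd a) / \<kappa> \<le> wmin"
        using wmin_pos wmax_pos by (simp add: \<kappa>_def field_simps)
      then show ?thesis by simp
    qed
    finally show "wt (ph m a - {g a}) \<le> (\<beta> ^ m - 1 / \<kappa>) * w (snd a)"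
      by (simp add: algebra_simps)
  qed
  also have "\<dots> = (\<beta> ^ m - 1 / \<kappa>) * wt (S n)"
    by (simp add: wt_def sum_distrib_left)
  finally show ?thesis .
qed

lemma decay:
  assumes "m > 0"
  shows "\<exists>C \<gamma>. C > 0 \<and> 0 < \<gamma> \<and> \<gamma> < \<beta> \<and> (\<forall>x\<in>L. \<forall>S. decaying m x S \<longrightarrow>
    (\<forall>n. real (card (S n)) \<le> C * \<gamma> ^ n))"
proof -
  \<comment> \<open>The second entry keeps \<delta> positive, so that its m-th root is a positive
    rate.\<close>
  define \<delta> where "\<delta> = max (\<beta> ^ m - 1 / \<kappa>) (\<beta> ^ m / 2)"
  have \<delta>: "0 < \<delta>" "\<delta> < \<beta> ^ m" "\<beta> ^ m - 1 / \<kappa> \<le> \<delta>"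
    using \<beta>_pos \<kappa>_pos by (auto simp: \<delta>_def less_max_iff_disj)
  define \<gamma> where "\<gamma> = root m \<delta>"
  have \<gamma>m: "\<gamma> ^ m = \<delta>" using \<delta>(1) assms by (simp add: \<gamma>_def)
  have \<gamma>: "0 < \<gamma>" using \<delta>(1) assms by (simp add: \<gamma>_def)
  have "\<gamma> < \<beta>"
    using \<delta>(2) \<gamma>m \<beta>_pos by (metis not_le power_mono less_imp_le)
  \<comment> \<open>The power of \<beta> / \<gamma> pays for the first n mod m levels, where only
    the growth rate \<beta> is available.\<close>
  define C where "C = \<kappa> * (\<beta> / \<gamma>) ^ m"
  have "real (card (S n)) \<le> C * \<gamma> ^ n"
    if x: "x \<in> L" and S: "decaying m x S" for x S n
  proof -
    have wt_nonneg: "0 \<le> wt (S n)" for n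
      unfolding wt_def by (intro sum_nonneg less_imp_le w_pos)
    have step: "wt (S (n + m)) \<le> \<delta> * wt (S n)" for n
      using decay_step[OF x S, of n] mult_right_mono[OF \<delta>(3) wt_nonneg[of n]] by linarith
    have iter: "wt (S (q * m + s)) \<le> \<delta> ^ q * wt (S s)" for q s
    proof (induction q)
      case (Suc q)
      have "wt (S (Suc q * m + s)) \<le> \<delta> * wt (S (q * m + s))"
        using step[of "q * m + s"] by (simp add: algebra_simps)
      also have "\<dots> \<le> \<delta> * (\<delta> ^ q * wt (S s))"
        using \<delta>(1) Suc by (intro mult_left_mono) auto
      finally show ?case by simp
    qed simp
    let ?q = "n div m" and ?s = "n mod m"
    have "wt (S ?s) \<le> wt (ph ?s x)"
      unfolding wt_def using S by (intro sum_mono2) (auto simp: decaying_def less_imp_le w_pos)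
    also have "\<dots> \<le> \<beta> ^ ?s * wmax"
      using wt_ph[OF x] wmax_ge \<beta>_pos by simp
    finally have "wt (S n) \<le> \<delta> ^ ?q * (\<beta> ^ ?s * wmax)"
      using iter[of ?q ?s] \<delta>(1) by (auto intro: order_trans mult_left_mono)
    also have "\<dots> = \<gamma> ^ (m * ?q) * \<gamma> ^ ?s * (\<beta> / \<gamma>) ^ ?s * wmax"
      using \<gamma> by (simp add: \<gamma>m[symmetric] power_mult[symmetric] power_divide)
    also have "\<gamma> ^ (m * ?q) * \<gamma> ^ ?s = \<gamma> ^ n"
      by (simp add: power_add[symmetric])
    also have "(\<beta> / \<gamma>) ^ ?s \<le> (\<beta> / \<gamma>) ^ m"
      using \<gamma> \<open>\<gamma> < \<beta>\<close> assms by (intro power_increasing) auto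
    finally have "wt (S n) \<le> \<gamma> ^ n * (\<beta> / \<gamma>) ^ m * wmax"
      using \<gamma> wmax_pos by (simp add: mult_left_mono mult_right_mono)
    then have "real (card (S n)) * wmin \<le> \<gamma> ^ n * (\<beta> / \<gamma>) ^ m * wmax"
      using wt_ge_card[of "S n"] by linarith
    then have "real (card (S n)) \<le> \<gamma> ^ n * (\<beta> / \<gamma>) ^ m * wmax / wmin"
      using wmin_pos by (simp only: pos_le_divide_eq)
    then show ?thesis by (simp add: C_def \<kappa>_def mult_ac)
  qed
  moreover have "C > 0" using \<kappa>_pos \<gamma> \<beta>_pos by (simp add: C_def)
  ultimately show ?thesis using \<gamma> \<open>\<gamma> < \<beta>\<close> by blast
qed

section \<open>Points near the boundary of a supertile\<close>

lemma tint_in_ball: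
  assumes "p \<in> tset b" "norm (fst b - fst c) \<le> \<rho>"
  shows "tint c \<subseteq> ball p (\<rho> + 2 * tile_radius + 1)"
proof
  fix q assume q: "q \<in> tint c"
  let ?v = "(q - fst c) - (fst b - fst c)"
  have "q - p = ?v - (p - fst b)" by simp
  then have "norm (q - p) \<le> norm ?v + norm (p - fst b)"
    by (simp only: norm_triangle_ineq4)
  moreover have "norm ?v \<le> norm (q - fst c) + norm (fst b - fst c)"
    by (rule norm_triangle_ineq4)
  ultimately have "norm (q - p) < \<rho> + 2 * tile_radius + 1"
    using tint_dist[OF q] tset_dist[OF assms(1)] assms(2) by linarith
  then show "q \<in> ball p (\<rho> + 2 * tile_radius + 1)"
    by (simp add: dist_norm norm_minus_commute)
qed

text \<open>A sufficiently inflated tile contains a ball so large that every tile close to the one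
  at its centre has its interior inside. There are finitely many colours, so one level serves all
  tiles.\<close>

lemma ex_deep_point:
  assumes "\<rho> \<ge> 0"
  shows "\<exists>m>0. \<forall>x\<in>L. \<exists>x1\<in>ph m x. \<forall>x2\<in>L. norm (fst x1 - fst x2) \<le> \<rho> \<longrightarrow> x2 \<in> ph m x"
proof -
  \<comment> \<open>One tile radius leads from the centre p to the point of \<open>x1\<close>,
    another from the point of \<open>x2\<close> to its tile; the 1 makes the estimate strict for an
    open ball.\<close>
  let ?r = "\<rho> + 2 * tile_radius + 1"
  have r: "?r > 0" using assms tile_radius_pos by simp
  have "\<forall>i. \<exists>m. \<forall>n\<ge>m. \<exists>p. ball p ?r \<subseteq> (Q ^^ n) ` tint (0, i)"
    using Qn_contains_ball[OF open_tint tint_nonempty r] by blast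
  then obtain f where f: "\<forall>i. \<forall>n\<ge>f i. \<exists>p. ball p ?r \<subseteq> (Q ^^ n) ` tint (0, i)" by metis
  define m where "m = Suc (Max (range f))"
  have m: "f i \<le> m" for i
    unfolding m_def by (intro le_SucI Max_ge) auto
  have "\<exists>x1\<in>ph m x. \<forall>x2\<in>L. norm (fst x1 - fst x2) \<le> \<rho> \<longrightarrow> x2 \<in> ph m x" if x: "x \<in> L" for x
  proof -
    obtain p0 where p0: "ball p0 ?r \<subseteq> (Q ^^ m) ` tint (0, snd x)" using f m by blast
    define p where "p = (Q ^^ m) (fst x) + p0"
    have xeq: "x = tr (fst x) (0, snd x)" by (simp add: prod_eq_iff)
    have sub: "ball p ?r \<subseteq> (Q ^^ m) ` tint x"
    proof
      fix q assume "q \<in> ball p ?r"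
      then have "q - (Q ^^ m) (fst x) \<in> ball p0 ?r"
        by (simp add: p_def dist_norm algebra_simps)
      then obtain z where z: "z \<in> tint (0, snd x)" "q - (Q ^^ m) (fst x) = (Q ^^ m) z" using p0 by blast
      then have "q = (Q ^^ m) (fst x + z)" by (simp add: linear_add[OF linear_Qn] algebra_simps)
      moreover have "fst x + z \<in> tint x" using z(1) by (subst xeq) (simp add: tint_tr)
      ultimately show "q \<in> (Q ^^ m) ` tint x" by blast
    qed
    obtain x1 where x1: "x1 \<in> L" "p \<in> tset x1" using tile_cover by blast
    have near: "x2 \<in> ph m x" if "x2 \<in> L" "norm (fst x1 - fst x2) \<le> \<rho>" for x2
      using ph_tint_unique[OF x that(1)] tint_in_ball[OF x1(2) that(2)] sub by blast
    then show ?thesis using x1(1) assms by (intro bexI[of _ x1]) auto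
  qed
  moreover have "m > 0" by (simp add: m_def)
  ultimately show ?thesis by blast
qed

text \<open>A point of the descendant pulls back into the tile of the ancestor, and the powers of
  the inverse are uniformly bounded on vectors of one tile radius.\<close>

lemma ex_descendant_dist: "\<exists>C>0. \<forall>n x b. b \<in> ph n x \<longrightarrow> norm ((Qi ^^ n) (fst b) - fst x) \<le> C"
proof -
  obtain C where C: "C > 0" "\<forall>n v. norm ((Qi ^^ n) v) \<le> C * norm v" using Qin_bounded by blast
  have "norm ((Qi ^^ n) (fst b) - fst x) \<le> tile_radius + C * tile_radius" if b: "b \<in> ph n x" for n x b
  proof -
    obtain p where p: "p \<in> tint b" using tint_nonempty by blast
    then obtain q where q: "q \<in> tint x" "p = (Q ^^ n) q" using tint_descend[OF b] by blast
    have "(Qi ^^ n) (fst b) - fst x = (q - fst x) - (Qi ^^ n) (p - fst b)"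
      by (simp add: linear_diff[OF linear_Qin] q(2))
    then have "norm ((Qi ^^ n) (fst b) - fst x) \<le> norm (q - fst x) + norm ((Qi ^^ n) (p - fst b))"
      by (simp only: norm_triangle_ineq4)
    also have "\<dots> \<le> tile_radius + C * tile_radius"
      using tint_dist[OF q(1)] C(2)[rule_format, of n "p - fst b"]
        mult_left_mono[OF tint_dist[OF p], of C] C(1) by linarith
    finally show ?thesis .
  qed
  moreover have "tile_radius + C * tile_radius > 0" using tile_radius_pos C(1) by (simp add: add_pos_pos)
  ultimately show ?thesis by blast
qed

text \<open>Below a deep point no descendant can be close to a point c outside the supertile: pulled
  back, the ancestor of c would be close to the deep point, hence inside, and c with it. So every
  member of the family below loses a descendant.\<close>

lemma card_near_boundary:
  assumes "\<rho> \<ge> 0"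
  shows "\<exists>C \<gamma>. C > 0 \<and> 0 < \<gamma> \<and> \<gamma> < \<beta> \<and> (\<forall>x\<in>L. \<forall>n.
    real (card {b \<in> ph n x. \<exists>c\<in>L. c \<notin> ph n x \<and> norm (fst b - fst c) \<le> \<rho>}) \<le> C * \<gamma> ^ n)"
proof -
  obtain C0 where C0: "C0 > 0" "\<forall>n v. norm ((Qi ^^ n) v) \<le> C0 * norm v" using Qin_bounded by blast
  obtain C1 where C1: "C1 > 0" "\<forall>n x b. b \<in> ph n x \<longrightarrow> norm ((Qi ^^ n) (fst b) - fst x) \<le> C1"
    using ex_descendant_dist by blast
  obtain m where m: "m > 0"
    "\<forall>x\<in>L. \<exists>x1\<in>ph m x. \<forall>x2\<in>L. norm (fst x1 - fst x2) \<le> 2 * C1 + C0 * \<rho> \<longrightarrow> x2 \<in> ph m x"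
    using ex_deep_point[of "2 * C1 + C0 * \<rho>"] C0(1) C1(1) assms by auto
  obtain C \<gamma> where C: "C > 0" "0 < \<gamma>" "\<gamma> < \<beta>"
    "\<forall>x\<in>L. \<forall>S. decaying m x S \<longrightarrow> (\<forall>n. real (card (S n)) \<le> C * \<gamma> ^ n)"
    using decay[OF m(1)] by blast
  have "real (card {b \<in> ph n x. \<exists>c\<in>L. c \<notin> ph n x \<and> norm (fst b - fst c) \<le> \<rho>}) \<le> C * \<gamma> ^ n"
    if x: "x \<in> L" for x n
  proof -
    \<comment> \<open>Being near the boundary does not pass to ancestors at a fixed distance.
      Admitting a descendant at any depth j that is near the boundary makes the family closed under
      ancestors.\<close>
    define S where "S n = {a \<in> ph n x. \<exists>j b c. b \<in> ph j a \<and> c \<in> L \<and> c \<notin> ph (n + j) x \<and>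
      norm (fst b - fst c) \<le> \<rho>}" for n
    have "decaying m x S"
      unfolding decaying_def
    proof (intro allI ballI conjI)
      show "S n \<subseteq> ph n x" for n by (auto simp: S_def)
      show "S (n + m) \<subseteq> (\<Union>a\<in>S n. ph m a)" for n
      proof
        fix a' assume "a' \<in> S (n + m)"
        then obtain j b c where a': "a' \<in> ph (n + m) x" "b \<in> ph j a'" "c \<in> L"
          "c \<notin> ph (n + m + j) x" "norm (fst b - fst c) \<le> \<rho>" by (auto simp: S_def)
        then obtain a where a: "a \<in> ph n x" "a' \<in> ph m a" by (auto simp: Phi_pow_add)
        have "b \<in> ph (m + j) a" by (rule Phi_pow_trans[OF a(2) a'(2)])
        moreover have "c \<notin> ph (n + (m + j)) x" using a'(4) by (simp add: add.assoc)
        ultimately have "a \<in> S n" using a(1) a'(3,5) unfolding S_def by blast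
        with a(2) show "a' \<in> (\<Union>a\<in>S n. ph m a)" by blast
      qed
      show "\<exists>b\<in>ph m a. b \<notin> S (n + m)" if "a \<in> S n" for n a
      proof -
        have a: "a \<in> ph n x" using that by (simp add: S_def)
        then have "a \<in> L" using ph_L[OF x] by blast
        then obtain x1 where x1: "x1 \<in> ph m a"
          "\<forall>x2\<in>L. norm (fst x1 - fst x2) \<le> 2 * C1 + C0 * \<rho> \<longrightarrow> x2 \<in> ph m a" using m(2) by blast
        have "x1 \<notin> S (n + m)"
        proof
          assume "x1 \<in> S (n + m)"
          then obtain j b c where c: "b \<in> ph j x1" "c \<in> L" "c \<notin> ph (n + m + j) x"
            "norm (fst b - fst c) \<le> \<rho>" by (auto simp: S_def)
          obtain x2 where x2: "x2 \<in> L" "c \<in> ph j x2" using L_parent[OF c(2)] by blast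
          let ?b = "(Qi ^^ j) (fst b) - fst x1" and ?c = "(Qi ^^ j) (fst c) - fst x2"
            and ?d = "(Qi ^^ j) (fst b - fst c)"
          have "fst x1 - fst x2 = ?d + (?c - ?b)" by (simp add: linear_diff[OF linear_Qin])
          then have "norm (fst x1 - fst x2) \<le> norm ?d + norm (?c - ?b)"
            by (simp only: norm_triangle_ineq)
          moreover have "norm (?c - ?b) \<le> norm ?c + norm ?b" by (rule norm_triangle_ineq4)
          moreover have "norm ?b \<le> C1" "norm ?c \<le> C1" using C1(2) c(1) x2(2) by blast+
          moreover have "norm ?d \<le> C0 * \<rho>"
            using C0(2)[rule_format, of j "fst b - fst c"] mult_left_mono[OF c(4), of C0] C0(1) by linarith
          ultimately have "norm (fst x1 - fst x2) \<le> 2 * C1 + C0 * \<rho>" by linarith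
          then have "x2 \<in> ph m a" using x1(2) x2(1) by blast
          then have "c \<in> ph (n + m + j) x"
            using Phi_pow_trans[OF Phi_pow_trans[OF a] x2(2)] by blast
          with c(3) show False by blast
        qed
        with x1(1) show ?thesis by blast
      qed
    qed
    then have "real (card (S n)) \<le> C * \<gamma> ^ n" using C(4) x by blast
    moreover have "card {b \<in> ph n x. \<exists>c\<in>L. c \<notin> ph n x \<and> norm (fst b - fst c) \<le> \<rho>} \<le> card (S n)"
    proof (rule card_mono)
      show "finite (S n)" by (simp add: S_def)
      show "{b \<in> ph n x. \<exists>c\<in>L. c \<notin> ph n x \<and> norm (fst b - fst c) \<le> \<rho>} \<subseteq> S n"
      proof
        fix b assume "b \<in> {b \<in> ph n x. \<exists>c\<in>L. c \<notin> ph n x \<and> norm (fst b - fst c) \<le> \<rho>}"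
        then obtain c where "b \<in> ph n x" "c \<in> L" "c \<notin> ph (n + 0) x" "norm (fst b - fst c) \<le> \<rho>" by auto
        moreover have "b \<in> ph 0 b" by simp
        ultimately show "b \<in> S n" unfolding S_def by blast
      qed
    qed
    ultimately show ?thesis by linarith
  qed
  with C(1-3) show ?thesis by blast
qed

text \<open>Some level-m descendant \<open>b0\<close> fits into the inflated U, and all descendants
  of \<open>b0\<close> stay inside; they make up the proportion 1 / (\<kappa> \<beta>^m).\<close>

lemma card_inside_open:
  assumes "x \<in> L" "open U" "U \<noteq> {}" "U \<subseteq> tint x"
  shows "\<exists>c>0. \<exists>m. \<forall>n\<ge>m. c * \<beta> ^ n \<le> real (card {b \<in> ph n x. tint b \<subseteq> (Q ^^ n) ` U})"
proof -
  let ?r = "0 + 2 * tile_radius + 1"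
  obtain m p where p: "ball p ?r \<subseteq> (Q ^^ m) ` U"
    using Qn_contains_ball[OF assms(2,3), of ?r] tile_radius_pos by force
  obtain b0 where b0: "b0 \<in> L" "p \<in> tset b0" using tile_cover by blast
  have b0U: "tint b0 \<subseteq> (Q ^^ m) ` U"
  proof -
    have "tint b0 \<subseteq> ball p ?r" by (rule tint_in_ball[OF b0(2)]) simp
    with p show ?thesis by (rule subset_trans[rotated])
  qed
  then have "b0 \<in> ph m x"
    using ph_tint_unique[OF assms(1) b0(1), of m] assms(4) by blast
  have "1 / (\<kappa> * \<beta> ^ m) * \<beta> ^ n \<le> real (card {b \<in> ph n x. tint b \<subseteq> (Q ^^ n) ` U})"
    if n: "n \<ge> m" for n
  proof -
    have "ph (n - m) b0 \<subseteq> {b \<in> ph n x. tint b \<subseteq> (Q ^^ n) ` U}"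
    proof
      fix b assume b: "b \<in> ph (n - m) b0"
      have "(Q ^^ (n - m)) ` (Q ^^ m) ` U = (Q ^^ n) ` U"
        using n by (metis funpow_add image_comp le_add_diff_inverse2)
      moreover have "tint b \<subseteq> (Q ^^ (n - m)) ` (Q ^^ m) ` U"
        using tint_descend[OF b] image_mono[OF b0U] by (rule order_trans)
      ultimately have "tint b \<subseteq> (Q ^^ n) ` U" by simp
      moreover have "b \<in> ph n x"
        using Phi_pow_trans[OF \<open>b0 \<in> ph m x\<close> b] n by simp
      ultimately show "b \<in> {b \<in> ph n x. tint b \<subseteq> (Q ^^ n) ` U}" by simp
    qed
    then have "card (ph (n - m) b0) \<le> card {b \<in> ph n x. tint b \<subseteq> (Q ^^ n) ` U}"
      by (intro card_mono) auto
    moreover have "1 / (\<kappa> * \<beta> ^ m) * \<beta> ^ n = \<beta> ^ (n - m) / \<kappa>"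
      using n \<beta>_pos by (simp add: power_diff field_simps)
    ultimately show ?thesis using card_ph_ge[OF b0(1), of "n - m"] by linarith
  qed
  then show ?thesis using \<kappa>_pos \<beta>_pos by (intro exI[of _ "1 / (\<kappa> * \<beta> ^ m)"]) auto
qed

end

section \<open>Almost periods\<close>

text \<open>Coordinates are rounded down. The error r is chosen before M, while K may depend on M:
  in the expansion below, M is a multiple of r.\<close>

lemma rounding_to_lattice:
  fixes B :: "'a::euclidean_space set"
  assumes "independent B" "span B = UNIV"
  shows "\<exists>r>0. \<forall>M. \<exists>K::nat. \<forall>v. norm v \<le> M \<longrightarrow>
    (\<exists>z::'a \<Rightarrow> int. (\<forall>b\<in>B. \<bar>z b\<bar> \<le> int K) \<and> norm (v - (\<Sum>b\<in>B. of_int (z b) *\<^sub>R b)) \<le> r)"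
proof -
  have fin: "finite B" using assms(1) by (rule independent_imp_finite)
  let ?r = "1 + (\<Sum>b\<in>B. norm b)"
  have "\<exists>K::nat. \<forall>v. norm v \<le> M \<longrightarrow>
    (\<exists>z::'a \<Rightarrow> int. (\<forall>b\<in>B. \<bar>z b\<bar> \<le> int K) \<and> norm (v - (\<Sum>b\<in>B. of_int (z b) *\<^sub>R b)) \<le> ?r)" for M
  proof -
    have "linear (\<lambda>v. representation B v b)" for b
      using assms by (intro linearI) (simp_all add: real_vector.representation_add real_vector.representation_scale)
    then have "\<exists>C>0. \<forall>v. \<bar>representation B v b\<bar> \<le> norm v * C" for b
      using bounded_linear.pos_bounded[of "\<lambda>v. representation B v b"]
      by (simp add: linear_conv_bounded_linear)
    then obtain C where C: "\<forall>b. C b > 0 \<and> (\<forall>v. \<bar>representation B v b\<bar> \<le> norm v * C b)" by metis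
    obtain K :: nat where K: "\<bar>M\<bar> * (\<Sum>b\<in>B. C b) + 1 \<le> real K" using real_arch_simple by blast
    have "\<exists>z::'a \<Rightarrow> int. (\<forall>b\<in>B. \<bar>z b\<bar> \<le> int K) \<and> norm (v - (\<Sum>b\<in>B. of_int (z b) *\<^sub>R b)) \<le> ?r"
      if v: "norm v \<le> M" for v
    proof (intro exI conjI ballI)
      let ?z = "\<lambda>b. \<lfloor>representation B v b\<rfloor>"
      fix b assume b: "b \<in> B"
      have "\<bar>representation B v b\<bar> \<le> norm v * C b" using C by blast
      also have "\<dots> \<le> \<bar>M\<bar> * (\<Sum>b\<in>B. C b)"
        using v C fin b by (intro mult_mono member_le_sum) (auto intro: less_imp_le)
      finally have "\<bar>representation B v b\<bar> + 1 \<le> real K" using K by linarith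
      then show "\<bar>?z b\<bar> \<le> int K" by linarith
    next
      let ?z = "\<lambda>b. \<lfloor>representation B v b\<rfloor>"
      have "v = (\<Sum>b\<in>B. representation B v b *\<^sub>R b)"
        using real_vector.sum_representation_eq[OF assms(1) _ fin subset_refl, of v] assms(2) by simp
      then have "v - (\<Sum>b\<in>B. of_int (?z b) *\<^sub>R b) =
          (\<Sum>b\<in>B. representation B v b *\<^sub>R b) - (\<Sum>b\<in>B. of_int (?z b) *\<^sub>R b)"
        by simp
      also have "\<dots> = (\<Sum>b\<in>B. (representation B v b - of_int (?z b)) *\<^sub>R b)"
        by (simp add: sum_subtractf scaleR_diff_left)
      finally have "norm (v - (\<Sum>b\<in>B. of_int (?z b) *\<^sub>R b)) \<le>
          (\<Sum>b\<in>B. norm ((representation B v b - of_int (?z b)) *\<^sub>R b))"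
        by (simp only: norm_sum)
      also have "\<dots> \<le> (\<Sum>b\<in>B. norm b)"
      proof (rule sum_mono)
        fix b
        have "\<bar>representation B v b - of_int (?z b)\<bar> \<le> 1" by linarith
        then show "norm ((representation B v b - of_int (?z b)) *\<^sub>R b) \<le> norm b"
          by (simp add: mult_left_le_one_le)
      qed
      finally show "norm (v - (\<Sum>b\<in>B. of_int (?z b) *\<^sub>R b)) \<le> ?r" by simp
    qed
    then show ?thesis by blast
  qed
  moreover have "?r > 0" using sum_nonneg[of B norm] by (simp add: add_pos_nonneg)
  ultimately show ?thesis by blast
qed

section \<open>Coincidences and points without a counterpart\<close>

context weighted_self_affine
begin

definition lead :: "nat \<Rightarrow> ('d, 'c) cpoint \<Rightarrow> ('d, 'c) cpoint \<Rightarrow> bool" where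
  "lead n x y \<longleftrightarrow> ph n x \<inter> ph n y \<noteq> {}"

lemma lead_mono:
  assumes "lead n x y" "n \<le> m"
  shows "lead m x y"
proof -
  obtain a where a: "a \<in> ph n x" "a \<in> ph n y" using assms(1) by (auto simp: lead_def)
  obtain b where b: "b \<in> ph (m - n) a" using ph_nonempty by blast
  have "b \<in> ph m x" "b \<in> ph m y"
    using Phi_pow_trans[OF a(1) b] Phi_pow_trans[OF a(2) b] assms(2) by simp_all
  then show ?thesis by (auto simp: lead_def)
qed

lemma lead_ov: "lead n x y \<Longrightarrow> ov x y"
  unfolding lead_def using ov_ancestor[OF _ _ ov_refl] by blast

lemma lead_tr: "lead n (tr g x) (tr g y) \<longleftrightarrow> lead n x y"
  by (auto simp: lead_def ph_tr image_iff)

lemma cls_eq_iff: "cls x y = cls x' y' \<longleftrightarrow> (\<exists>g. x = tr g x' \<and> y = tr g y')"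
proof
  assume "cls x y = cls x' y'"
  then have "x = tr (fst y - fst y') x'" "y = tr (fst y - fst y') y'"
    by (auto simp: cls_def prod_eq_iff algebra_simps)
  then show "\<exists>g. x = tr g x' \<and> y = tr g y'" by blast
qed (auto simp: cls_def)

text \<open>From here on an overlap \<open>(u, y, v)\<close> is represented by the coloured points \<open>u - y\<close> and \<open>v\<close>.\<close>

definition coinciding :: "nat \<Rightarrow> real^'d \<Rightarrow> bool" where
  "coinciding l y \<longleftrightarrow> (\<forall>n x x'. x' \<in> L \<longrightarrow> tr ((Q ^^ n) y) x \<in> L \<longrightarrow> ov x x' \<longrightarrow> lead l x x')"

text \<open>Translating a pair for -y and exchanging its members gives a pair for y.\<close>

lemma coinciding_uminus:
  assumes "coinciding l y"
  shows "coinciding l (- y)"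
  unfolding coinciding_def
proof (intro allI impI)
  fix n x x' assume h: "x' \<in> L" "tr ((Q ^^ n) (- y)) x \<in> L" "ov x x'"
  let ?g = "(Q ^^ n) (- y)"
  have neg: "(Q ^^ n) y = - ?g" by (simp add: linear_neg[OF linear_Qn])
  have "tr ((Q ^^ n) y) (tr ?g x') \<in> L" using h(1) by (simp add: neg)
  moreover have "ov (tr ?g x') (tr ?g x)" using h(3) by (simp add: ov_tr ov_sym)
  ultimately have "lead l (tr ?g x') (tr ?g x)"
    using assms h(2) unfolding coinciding_def by blast
  then show "lead l x x'" by (auto simp: lead_tr) (auto simp: lead_def)
qed

text \<open>A translated bad point still overlaps some tile of the tiling. The coincidence of this
  overlap is a descendant of the bad point that is good, and goodness is inherited, so the bad
  points form a decaying family.\<close>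

lemma card_bad_le:
  assumes "l > 0"
  shows "\<exists>C \<gamma>. C > 0 \<and> 0 < \<gamma> \<and> \<gamma> < \<beta> \<and> (\<forall>y. coinciding l y \<longrightarrow>
    (\<forall>x\<in>L. \<forall>n. real (card {b \<in> ph n x. tr ((Q ^^ n) y) b \<notin> L}) \<le> C * \<gamma> ^ n))"
proof -
  obtain C \<gamma> where C: "C > 0" "0 < \<gamma>" "\<gamma> < \<beta>"
    "\<forall>x\<in>L. \<forall>S. decaying l x S \<longrightarrow> (\<forall>n. real (card (S n)) \<le> C * \<gamma> ^ n)"
    using decay[OF assms] by blast
  have "real (card {b \<in> ph n x. tr ((Q ^^ n) y) b \<notin> L}) \<le> C * \<gamma> ^ n"
    if y: "coinciding l y" and x: "x \<in> L" for x y n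
  proof -
    define S where "S n = {b \<in> ph n x. tr ((Q ^^ n) y) b \<notin> L}" for n
    have step: "tr ((Q ^^ (n + j)) y) b \<in> L" if "tr ((Q ^^ n) y) a \<in> L" "b \<in> ph j a" for a b n j
    proof -
      have "tr ((Q ^^ j) ((Q ^^ n) y)) b \<in> ph j (tr ((Q ^^ n) y) a)" using that(2) by (simp add: ph_tr)
      moreover have "(Q ^^ j) ((Q ^^ n) y) = (Q ^^ (n + j)) y" by (simp add: add.commute[of n] funpow_add)
      ultimately show ?thesis using ph_L[OF that(1), of j] by auto
    qed
    have "decaying l x S"
      unfolding decaying_def
    proof (intro allI conjI ballI)
      show "S n \<subseteq> ph n x" for n by (auto simp: S_def)
      show "S (n + l) \<subseteq> (\<Union>a\<in>S n. ph l a)" for n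
      proof
        fix b assume b: "b \<in> S (n + l)"
        then obtain a where a: "a \<in> ph n x" "b \<in> ph l a" by (auto simp: S_def Phi_pow_add)
        then have "a \<in> S n" using b step[of n a b l] by (auto simp: S_def)
        with a(2) show "b \<in> (\<Union>a\<in>S n. ph l a)" by blast
      qed
      show "\<exists>b\<in>ph l a. b \<notin> S (n + l)" if a: "a \<in> S n" for n a
      proof -
        let ?g = "(Q ^^ n) y"
        have aL: "a \<in> L" using a ph_L[OF x, of n] by (auto simp: S_def)
        obtain u where u: "u \<in> L" "ov u (tr ?g a)"
          using open_meets_L[OF open_tint tint_nonempty, of "tr ?g a"] unfolding ov_def by blast
        have "tr ?g (tr (- ?g) u) \<in> L" using u(1) by simp
        moreover have "ov (tr (- ?g) u) a"
          using u(2) ov_tr[of "- ?g" u "tr ?g a"] by simp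
        ultimately have "lead l (tr (- ?g) u) a"
          using y aL unfolding coinciding_def by blast
        then obtain b where b: "b \<in> ph l (tr (- ?g) u)" "b \<in> ph l a" by (auto simp: lead_def)
        have "tr ((Q ^^ (n + l)) y) b \<in> L"
          by (rule step[OF _ b(1)]) (use u(1) in simp)
        then show ?thesis using b(2) by (auto simp: S_def)
      qed
    qed
    then show ?thesis using C(4) x unfolding S_def by blast
  qed
  with C(1-3) show ?thesis by blast
qed

text \<open>A shifted supertile meets boundedly many supertiles of the tiling, since their ancestors
  overlap the shifted ancestor. A bound for genuine supertiles thus carries over with a constant
  factor.\<close>

lemma card_shifted_le:
  "\<exists>K>0. \<forall>Z n e x s. (\<forall>x\<in>L. real (card (Z \<inter> ph n x)) \<le> e) \<longrightarrow> 0 \<le> e \<longrightarrow>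
     real (card {b \<in> ph n x. tr s b \<in> L \<and> tr s b \<in> Z}) \<le> K * e"
proof -
  obtain K where K: "\<forall>p. finite {x \<in> L. norm (fst x - p) \<le> 2 * tile_radius} \<and>
    card {x \<in> L. norm (fst x - p) \<le> 2 * tile_radius} \<le> K"
    using L_locally_finite by blast
  have "real (card {b \<in> ph n x. tr s b \<in> L \<and> tr s b \<in> Z}) \<le> real (Suc K) * e"
    if Z: "\<forall>x\<in>L. real (card (Z \<inter> ph n x)) \<le> e" and e: "0 \<le> e" for Z n e x s
  proof -
    let ?z = "tr ((Qi ^^ n) s) x"
    let ?X = "{x' \<in> L. norm (fst x' - fst ?z) \<le> 2 * tile_radius}"
    let ?S = "{b \<in> ph n x. tr s b \<in> L \<and> tr s b \<in> Z}"
    have finX: "finite ?X" and cardX: "card ?X \<le> K" using K by blast+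
    have "tr s ` ?S \<subseteq> (\<Union>x'\<in>?X. Z \<inter> ph n x')"
    proof
      fix c assume "c \<in> tr s ` ?S"
      then obtain b where b: "c = tr s b" "b \<in> ph n x" "c \<in> L" "c \<in> Z" by auto
      obtain x' where x': "x' \<in> L" "c \<in> ph n x'" using L_parent[OF b(3)] by blast
      have "c \<in> ph n ?z" using b(1,2) by (simp add: ph_tr)
      from ov_dist[OF ov_ancestor[OF x'(2) this ov_refl]]
      show "c \<in> (\<Union>x'\<in>?X. Z \<inter> ph n x')" using x' b(4) by blast
    qed
    then have "card (tr s ` ?S) \<le> card (\<Union>x'\<in>?X. Z \<inter> ph n x')"
      using finX by (intro card_mono) auto
    also have "\<dots> \<le> (\<Sum>x'\<in>?X. card (Z \<inter> ph n x'))" by (rule card_UN_le[OF finX])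
    finally have "card ?S \<le> (\<Sum>x'\<in>?X. card (Z \<inter> ph n x'))"
      by (simp add: card_image inj_on_def)
    then have "real (card ?S) \<le> (\<Sum>x'\<in>?X. real (card (Z \<inter> ph n x')))"
      unfolding of_nat_sum[symmetric] by (simp only: of_nat_le_iff)
    also have "\<dots> \<le> (\<Sum>x'\<in>?X. e)" using Z by (intro sum_mono) auto
    also have "\<dots> \<le> real (Suc K) * e" using cardX e by (simp add: mult_right_mono)
    finally show ?thesis .
  qed
  then show ?thesis by (intro exI[of _ "real (Suc K)"]) auto
qed

text \<open>The shift \<open>s\<close> is arbitrary so that errors add: the exceptions for p + q at
  \<open>s\<close> are exceptions for p at \<open>s\<close> or for q at s + p.\<close>

definition ap :: "real \<Rightarrow> nat \<Rightarrow> real^'d \<Rightarrow> bool" where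
  "ap e n0 p \<longleftrightarrow> (\<forall>n\<ge>n0. \<forall>x\<in>L. \<forall>s.
     real (card {b \<in> ph n x. tr s b \<in> L \<and> tr (s + p) b \<notin> L}) \<le> e * \<beta> ^ n)"

lemma ap_mono: "ap e n0 p \<Longrightarrow> e \<le> e' \<Longrightarrow> n0 \<le> n0' \<Longrightarrow> ap e' n0' p"
  unfolding ap_def
proof (intro allI impI ballI)
  fix n x s
  assume "\<forall>n\<ge>n0. \<forall>x\<in>L. \<forall>s. real (card {b \<in> ph n x. tr s b \<in> L \<and> tr (s + p) b \<notin> L}) \<le> e * \<beta> ^ n"
    "e \<le> e'" "n0 \<le> n0'" "n0' \<le> n" "x \<in> L"
  then have "real (card {b \<in> ph n x. tr s b \<in> L \<and> tr (s + p) b \<notin> L}) \<le> e * \<beta> ^ n" by simp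
  also have "\<dots> \<le> e' * \<beta> ^ n" using \<open>e \<le> e'\<close> \<beta>_pos by (intro mult_right_mono) auto
  finally show "real (card {b \<in> ph n x. tr s b \<in> L \<and> tr (s + p) b \<notin> L}) \<le> e' * \<beta> ^ n" .
qed

lemma ap_zero: "ap 0 n0 0"
  by (auto simp: ap_def)

lemma ap_add:
  assumes "ap e n0 p" "ap e' n0 q"
  shows "ap (e + e') n0 (p + q)"
  unfolding ap_def
proof (intro allI impI ballI)
  fix n x s assume n: "n \<ge> n0" and x: "x \<in> L"
  let ?S = "\<lambda>s p. {b \<in> ph n x. tr s b \<in> L \<and> tr (s + p) b \<notin> L}"
  have "card (?S s (p + q)) \<le> card (?S s p \<union> ?S (s + p) q)"
    by (intro card_mono) (auto simp: add.assoc)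
  also have "\<dots> \<le> card (?S s p) + card (?S (s + p) q)" by (rule card_Un_le)
  finally have "real (card (?S s (p + q))) \<le> real (card (?S s p)) + real (card (?S (s + p) q))"
    by linarith
  also have "\<dots> \<le> e * \<beta> ^ n + e' * \<beta> ^ n"
    using assms n x unfolding ap_def by (intro add_mono) auto
  finally show "real (card (?S s (p + q))) \<le> (e + e') * \<beta> ^ n" by (simp add: distrib_right)
qed

lemma ap_of_nat: "ap e n0 p \<Longrightarrow> ap (real j * e) n0 (real j *\<^sub>R p)"
proof (induction j)
  case 0
  then show ?case by (simp add: ap_zero)
next
  case (Suc j)
  then show ?case using ap_add[of e n0 p "real j * e" "real j *\<^sub>R p"]
    by (simp add: algebra_simps)
qed

lemma ap_of_int:
  assumes "ap e n0 p" "ap e n0 (- p)" "0 \<le> e" "\<bar>z\<bar> \<le> int K"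
  shows "ap (real K * e) n0 (of_int z *\<^sub>R p)"
proof -
  let ?j = "nat \<bar>z\<bar>"
  have "ap (real ?j * e) n0 (of_int z *\<^sub>R p)"
    using ap_of_nat[OF assms(1), of ?j] ap_of_nat[OF assms(2), of ?j]
    by (cases "z \<ge> 0") (simp_all add: of_nat_nat)
  moreover have "real ?j * e \<le> real K * e"
    using assms(3,4) by (intro mult_right_mono) linarith+
  ultimately show ?thesis by (rule ap_mono) simp
qed

lemma ap_sum:
  assumes "finite S" "\<And>b. b \<in> S \<Longrightarrow> ap e n0 (f b)"
  shows "ap (real (card S) * e) n0 (sum f S)"
  using assms
proof (induction S)
  case empty
  then show ?case by (simp add: ap_zero)
next
  case (insert a S)
  have "ap (e + real (card S) * e) n0 (f a + sum f S)"
    using insert by (intro ap_add) auto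
  with insert show ?case by (simp add: algebra_simps)
qed

text \<open>A supertile of level n splits into at most \<kappa> \<beta>^(n-m) supertiles of level m,
  each with at most C \<gamma>^m bad points. Relative to \<beta>^n this is of order
  (\<gamma>/\<beta>)^m, and \<open>card_shifted_le\<close> extends it to all shifts.\<close>

lemma ap_basic:
  assumes "l > 0"
  shows "\<exists>C \<theta>. C > 0 \<and> 0 < \<theta> \<and> \<theta> < 1 \<and> (\<forall>y. coinciding l y \<longrightarrow> (\<forall>m. ap (C * \<theta> ^ m) m ((Q ^^ m) y)))"
proof -
  obtain C \<gamma> where C: "C > 0" "0 < \<gamma>" "\<gamma> < \<beta>" "\<forall>y. coinciding l y \<longrightarrow>
    (\<forall>x\<in>L. \<forall>n. real (card {b \<in> ph n x. tr ((Q ^^ n) y) b \<notin> L}) \<le> C * \<gamma> ^ n)"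
    using card_bad_le[OF assms] by blast
  obtain K where K: "K > 0" "\<forall>Z n e x s. (\<forall>x\<in>L. real (card (Z \<inter> ph n x)) \<le> e) \<longrightarrow> 0 \<le> e \<longrightarrow>
     real (card {b \<in> ph n x. tr s b \<in> L \<and> tr s b \<in> Z}) \<le> K * e"
    using card_shifted_le by blast
  have "ap (K * \<kappa> * C * (\<gamma> / \<beta>) ^ m) m ((Q ^^ m) y)" if y: "coinciding l y" for y m
    unfolding ap_def
  proof (intro allI impI ballI)
    fix n x s assume n: "n \<ge> m"
    let ?p = "(Q ^^ m) y"
    let ?Z = "{b. tr ?p b \<notin> L}"
    let ?e = "\<kappa> * \<beta> ^ (n - m) * (C * \<gamma> ^ m)"
    have "real (card (?Z \<inter> ph n z)) \<le> ?e" if z: "z \<in> L" for z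
    proof -
      have "?Z \<inter> ph n z = (\<Union>a\<in>ph (n - m) z. {b \<in> ph m a. tr ?p b \<notin> L})"
        using Phi_pow_add[of Q D "n - m" m z] n by auto
      then have "card (?Z \<inter> ph n z) \<le> (\<Sum>a\<in>ph (n - m) z. card {b \<in> ph m a. tr ?p b \<notin> L})"
        by (simp add: card_UN_le)
      then have "real (card (?Z \<inter> ph n z)) \<le> (\<Sum>a\<in>ph (n - m) z. real (card {b \<in> ph m a. tr ?p b \<notin> L}))"
        unfolding of_nat_sum[symmetric] by (simp only: of_nat_le_iff)
      also have "\<dots> \<le> (\<Sum>a\<in>ph (n - m) z. C * \<gamma> ^ m)"
        using C(4) y ph_L[OF z] by (intro sum_mono) blast
      also have "\<dots> \<le> ?e"
        using card_ph_le[OF z, of "n - m"] C(1,2) by (simp add: mult_right_mono)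
      finally show ?thesis .
    qed
    moreover have "0 \<le> ?e" using \<kappa>_pos \<beta>_pos C(1,2) by simp
    ultimately have "real (card {b \<in> ph n x. tr s b \<in> L \<and> tr s b \<in> ?Z}) \<le> K * ?e"
      using K(2) by blast
    also have "{b \<in> ph n x. tr s b \<in> L \<and> tr s b \<in> ?Z} = {b \<in> ph n x. tr s b \<in> L \<and> tr (s + ?p) b \<notin> L}"
      by (simp add: add.commute)
    also have "K * ?e = K * \<kappa> * C * (\<gamma> / \<beta>) ^ m * \<beta> ^ n"
      using n \<beta>_pos by (simp add: power_diff power_divide field_simps)
    finally show "real (card {b \<in> ph n x. tr s b \<in> L \<and> tr (s + ?p) b \<notin> L}) \<le>
      K * \<kappa> * C * (\<gamma> / \<beta>) ^ m * \<beta> ^ n" .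
  qed
  moreover have "K * \<kappa> * C > 0" "0 < \<gamma> / \<beta>" "\<gamma> / \<beta> < 1" using K(1) \<kappa>_pos C(1-3) \<beta>_pos by simp_all
  ultimately show ?thesis by blast
qed

text \<open>Expanding a vector in base \<open>Q\<close> with bounded integer combinations of \<open>B\<close> as digits shows that the
  almost periods are relatively dense.\<close>

lemma ap_expansion:
  assumes B: "independent B" "span B = UNIV" and l: "l > 0"
    and coin: "\<forall>b\<in>B. coinciding l b"
  shows "\<exists>C \<theta> r. C > 0 \<and> 0 < \<theta> \<and> \<theta> < 1 \<and> r > 0 \<and> (\<forall>N M v. norm v \<le> r \<longrightarrow>
    (\<exists>p v'. (Q ^^ (N + M)) v = p + (Q ^^ N) v' \<and> norm v' \<le> r \<and>
       ap (C * \<theta> ^ N) (N + M) p \<and> ap (C * \<theta> ^ N) (N + M) (- p)))"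
proof -
  have finB: "finite B" using B(1) by (rule independent_imp_finite)
  obtain C1 \<theta> where C1: "C1 > 0" "0 < \<theta>" "\<theta> < 1"
    "\<forall>y. coinciding l y \<longrightarrow> (\<forall>m. ap (C1 * \<theta> ^ m) m ((Q ^^ m) y))"
    using ap_basic[OF l] by (elim exE conjE)
  have ap_B: "ap (C1 * \<theta> ^ m) m ((Q ^^ m) b)" "ap (C1 * \<theta> ^ m) m (- (Q ^^ m) b)" if "b \<in> B" for b m
    using C1(4) bspec[OF coin that] coinciding_uminus[OF bspec[OF coin that]]
    by (auto simp flip: linear_neg[OF linear_Qn])
  obtain r where r: "r > 0" "\<forall>M. \<exists>K::nat. \<forall>v. norm v \<le> M \<longrightarrow> (\<exists>z::real^'d \<Rightarrow> int.
      (\<forall>b\<in>B. \<bar>z b\<bar> \<le> int K) \<and> norm (v - (\<Sum>b\<in>B. of_int (z b) *\<^sub>R b)) \<le> r)"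
    using rounding_to_lattice[OF B] by (elim exE conjE)
  obtain q where q: "q > 0" "\<forall>v. norm (Q v) \<le> norm v * q"
    using bounded_linear.pos_bounded linear_Q by (auto simp: linear_conv_bounded_linear)
  obtain K :: nat where K: "\<forall>v. norm v \<le> r * q \<longrightarrow> (\<exists>z::real^'d \<Rightarrow> int.
      (\<forall>b\<in>B. \<bar>z b\<bar> \<le> int K) \<and> norm (v - (\<Sum>b\<in>B. of_int (z b) *\<^sub>R b)) \<le> r)"
    using r(2) by blast
  define C2 where "C2 = real (card B) * (real K * C1)"
  have C2: "C2 \<ge> 0" using C1(1) by (simp add: C2_def)
  have ap_comb: "ap (C2 * \<theta> ^ m) m ((Q ^^ m) (\<Sum>b\<in>B. of_int (z b) *\<^sub>R b))"
    if z: "\<forall>b\<in>B. \<bar>z b\<bar> \<le> int K" for z m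
  proof -
    have "ap (real (card B) * (real K * (C1 * \<theta> ^ m))) m (\<Sum>b\<in>B. of_int (z b) *\<^sub>R (Q ^^ m) b)"
      by (intro ap_sum[OF finB] ap_of_int ap_B) (use z C1 in auto)
    then show ?thesis
      by (simp add: C2_def mult_ac linear_sum[OF linear_Qn] linear_cmul[OF linear_Qn])
  qed
  \<comment> \<open>The M leading digits go into p, with errors of orders \<theta>^N to
    \<theta>^(N+M-1); the rest remains as Q^N v'. Starting at N makes the geometric sum small
    whatever M is.\<close>
  have main: "\<exists>p v'. (Q ^^ (N + M)) v = p + (Q ^^ N) v' \<and> norm v' \<le> r \<and>
      ap (\<Sum>i<M. C2 * \<theta> ^ (N + i)) (N + M) p \<and> ap (\<Sum>i<M. C2 * \<theta> ^ (N + i)) (N + M) (- p)"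
    if "norm v \<le> r" for N M v
    using that
  proof (induction M arbitrary: v)
    case 0
    then show ?case by (intro exI[of _ 0] exI[of _ v]) (simp add: ap_zero)
  next
    case (Suc M)
    have "norm (Q v) \<le> r * q"
      using q Suc.prems mult_right_mono[of "norm v" r q] by (meson less_imp_le order_trans)
    then obtain z :: "real^'d \<Rightarrow> int" where z: "\<forall>b\<in>B. \<bar>z b\<bar> \<le> int K"
      "norm (Q v - (\<Sum>b\<in>B. of_int (z b) *\<^sub>R b)) \<le> r"
      using K by blast
    define c where "c = (\<Sum>b\<in>B. of_int (z b) *\<^sub>R b)"
    \<comment> \<open>The negated coefficients are admissible too, so p and -p are treated
      together.\<close>
    define c' where "c' = (\<Sum>b\<in>B. of_int (- z b) *\<^sub>R b)"
    have c': "c' = - c" by (simp add: c_def c'_def sum_negf)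
    obtain p v' where p: "(Q ^^ (N + M)) (Q v - c) = p + (Q ^^ N) v'" "norm v' \<le> r"
      "ap (\<Sum>i<M. C2 * \<theta> ^ (N + i)) (N + M) p" "ap (\<Sum>i<M. C2 * \<theta> ^ (N + i)) (N + M) (- p)"
      using Suc.IH[of "Q v - c"] z(2) unfolding c_def by blast
    let ?e = "\<Sum>i<Suc M. C2 * \<theta> ^ (N + i)"
    have "ap ?e (N + M) ((Q ^^ (N + M)) c + p)"
      using ap_add[OF ap_comb[OF z(1)] p(3)] by (simp add: c_def add.commute)
    moreover have "ap ?e (N + M) ((Q ^^ (N + M)) c' + - p)"
      using ap_add[OF ap_comb[of "\<lambda>b. - z b"] p(4)] z(1) by (simp add: c'_def add.commute)
    then have "ap ?e (N + M) (- ((Q ^^ (N + M)) c + p))"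
      by (simp add: c' linear_neg[OF linear_Qn])
    moreover have "(Q ^^ (N + Suc M)) v = ((Q ^^ (N + M)) c + p) + (Q ^^ N) v'"
    proof -
      have "(Q ^^ (N + Suc M)) v = (Q ^^ (N + M)) (Q v)" by (simp add: funpow_swap1)
      also have "\<dots> = (Q ^^ (N + M)) c + (Q ^^ (N + M)) (Q v - c)"
        by (simp add: linear_diff[OF linear_Qn])
      finally show ?thesis by (simp add: p(1) add.assoc)
    qed
    ultimately show ?case
      using p(2) by (intro exI[of _ "(Q ^^ (N + M)) c + p"] exI[of _ v']) (auto intro: ap_mono)
  qed
  \<comment> \<open>The added 1 keeps C positive when \<open>C2\<close> is 0.\<close>
  define C where "C = C2 / (1 - \<theta>) + 1"
  have geo: "(\<Sum>i<M. C2 * \<theta> ^ (N + i)) \<le> C * \<theta> ^ N" for N M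
  proof -
    have "(\<Sum>i<M. C2 * \<theta> ^ (N + i)) = C2 * \<theta> ^ N * (\<Sum>i<M. \<theta> ^ i)"
      by (simp add: power_add sum_distrib_left mult_ac)
    also have "(\<Sum>i<M. \<theta> ^ i) \<le> 1 / (1 - \<theta>)"
      using C1(2,3) by (simp add: sum_gp_strict divide_right_mono)
    finally have "(\<Sum>i<M. C2 * \<theta> ^ (N + i)) \<le> C2 * \<theta> ^ N * (1 / (1 - \<theta>))"
      using C2 C1(2) by (simp add: mult_left_mono)
    also have "\<dots> \<le> C * \<theta> ^ N"
      using C1(2) by (simp add: C_def distrib_right)
    finally show ?thesis .
  qed
  have "C > 0" using C2 C1(3) by (simp add: C_def add_nonneg_pos)
  have "\<exists>p v'. (Q ^^ (N + M)) v = p + (Q ^^ N) v' \<and> norm v' \<le> r \<and>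
       ap (C * \<theta> ^ N) (N + M) p \<and> ap (C * \<theta> ^ N) (N + M) (- p)" if v: "norm v \<le> r" for N M v
  proof -
    obtain p v' where "(Q ^^ (N + M)) v = p + (Q ^^ N) v'" "norm v' \<le> r"
      "ap (\<Sum>i<M. C2 * \<theta> ^ (N + i)) (N + M) p" "ap (\<Sum>i<M. C2 * \<theta> ^ (N + i)) (N + M) (- p)"
      using main[OF v] by blast
    then show ?thesis using ap_mono[OF _ geo le_refl] by blast
  qed
  then show ?thesis using \<open>C > 0\<close> C1(2,3) r(1) by blast
qed

section \<open>From almost periods to all return vectors\<close>

lemma ap_lower_level:
  assumes "ap e (n + j) p" "x \<in> L"
  shows "real (card {b \<in> ph n x. tr s b \<in> L \<and> tr (s + p) b \<notin> L}) \<le> e * \<beta> ^ j * \<beta> ^ n"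
proof -
  \<comment> \<open>The estimate is known at level n + j only, so the supertile of x is enlarged to
    one of that level, at the price of \<beta>^j.\<close>
  obtain z where z: "z \<in> L" "x \<in> ph j z" using L_parent[OF assms(2)] by blast
  have "ph n x \<subseteq> ph (j + n) z" using Phi_pow_trans[OF z(2)] by blast
  then have "ph n x \<subseteq> ph (n + j) z" by (simp only: add.commute)
  then have "card {b \<in> ph n x. tr s b \<in> L \<and> tr (s + p) b \<notin> L} \<le>
      card {b \<in> ph (n + j) z. tr s b \<in> L \<and> tr (s + p) b \<notin> L}"
    by (intro card_mono) auto
  also have "real \<dots> \<le> e * \<beta> ^ (n + j)"
    using assms(1) z(1) unfolding ap_def by blast
  finally show ?thesis by (simp add: power_add mult_ac)
qed

text \<open>Let b be a descendant of x' inside the inflated intersection. If its translate were in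
  the tiling, it would be a descendant of the translated x, making b a common descendant. So all
  such b are bad, and they form a positive proportion.\<close>

lemma card_bad_ge:
  assumes "x' \<in> L" "tr y x \<in> L" "ov x x'" "\<And>n. \<not> lead n x x'"
  shows "\<exists>c>0. \<exists>m. \<forall>n\<ge>m. c * \<beta> ^ n \<le> real (card {b \<in> ph n x'. tr ((Q ^^ n) y) b \<notin> L})"
proof -
  let ?U = "tint x \<inter> tint x'"
  obtain c m where c: "c > 0" "\<forall>n\<ge>m. c * \<beta> ^ n \<le> real (card {b \<in> ph n x'. tint b \<subseteq> (Q ^^ n) ` ?U})"
  proof -
    have "open ?U" "?U \<noteq> {}" "?U \<subseteq> tint x'" using assms(3) by (auto simp: ov_def open_tint)
    from card_inside_open[OF assms(1) this] show ?thesis by (elim exE conjE) (rule that)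
  qed
  have "{b \<in> ph n x'. tint b \<subseteq> (Q ^^ n) ` ?U} \<subseteq> {b \<in> ph n x'. tr ((Q ^^ n) y) b \<notin> L}" for n
  proof
    fix b assume "b \<in> {b \<in> ph n x'. tint b \<subseteq> (Q ^^ n) ` ?U}"
    then have b: "b \<in> ph n x'" "tint b \<subseteq> (Q ^^ n) ` tint x" by auto
    have "tr ((Q ^^ n) y) b \<notin> L"
    proof
      assume "tr ((Q ^^ n) y) b \<in> L"
      moreover have "tint (tr ((Q ^^ n) y) b) \<subseteq> (Q ^^ n) ` tint (tr y x)"
        using b(2) by (auto simp: tint_tr image_image linear_add[OF linear_Qn])
      ultimately have "tr ((Q ^^ n) y) b \<in> ph n (tr y x)" by (rule ph_tint_unique[OF assms(2)])
      then have "b \<in> ph n x" by (auto simp: ph_tr)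
      with b(1) assms(4)[of n] show False by (auto simp: lead_def)
    qed
    with b(1) show "b \<in> {b \<in> ph n x'. tr ((Q ^^ n) y) b \<notin> L}" by simp
  qed
  then have "card {b \<in> ph n x'. tint b \<subseteq> (Q ^^ n) ` ?U} \<le>
      card {b \<in> ph n x'. tr ((Q ^^ n) y) b \<notin> L}" for n
    by (intro card_mono) auto
  with c have "\<forall>n\<ge>m. c * \<beta> ^ n \<le> real (card {b \<in> ph n x'. tr ((Q ^^ n) y) b \<notin> L})"
    by (meson of_nat_le_iff order_trans)
  with c(1) show ?thesis by blast
qed

text \<open>By primitivity the supertile of \<open>x0\<close> contains a copy of every lower supertile; a shift by \<open>h\<close>
  behaves alike on the two copies except near their boundaries.\<close>

lemma card_bad_transfer:
  assumes "x0 \<in> L" "z \<in> L" "z1 \<in> ph m x0" "snd z1 = snd z"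
  shows "card {b \<in> ph n z. tr h b \<notin> L} \<le> card {b \<in> ph (m + n) x0. tr h b \<notin> L} +
    card {b \<in> ph n z1. \<exists>c\<in>L. c \<notin> ph n z1 \<and> norm (fst b - fst c) \<le> norm h}"
proof -
  let ?g = "(Q ^^ n) (fst z - fst z1)"
  let ?N = "{b \<in> ph n z1. \<exists>c\<in>L. c \<notin> ph n z1 \<and> norm (fst b - fst c) \<le> norm h}"
  have z: "z = tr (fst z - fst z1) z1" using assms(4) by (simp add: prod_eq_iff)
  have phz: "ph n z = tr ?g ` ph n z1" by (subst z) (rule ph_tr)
  have "{b \<in> ph n z. tr h b \<notin> L} \<subseteq> tr ?g ` ({b \<in> ph (m + n) x0. tr h b \<notin> L} \<union> ?N)"
  proof
    fix b assume "b \<in> {b \<in> ph n z. tr h b \<notin> L}"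
    then obtain b' where b': "b = tr ?g b'" "b' \<in> ph n z1" and b: "tr h b \<notin> L" by (auto simp: phz)
    \<comment> \<open>A copy that is good below \<open>z1\<close> while the original is bad must be
      shifted out of the supertile of \<open>z1\<close>, hence lies within norm h of a point outside
      it.\<close>
    have "b' \<in> ?N" if "tr h b' \<in> L"
    proof -
      have "tr h b' \<notin> ph n z1"
      proof
        assume "tr h b' \<in> ph n z1"
        then have "tr ?g (tr h b') \<in> ph n z" by (simp only: phz imageI)
        then have "tr h b \<in> L" using ph_L[OF assms(2), of n] b'(1) by (auto simp: add.commute)
        with b show False by blast
      qed
      moreover have "norm (fst b' - fst (tr h b')) \<le> norm h" by simp
      ultimately show ?thesis using that b'(2) by blast
    qed
    moreover have "b' \<in> ph (m + n) x0" by (rule Phi_pow_trans[OF assms(3) b'(2)])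
    ultimately show "b \<in> tr ?g ` ({b \<in> ph (m + n) x0. tr h b \<notin> L} \<union> ?N)"
      using b'(1) by blast
  qed
  then have "card {b \<in> ph n z. tr h b \<notin> L} \<le> card ({b \<in> ph (m + n) x0. tr h b \<notin> L} \<union> ?N)"
    by (intro surj_card_le) auto
  also have "\<dots> \<le> card {b \<in> ph (m + n) x0. tr h b \<notin> L} + card ?N" by (rule card_Un_le)
  finally show ?thesis .
qed

text \<open>Write \<open>Q\<^sup>n y = p + h\<close> with an almost period \<open>p\<close> and \<open>h\<close> from a fixed finite set. Since \<open>Q\<^sup>n y\<close>
  carries the supertile of \<open>x0\<close> into the tiling, so does \<open>h\<close> up to few exceptions.\<close>

lemma card_bad_infinitely_often:
  assumes B: "independent B" "span B = UNIV" and l: "l > 0"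
    and coin: "\<forall>b\<in>B. coinciding l b"
    and y: "x0 \<in> L" "tr y x0 \<in> L" and x': "x' \<in> L" and e: "e > 0"
  shows "\<exists>I. infinite I \<and> (\<forall>n\<in>I. real (card {b \<in> ph n x'. tr ((Q ^^ n) y) b \<notin> L}) \<le> e * \<beta> ^ n)"
proof -
  obtain m where m: "\<forall>x i. \<exists>a\<in>ph m x. snd a = i" using ph_colour by blast
  obtain C \<theta> r where C: "C > 0" "0 < \<theta>" "\<theta> < 1" "r > 0" "\<forall>N M v. norm v \<le> r \<longrightarrow>
    (\<exists>p v'. (Q ^^ (N + M)) v = p + (Q ^^ N) v' \<and> norm v' \<le> r \<and>
       ap (C * \<theta> ^ N) (N + M) p \<and> ap (C * \<theta> ^ N) (N + M) (- p))"
    using ap_expansion[OF B l coin] by (elim exE conjE)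
  \<comment> \<open>The expansion starts from vectors of norm at most r. As Q^n y is Q^(n+j) applied
    to \<open>(Qi ^^ j) y\<close>, every y is covered by raising the level by j.\<close>
  obtain j where j: "norm ((Qi ^^ j) y) \<le> r"
  proof -
    obtain j where "\<forall>n\<ge>j. \<forall>v. norm ((Qi ^^ n) v) \<le> r / (norm y + 1) * norm v"
      using Qin_small[of "r / (norm y + 1)"] C(4) by (auto simp: add_nonneg_pos)
    then have "norm ((Qi ^^ j) y) \<le> r / (norm y + 1) * norm y" by blast
    also have "\<dots> = r * (norm y / (norm y + 1))" by simp
    also have "\<dots> \<le> r * 1"
      using C(4) by (intro mult_left_mono) (auto simp: divide_le_eq_1 add_nonneg_pos)
    finally have "norm ((Qi ^^ j) y) \<le> r" by simp
    then show ?thesis by (rule that)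
  qed
  let ?k = "\<kappa> * \<beta> ^ m"
  \<comment> \<open>The first entry serves the final estimate, which collects \<open>?k\<close>
    errors over the pieces of the supertile of x' and one more for P n. The second leaves a point
    that P n carries into the tiling.\<close>
  define e0 where "e0 = min (e / (2 * (?k + 1))) (1 / (2 * \<kappa>))"
  have "?k > 0" using \<kappa>_pos \<beta>_pos by simp
  then have e0: "e0 > 0" "(?k + 1) * e0 \<le> e / 2" "e0 < 1 / \<kappa>"
  proof -
    show "e0 > 0" using e \<kappa>_pos \<open>?k > 0\<close> by (simp add: e0_def)
    have "e0 \<le> e / (2 * (?k + 1))" by (simp add: e0_def)
    then show "(?k + 1) * e0 \<le> e / 2" using \<open>?k > 0\<close> by (simp add: field_simps)
    have "e0 \<le> 1 / (2 * \<kappa>)" by (simp add: e0_def)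
    also have "\<dots> < 1 / \<kappa>" using \<kappa>_pos by (simp add: field_simps)
    finally show "e0 < 1 / \<kappa>" .
  qed
  obtain N where N: "C * \<theta> ^ N * \<beta> ^ j \<le> e0"
  proof -
    have pos: "C * \<beta> ^ j > 0" using C(1) \<beta>_pos by simp
    obtain N where "\<theta> ^ N < e0 / (C * \<beta> ^ j)"
      using real_arch_pow_inv[of "e0 / (C * \<beta> ^ j)" \<theta>] e0(1) pos C(3) by auto
    then have "\<theta> ^ N * (C * \<beta> ^ j) < e0" using pos by (simp only: pos_less_divide_eq)
    then show ?thesis by (intro that[of N]) (simp add: mult_ac)
  qed
  let ?R = "\<lambda>n p v. (Q ^^ n) y = p + (Q ^^ N) v \<and> norm v \<le> r \<and>
      ap (C * \<theta> ^ N) (n + j) p \<and> ap (C * \<theta> ^ N) (n + j) (- p)"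
  have R: "\<exists>p v. ?R n p v" if "n \<ge> N" for n
  proof -
    have eq: "N + (n + j - N) = n + j" using that by simp
    have "(Q ^^ (n + j)) ((Qi ^^ j) y) = (Q ^^ n) y" by (simp add: funpow_add)
    with C(5)[rule_format, OF j, of N "n + j - N"] show ?thesis unfolding eq by simp
  qed
  define P where "P n = (SOME p. \<exists>v. ?R n p v)" for n
  define V where "V n = (SOME v. ?R n (P n) v)" for n
  have PV: "?R n (P n) (V n)" if "n \<ge> N" for n
  proof -
    have "\<exists>v. ?R n (P n) v" unfolding P_def by (rule someI_ex[OF R[OF that]])
    then show ?thesis unfolding V_def by (rule someI_ex)
  qed
  define H where "H n = (Q ^^ N) (V n)" for n
  have few: "real (card {b \<in> ph n x. tr s b \<in> L \<and> tr (s + P n) b \<notin> L}) \<le> e0 * \<beta> ^ n"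
    "real (card {b \<in> ph n x. tr s b \<in> L \<and> tr (s + - P n) b \<notin> L}) \<le> e0 * \<beta> ^ n"
    if "n \<ge> N" "x \<in> L" for n x s
  proof -
    have "C * \<theta> ^ N * \<beta> ^ j * \<beta> ^ n \<le> e0 * \<beta> ^ n"
      using N \<beta>_pos by (intro mult_right_mono) auto
    then show "real (card {b \<in> ph n x. tr s b \<in> L \<and> tr (s + P n) b \<notin> L}) \<le> e0 * \<beta> ^ n"
      "real (card {b \<in> ph n x. tr s b \<in> L \<and> tr (s + - P n) b \<notin> L}) \<le> e0 * \<beta> ^ n"
      using ap_lower_level[of "C * \<theta> ^ N" n j "P n" x s] ap_lower_level[of "C * \<theta> ^ N" n j "- P n" x s]
        PV[OF that(1)] that(2) by linarith+
  qed
  \<comment> \<open>Not all points of the supertile of x0 are exceptional, so P n is a return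
    vector. This places H n in Xi - Xi.\<close>
  have P_Xi: "P n \<in> Xi T" if n: "n \<ge> N" for n
  proof (rule ccontr)
    assume "P n \<notin> Xi T"
    then have "{b \<in> ph n x0. tr 0 b \<in> L \<and> tr (0 + P n) b \<notin> L} = ph n x0"
      using ph_L[OF y(1), of n] by (auto simp: Xi_iff)
    then have "real (card (ph n x0)) \<le> e0 * \<beta> ^ n" using few(1)[OF n y(1), of 0] by simp
    moreover have "e0 * \<beta> ^ n < 1 / \<kappa> * \<beta> ^ n" using e0(3) \<beta>_pos by (intro mult_strict_right_mono) auto
    ultimately show False using card_ph_ge[OF y(1), of n] by simp
  qed
  obtain q where q: "q > 0" "\<forall>v. norm ((Q ^^ N) v) \<le> norm v * q"
    using bounded_linear.pos_bounded linear_Qn[of N] by (auto simp: linear_conv_bounded_linear)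
  have H_in: "H n \<in> {h \<in> Xid. norm h \<le> r * q}" if n: "n \<ge> N" for n
  proof -
    have "y \<in> Xi T" using y by (auto simp: Xi_iff)
    then have "(Q ^^ n) y - P n \<in> Xid" using Q_Xi P_Xi[OF n] by blast
    moreover have "H n = (Q ^^ n) y - P n" using PV[OF n] by (simp add: H_def)
    moreover have "norm (H n) \<le> r * q"
    proof -
      have "norm (H n) \<le> norm (V n) * q" using q(2) by (simp add: H_def)
      also have "\<dots> \<le> r * q" using PV[OF n] q(1) by (intro mult_right_mono) auto
      finally show ?thesis .
    qed
    ultimately show ?thesis by simp
  qed
  have "\<exists>h. infinite {n \<in> {N..}. H n = h}"
  proof -
    have "finite (H ` {N..})"
      by (rule finite_subset[OF _ finite_Xid[of "r * q"]]) (use H_in in blast)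
    from pigeonhole_infinite[OF infinite_Ici this] show ?thesis by metis
  qed
  then obtain h where h: "infinite {n \<in> {N..}. H n = h}" by blast
  \<comment> \<open>These constants depend on h, so they are available only after one recurring h
    has been fixed; n0 is chosen accordingly.\<close>
  obtain C' \<gamma> where C': "C' > 0" "0 < \<gamma>" "\<gamma> < \<beta>" "\<forall>x\<in>L. \<forall>n.
    real (card {b \<in> ph n x. \<exists>c\<in>L. c \<notin> ph n x \<and> norm (fst b - fst c) \<le> norm h}) \<le> C' * \<gamma> ^ n"
    using card_near_boundary[OF norm_ge_zero, of h] by (elim exE conjE)
  obtain n0 where n0: "?k * (C' / \<gamma> ^ m) * (\<gamma> / \<beta>) ^ n0 \<le> e / 2"
  proof -
    have pos: "?k * (C' / \<gamma> ^ m) > 0" using \<open>?k > 0\<close> C'(1,2) by simp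
    obtain n0 where "(\<gamma> / \<beta>) ^ n0 < (e / 2) / (?k * (C' / \<gamma> ^ m))"
    proof -
      have "(e / 2) / (?k * (C' / \<gamma> ^ m)) > 0" by (rule divide_pos_pos[OF _ pos]) (use e in simp)
      moreover have "\<gamma> / \<beta> < 1" using C'(3) \<beta>_pos by simp
      ultimately show ?thesis using real_arch_pow_inv that by blast
    qed
    then have "(\<gamma> / \<beta>) ^ n0 * (?k * (C' / \<gamma> ^ m)) < e / 2" using pos by (simp only: pos_less_divide_eq)
    then show ?thesis by (intro that[of n0]) (simp add: mult_ac)
  qed
  let ?I = "{n \<in> {N..}. H n = h} - {..<n0 + m}"
  have "real (card {b \<in> ph n x'. tr ((Q ^^ n) y) b \<notin> L}) \<le> e * \<beta> ^ n" if "n \<in> ?I" for n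
  proof -
    have n: "n \<ge> N" "n \<ge> m" "n \<ge> n0" and Hn: "H n = h" using that by auto
    have y_eq: "(Q ^^ n) y = h + P n" using PV[OF n(1)] Hn by (simp add: H_def add.commute)
    \<comment> \<open>Q^n y carries the supertile of x0 into the tiling; undoing P n leaves h and
      costs at most e0 \<beta>^n.\<close>
    have x0: "real (card {b \<in> ph n x0. tr h b \<notin> L}) \<le> e0 * \<beta> ^ n"
    proof -
      have "ph n (tr y x0) \<subseteq> L" by (rule ph_L[OF y(2)])
      then have "{b \<in> ph n x0. tr h b \<notin> L} =
          {b \<in> ph n x0. tr ((Q ^^ n) y) b \<in> L \<and> tr ((Q ^^ n) y + - P n) b \<notin> L}"
        by (auto simp: y_eq ph_tr)
      then show ?thesis using few(2)[OF n(1) y(1), of "(Q ^^ n) y"] by simp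
    qed
    have low: "real (card {b \<in> ph (n - m) z. tr h b \<notin> L}) \<le> e0 * \<beta> ^ n + C' * \<gamma> ^ (n - m)"
      if z: "z \<in> L" for z
    proof -
      obtain z1 where z1: "z1 \<in> ph m x0" "snd z1 = snd z" using m by blast
      have "z1 \<in> L" using z1(1) ph_L[OF y(1)] by blast
      then have "real (card {b \<in> ph (n - m) z1. \<exists>c\<in>L. c \<notin> ph (n - m) z1 \<and>
          norm (fst b - fst c) \<le> norm h}) \<le> C' * \<gamma> ^ (n - m)" using C'(4) by blast
      moreover have "m + (n - m) = n" using n(2) by simp
      ultimately show ?thesis
        using card_bad_transfer[OF y(1) z z1, of "n - m" h] x0 by simp
    qed
    have "{b \<in> ph n x'. tr h b \<notin> L} = (\<Union>z\<in>ph m x'. {b \<in> ph (n - m) z. tr h b \<notin> L})"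
      using Phi_pow_add[of Q D m "n - m" x'] n(2) by auto
    then have "card {b \<in> ph n x'. tr h b \<notin> L} \<le> (\<Sum>z\<in>ph m x'. card {b \<in> ph (n - m) z. tr h b \<notin> L})"
      by (simp add: card_UN_le)
    then have "real (card {b \<in> ph n x'. tr h b \<notin> L}) \<le>
        (\<Sum>z\<in>ph m x'. real (card {b \<in> ph (n - m) z. tr h b \<notin> L}))"
      unfolding of_nat_sum[symmetric] by (simp only: of_nat_le_iff)
    also have "\<dots> \<le> (\<Sum>z\<in>ph m x'. e0 * \<beta> ^ n + C' * \<gamma> ^ (n - m))"
      using ph_L[OF x'] by (intro sum_mono low) blast
    also have "\<dots> = real (card (ph m x')) * (e0 * \<beta> ^ n + C' * \<gamma> ^ (n - m))" by simp
    also have "\<dots> \<le> ?k * (e0 * \<beta> ^ n + C' * \<gamma> ^ (n - m))"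
      using card_ph_le[OF x', of m] e0(1) C'(1,2) \<beta>_pos by (intro mult_right_mono) auto
    finally have bad_h: "real (card {b \<in> ph n x'. tr h b \<notin> L}) \<le> ?k * (e0 * \<beta> ^ n + C' * \<gamma> ^ (n - m))" .
    have "card {b \<in> ph n x'. tr ((Q ^^ n) y) b \<notin> L} \<le>
        card ({b \<in> ph n x'. tr h b \<notin> L} \<union> {b \<in> ph n x'. tr h b \<in> L \<and> tr (h + P n) b \<notin> L})"
      unfolding y_eq by (intro card_mono) auto
    also have "\<dots> \<le> card {b \<in> ph n x'. tr h b \<notin> L} +
        card {b \<in> ph n x'. tr h b \<in> L \<and> tr (h + P n) b \<notin> L}"
      by (rule card_Un_le)
    finally have "real (card {b \<in> ph n x'. tr ((Q ^^ n) y) b \<notin> L}) \<le>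
        ?k * (e0 * \<beta> ^ n + C' * \<gamma> ^ (n - m)) + e0 * \<beta> ^ n"
      using bad_h few(1)[OF n(1) x', of h] by linarith
    also have "\<dots> = (?k + 1) * e0 * \<beta> ^ n + ?k * (C' / \<gamma> ^ m) * (\<gamma> / \<beta>) ^ n * \<beta> ^ n"
      using n(2) C'(2) \<beta>_pos by (simp add: power_diff power_divide algebra_simps)
    also have "\<dots> \<le> e / 2 * \<beta> ^ n + e / 2 * \<beta> ^ n"
    proof (intro add_mono mult_right_mono)
      show "(?k + 1) * e0 \<le> e / 2" by (rule e0(2))
      have "(\<gamma> / \<beta>) ^ n \<le> (\<gamma> / \<beta>) ^ n0" using n(3) C'(2,3) \<beta>_pos by (intro power_decreasing) auto
      then have "?k * (C' / \<gamma> ^ m) * (\<gamma> / \<beta>) ^ n \<le> ?k * (C' / \<gamma> ^ m) * (\<gamma> / \<beta>) ^ n0"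
        using \<open>?k > 0\<close> C'(1,2) by (intro mult_left_mono) auto
      with n0 show "?k * (C' / \<gamma> ^ m) * (\<gamma> / \<beta>) ^ n \<le> e / 2" by linarith
    qed (use \<beta>_pos in auto)
    finally show ?thesis by (simp add: algebra_simps)
  qed
  moreover have "infinite ?I" using h by (rule Diff_infinite_finite[rotated]) simp
  ultimately show ?thesis by blast
qed

text \<open>A pair that never coincides has at least c \<beta>^n bad descendants for all large n,
  whereas for infinitely many n there are at most half as many.\<close>

lemma lead_of_coinciding_basis:
  assumes B: "independent B" "span B = UNIV" and l: "l > 0"
    and coin: "\<forall>b\<in>B. coinciding l b"
    and y: "y \<in> Xi T" and x: "x' \<in> L" "tr y x \<in> L" "ov x x'"
  shows "\<exists>n. lead n x x'"
proof (rule ccontr)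
  assume "\<not> ?thesis"
  then obtain c m where c: "c > 0"
    "\<forall>n\<ge>m. c * \<beta> ^ n \<le> real (card {b \<in> ph n x'. tr ((Q ^^ n) y) b \<notin> L})"
    using card_bad_ge[OF x] by blast
  obtain x0 where x0: "x0 \<in> L" "tr y x0 \<in> L" using y by (auto simp: Xi_iff)
  obtain I where I: "infinite I"
    "\<forall>n\<in>I. real (card {b \<in> ph n x'. tr ((Q ^^ n) y) b \<notin> L}) \<le> c / 2 * \<beta> ^ n"
    using card_bad_infinitely_often[OF B l coin x0 x(1), of "c / 2"] c(1) by auto
  obtain n where n: "n \<in> I" "n \<ge> m"
    using I(1) unfolding infinite_nat_iff_unbounded_le by blast
  have "c * \<beta> ^ n \<le> c / 2 * \<beta> ^ n" using c(2) I(2) n by (meson order_trans)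
  moreover have "c / 2 * \<beta> ^ n < c * \<beta> ^ n" using c(1) \<beta>_pos by simp
  ultimately show False by linarith
qed

end

section \<open>The graph of potential overlaps\<close>

locale overlap_graph = weighted_self_affine Q A D T k w \<beta>
  for Q :: "real^'d::finite \<Rightarrow> real^'d" and A :: "'c::finite \<Rightarrow> (real^'d) set" and D T k w \<beta> +
  fixes B :: "(real^'d) set"
  assumes B_Xi: "B \<subseteq> Xi T" and B_indep: "independent B" and B_span: "span B = UNIV"
begin

abbreviation R :: real where "R \<equiv> overlap_radius Q D k"
abbreviation G :: "(('d, 'c) po_class, ('d, 'c) po_arc) pre_digraph" where "G \<equiv> po_graph Q A D T B k"

text \<open>The condition on vertices without the bound R; unlike that bound it passes to all pairs
  of descendants.\<close>

definition level_pair :: "('d, 'c) cpoint \<Rightarrow> ('d, 'c) cpoint \<Rightarrow> bool" where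
  "level_pair x x' \<longleftrightarrow> x' \<in> L \<and> (\<exists>n. \<exists>\<alpha>\<in>B. tr ((Q ^^ n) \<alpha>) x \<in> L)"

lemma po_class_eq: "po_class (X, y, X') = cls (tr (- y) X) X'"
  by (cases X; cases X') (simp add: cls_def)

lemma is_potential_overlap_iff:
  "is_potential_overlap r A T (X, y, X') \<longleftrightarrow>
    X \<in> L \<and> X' \<in> L \<and> y \<in> Xi T \<and> norm (fst (tr (- y) X) - fst X') \<le> r"
  by (cases X; cases X') simp

lemma verts_G: "verts G = {cls x x' | x x'. level_pair x x' \<and> norm (fst x - fst x') \<le> R}"
proof -
  have "po_vertices Q A D T B k = {cls x x' | x x'. level_pair x x' \<and> norm (fst x - fst x') \<le> R}"
    (is "_ = ?V")
  proof (intro equalityI subsetI)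
    fix v assume "v \<in> po_vertices Q A D T B k"
    then obtain X n \<alpha> X' where v: "v = po_class (X, (Q ^^ n) \<alpha>, X')" "\<alpha> \<in> B"
      "is_potential_overlap R A T (X, (Q ^^ n) \<alpha>, X')"
      unfolding po_vertices_def by blast
    let ?x = "tr (- (Q ^^ n) \<alpha>) X"
    have X: "X \<in> L" "X' \<in> L" "norm (fst ?x - fst X') \<le> R"
      using v(3) unfolding is_potential_overlap_iff by blast+
    have "tr ((Q ^^ n) \<alpha>) ?x \<in> L" using X(1) by simp
    then have "level_pair ?x X'" using X(2) v(2) unfolding level_pair_def by blast
    with X(3) show "v \<in> ?V" unfolding v(1) po_class_eq by blast
  next
    fix v assume "v \<in> ?V"
    then obtain x x' n \<alpha> where v: "v = cls x x'" "x' \<in> L" "\<alpha> \<in> B" "tr ((Q ^^ n) \<alpha>) x \<in> L"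
      "norm (fst x - fst x') \<le> R" unfolding level_pair_def by blast
    let ?X = "tr ((Q ^^ n) \<alpha>) x"
    have "v = po_class (?X, (Q ^^ n) \<alpha>, x')" unfolding po_class_eq by (simp add: v(1))
    moreover have "(Q ^^ n) \<alpha> \<in> Xi T" using v(3) B_Xi Q_Xi by blast
    then have "is_potential_overlap R A T (?X, (Q ^^ n) \<alpha>, x')"
      unfolding is_potential_overlap_iff using v(2,4,5) by simp
    ultimately show "v \<in> po_vertices Q A D T B k"
      unfolding po_vertices_def using v(3) by blast
  qed
  then show ?thesis by (simp add: po_graph_def)
qed

lemma level_pair_L:
  assumes "level_pair x x'"
  obtains g where "g \<in> Xi T" "tr g x \<in> L"
  using assms B_Xi Q_Xi unfolding level_pair_def by blast

lemma level_pair_ph: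
  assumes "level_pair x x'" "a \<in> ph m x" "b \<in> ph m x'"
  shows "level_pair a b"
proof -
  obtain n \<alpha> where n: "\<alpha> \<in> B" "tr ((Q ^^ n) \<alpha>) x \<in> L" using assms(1) unfolding level_pair_def by blast
  have "tr ((Q ^^ m) ((Q ^^ n) \<alpha>)) a \<in> ph m (tr ((Q ^^ n) \<alpha>) x)" using assms(2) by (simp add: ph_tr)
  then have "tr ((Q ^^ (m + n)) \<alpha>) a \<in> L" using ph_L[OF n(2)] by (auto simp: funpow_add)
  moreover have "b \<in> L" using assms(1,3) ph_L unfolding level_pair_def by blast
  ultimately show ?thesis using n(1) unfolding level_pair_def by blast
qed

lemma level_pair_Phi: "level_pair x x' \<Longrightarrow> a \<in> Phi Q D x \<Longrightarrow> b \<in> Phi Q D x' \<Longrightarrow> level_pair a b"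
  using level_pair_ph[of x x' a "Suc 0" b] by simp

lemma cls_in_verts:
  assumes "level_pair x x'"
  shows "cls x x' \<in> verts G \<longleftrightarrow> norm (fst x - fst x') \<le> R"
proof
  assume "cls x x' \<in> verts G"
  then obtain y y' where "cls x x' = cls y y'" "norm (fst y - fst y') \<le> R"
    unfolding verts_G by blast
  then show "norm (fst x - fst x') \<le> R" by (simp add: cls_def)
next
  assume "norm (fst x - fst x') \<le> R"
  with assms show "cls x x' \<in> verts G" unfolding verts_G by blast
qed

lemma ov_in_verts: "level_pair x x' \<Longrightarrow> ov x x' \<Longrightarrow> cls x x' \<in> verts G"
  by (simp add: cls_in_verts ov_overlap_radius)

lemma finite_verts_G: "finite (verts G)"
proof (rule finite_subset[OF _ finite_cls[of R]])
  show "verts G \<subseteq> {cls x y | x y. y \<in> L \<and> (\<exists>g\<in>Xi T. tr g x \<in> L) \<and> norm (fst x - fst y) \<le> R}"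
  proof
    fix v assume "v \<in> verts G"
    then obtain x x' where v: "v = cls x x'" "level_pair x x'" "norm (fst x - fst x') \<le> R"
      unfolding verts_G by blast
    obtain g where "g \<in> Xi T" "tr g x \<in> L" using level_pair_L[OF v(2)] .
    moreover have "x' \<in> L" using v(2) by (simp add: level_pair_def)
    ultimately show "v \<in> {cls x y | x y. y \<in> L \<and> (\<exists>g\<in>Xi T. tr g x \<in> L) \<and> norm (fst x - fst y) \<le> R}"
      using v by blast
  qed
qed

lemma arcs_G: "e \<in> arcs G \<longleftrightarrow> (\<exists>i z j d d' p q. e = ((i, z, j), (d, d'), (p, Q z + d - d', q)) \<and>
    (i, z, j) \<in> verts G \<and> (p, Q z + d - d', q) \<in> verts G \<and> d \<in> D p i \<and> d' \<in> D q j)"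
  unfolding po_graph_def by auto

lemma finite_Phi: "finite (Phi Q D x)"
  using finite_ph[of "Suc 0" x] by simp

lemma tail_G: "tail G = fst" and head_G: "head G = (\<lambda>e. snd (snd e))"
  by (simp_all add: po_graph_def)

lemma finite_arcs_G: "finite (arcs G)"
proof -
  have "arcs G \<subseteq> verts G \<times> ((\<Union>p. \<Union>i. D p i) \<times> (\<Union>q. \<Union>j. D q j)) \<times> verts G"
  proof
    fix e assume "e \<in> arcs G"
    then obtain i z j d d' p q where "e = ((i, z, j), (d, d'), (p, Q z + d - d', q))"
      "(i, z, j) \<in> verts G" "(p, Q z + d - d', q) \<in> verts G" "d \<in> D p i" "d' \<in> D q j"
      unfolding arcs_G by blast
    then show "e \<in> verts G \<times> ((\<Union>p. \<Union>i. D p i) \<times> (\<Union>q. \<Union>j. D q j)) \<times> verts G"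
      by blast
  qed
  then show ?thesis
    by (rule finite_subset)
      (intro finite_cartesian_product finite_verts_G finite_UN_I finite_class.finite_UNIV finite_D)
qed

lemma wf_G: "wf_digraph G"
  by unfold_locales (auto simp: arcs_G tail_G head_G)

lemma fin_digraph_induced:
  assumes "S \<subseteq> verts G"
  shows "fin_digraph (G \<restriction> S)"
proof
  show "tail (G \<restriction> S) e \<in> verts (G \<restriction> S)" "head (G \<restriction> S) e \<in> verts (G \<restriction> S)"
    if "e \<in> arcs (G \<restriction> S)" for e
    using that by (simp_all add: induce_subgraph_def)
  show "finite (verts (G \<restriction> S))" using finite_subset[OF assms finite_verts_G] by simp
  show "finite (arcs (G \<restriction> S))" using finite_arcs_G by (simp add: induce_subgraph_def)
qed

section \<open>Arcs and walks as pairs of descendants\<close>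

definition po_arc :: "('d, 'c) cpoint \<Rightarrow> ('d, 'c) cpoint \<Rightarrow> ('d, 'c) cpoint \<times> ('d, 'c) cpoint \<Rightarrow> ('d, 'c) po_arc" where
  "po_arc x x' = (\<lambda>(a, b). (cls x x', (fst a - Q (fst x), fst b - Q (fst x')), cls a b))"

text \<open>An arc is a choice of two digits, that is, of a child of x and a child of x'; any
  representative of the class may be used.\<close>

lemma arcs_from_cls:
  assumes "cls x x' \<in> verts G"
  shows "{e \<in> arcs G. tail G e = cls x x'} =
    po_arc x x' ` {(a, b). a \<in> Phi Q D x \<and> b \<in> Phi Q D x' \<and> cls a b \<in> verts G}"
proof (intro equalityI subsetI)
  fix e assume "e \<in> {e \<in> arcs G. tail G e = cls x x'}"
  then obtain d d' p q where e: "e = (cls x x', (d, d'), (p, Q (fst x - fst x') + d - d', q))"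
    "(p, Q (fst x - fst x') + d - d', q) \<in> verts G" "d \<in> D p (snd x)" "d' \<in> D q (snd x')"
    by (auto simp: arcs_G tail_G cls_def)
  let ?a = "(Q (fst x) + d, p)" and ?b = "(Q (fst x') + d', q)"
  have "cls ?a ?b = (p, Q (fst x - fst x') + d - d', q)"
    by (simp add: cls_def linear_diff[OF linear_Q])
  moreover have "?a \<in> Phi Q D x" "?b \<in> Phi Q D x'" using e(3,4) by (auto simp: Phi_def)
  ultimately show "e \<in> po_arc x x' ` {(a, b). a \<in> Phi Q D x \<and> b \<in> Phi Q D x' \<and> cls a b \<in> verts G}"
    using e(1,2) by (intro image_eqI[of _ _ "(?a, ?b)"]) (simp_all add: po_arc_def)
next
  fix e assume "e \<in> po_arc x x' ` {(a, b). a \<in> Phi Q D x \<and> b \<in> Phi Q D x' \<and> cls a b \<in> verts G}"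
  then obtain a b where ab: "a \<in> Phi Q D x" "b \<in> Phi Q D x'" "cls a b \<in> verts G" "e = po_arc x x' (a, b)"
    by blast
  obtain d p where a: "a = (Q (fst x) + d, p)" "d \<in> D p (snd x)" using ab(1) by (auto simp: Phi_def)
  obtain d' q where b: "b = (Q (fst x') + d', q)" "d' \<in> D q (snd x')" using ab(2) by (auto simp: Phi_def)
  have c: "cls a b = (p, Q (fst x - fst x') + d - d', q)"
    by (simp add: a b cls_def linear_diff[OF linear_Q])
  have "e = ((snd x, fst x - fst x', snd x'), (d, d'), (p, Q (fst x - fst x') + d - d', q))"
    unfolding ab(4) po_arc_def by (simp add: c) (simp add: a b cls_def)
  then have "e \<in> arcs G \<and> tail G e = cls x x'"
    using a(2) b(2) ab(3) assms unfolding arcs_G c by (auto simp: cls_def tail_G)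
  then show "e \<in> {e \<in> arcs G. tail G e = cls x x'}" by simp
qed

lemma inj_po_arc:
  "inj_on (po_arc x x') {(a, b). a \<in> Phi Q D x \<and> b \<in> Phi Q D x' \<and> P a b}"
  by (auto simp: inj_on_def po_arc_def cls_def)

lemma walks_Suc_cls:
  assumes "S \<subseteq> verts G" "cls x x' \<in> S"
  shows "walks (G \<restriction> S) (Suc n) (cls x x') =
    (\<Sum>(a, b) | a \<in> Phi Q D x \<and> b \<in> Phi Q D x' \<and> cls a b \<in> S. walks (G \<restriction> S) n (cls a b))"
proof -
  let ?E = "{e \<in> arcs (G \<restriction> S). tail (G \<restriction> S) e = cls x x'}"
  let ?P = "{(a, b). a \<in> Phi Q D x \<and> b \<in> Phi Q D x' \<and> cls a b \<in> S}"
  have "?E = {e \<in> {e \<in> arcs G. tail G e = cls x x'}. head G e \<in> S}"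
    using assms(2) by (auto simp: induce_subgraph_def)
  also have "\<dots> = po_arc x x' ` ?P"
  proof -
    have x: "cls x x' \<in> verts G" using assms by blast
    have "head G (po_arc x x' (a, b)) = cls a b" for a b by (simp add: po_arc_def head_G)
    then show ?thesis unfolding arcs_from_cls[OF x] using assms(1) by auto
  qed
  finally have E: "?E = po_arc x x' ` ?P" .
  have "walks (G \<restriction> S) (Suc n) (cls x x') = (\<Sum>e\<in>?E. walks (G \<restriction> S) n (head G e))"
    by (simp add: induce_subgraph_def)
  also have "\<dots> = (\<Sum>e\<in>?P. walks (G \<restriction> S) n (head G (po_arc x x' e)))"
    unfolding E by (rule sum.reindex[OF inj_po_arc, unfolded o_def])
  also have "\<dots> = (\<Sum>(a, b)\<in>?P. walks (G \<restriction> S) n (cls a b))"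
    by (intro sum.cong) (auto simp: po_arc_def head_G)
  finally show ?thesis .
qed

text \<open>A walk is determined by its final pair. Translated by \<open>g\<close>, the descendants
  of x are points of the tiling, so each has only one ancestor among the children of x; the same
  holds for x'.\<close>

lemma walks_le_pairs:
  assumes "S \<subseteq> verts G" "level_pair x x'" "cls x x' \<in> S"
  shows "walks (G \<restriction> S) n (cls x x') \<le> card {(a, b). a \<in> ph n x \<and> b \<in> ph n x' \<and> norm (fst a - fst b) \<le> R}"
  using assms(2,3)
proof (induction n arbitrary: x x')
  case 0
  have "norm (fst x - fst x') \<le> R" using cls_in_verts[OF 0(1)] 0(2) assms(1) by blast
  then have "{(a, b). a \<in> ph 0 x \<and> b \<in> ph 0 x' \<and> norm (fst a - fst b) \<le> R} = {(x, x')}" by auto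
  then show ?case by simp
next
  case (Suc n)
  let ?P = "{(a, b). a \<in> Phi Q D x \<and> b \<in> Phi Q D x' \<and> cls a b \<in> S}"
  let ?N = "\<lambda>n x x'. {(a, b). a \<in> ph n x \<and> b \<in> ph n x' \<and> norm (fst a - fst b) \<le> R}"
  have finN: "finite (?N n y y')" for n y y'
    by (rule finite_subset[of _ "ph n y \<times> ph n y'"]) auto
  have finP: "finite ?P"
    by (rule finite_subset[of _ "Phi Q D x \<times> Phi Q D x'"]) (auto simp: finite_Phi)
  obtain g where g: "tr g x \<in> L" "x' \<in> L"
    using Suc.prems(1) level_pair_L[OF Suc.prems(1)] by (auto simp: level_pair_def)
  have child: "tr (Q g) a \<in> L" if "a \<in> Phi Q D x" for a
    using ph_L[OF g(1), of "Suc 0"] that ph_tr[of "Suc 0" g x] by auto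
  have "walks (G \<restriction> S) (Suc n) (cls x x') = (\<Sum>(a, b)\<in>?P. walks (G \<restriction> S) n (cls a b))"
    by (rule walks_Suc_cls[OF assms(1) Suc.prems(2)])
  also have "\<dots> \<le> (\<Sum>(a, b)\<in>?P. card (?N n a b))"
    using Suc.IH level_pair_Phi[OF Suc.prems(1)] by (intro sum_mono) auto
  also have "\<dots> = (\<Sum>e\<in>?P. card (case e of (a, b) \<Rightarrow> ?N n a b))"
    by (intro sum.cong) auto
  also have "\<dots> = card (\<Union>e\<in>?P. case e of (a, b) \<Rightarrow> ?N n a b)"
  proof (rule card_UN_disjoint[symmetric, OF finP])
    show "\<forall>e\<in>?P. finite (case e of (a, b) \<Rightarrow> ?N n a b)" using finN by auto
    show "\<forall>e\<in>?P. \<forall>f\<in>?P. e \<noteq> f \<longrightarrow> (case e of (a, b) \<Rightarrow> ?N n a b) \<inter> (case f of (a, b) \<Rightarrow> ?N n a b) = {}"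
    proof (intro ballI impI, rule ccontr)
      fix e f assume e: "e \<in> ?P" and f: "f \<in> ?P" and ne: "e \<noteq> f"
        and "(case e of (a, b) \<Rightarrow> ?N n a b) \<inter> (case f of (a, b) \<Rightarrow> ?N n a b) \<noteq> {}"
      then obtain s t where st: "s \<in> ph n (fst e)" "t \<in> ph n (snd e)" "s \<in> ph n (fst f)" "t \<in> ph n (snd f)"
        by (auto simp: case_prod_beta)
      have "fst e = fst f"
        using ph_disjoint[OF child child st(1,3)] e f by auto
      moreover have "snd e \<in> L" "snd f \<in> L" using e f ph_L[OF g(2), of "Suc 0"] by auto
      then have "snd e = snd f" using ph_unique st(2,4) by blast
      ultimately show False using ne by (simp add: prod_eq_iff)
    qed
  qed
  also have "\<dots> \<le> card (?N (Suc n) x x')"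
    by (intro card_mono finN) (auto simp: Phi_pow_Suc')
  finally show ?case .
qed

text \<open>Ancestors of an overlapping pair overlap at every level, so the pair is reached by a
  walk that never leaves S.\<close>

lemma pairs_le_walks:
  assumes "S \<subseteq> verts G" "level_pair x x'" "ov x x'"
    and "\<And>m a b. a \<in> ph m x \<Longrightarrow> b \<in> ph m x' \<Longrightarrow> ov a b \<Longrightarrow> cls a b \<in> S"
  shows "card {(a, b). a \<in> ph n x \<and> b \<in> ph n x' \<and> ov a b} \<le> walks (G \<restriction> S) n (cls x x')"
  using assms(2-4)
proof (induction n arbitrary: x x')
  case 0
  have "{(a, b). a \<in> ph 0 x \<and> b \<in> ph 0 x' \<and> ov a b} \<subseteq> {(x, x')}" by auto
  then have "card {(a, b). a \<in> ph 0 x \<and> b \<in> ph 0 x' \<and> ov a b} \<le> card {(x, x')}"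
    by (intro card_mono) auto
  then show ?case by simp
next
  case (Suc n)
  let ?P = "{(a, b). a \<in> Phi Q D x \<and> b \<in> Phi Q D x' \<and> cls a b \<in> S}"
  let ?P' = "{(a, b). a \<in> Phi Q D x \<and> b \<in> Phi Q D x' \<and> ov a b}"
  let ?N = "\<lambda>n x x'. {(a, b). a \<in> ph n x \<and> b \<in> ph n x' \<and> ov a b}"
  have finN: "finite (?N n y y')" for n y y'
    by (rule finite_subset[of _ "ph n y \<times> ph n y'"]) auto
  have finP: "finite ?P" "finite ?P'"
    by (rule finite_subset[of _ "Phi Q D x \<times> Phi Q D x'"]; auto simp: finite_Phi)+
  have S: "cls a b \<in> S" if "(a, b) \<in> ?P'" for a b
    using Suc.prems(3)[of a "Suc 0" b] that by simp
  have x: "cls x x' \<in> S" using Suc.prems(3)[of x 0 x'] Suc.prems(2) by simp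
  have "?N (Suc n) x x' \<subseteq> (\<Union>e\<in>?P'. ?N n (fst e) (snd e))"
  proof
    fix e assume "e \<in> ?N (Suc n) x x'"
    then obtain s t where e: "e = (s, t)" and st: "s \<in> ph (Suc n) x" "t \<in> ph (Suc n) x'" "ov s t"
      by blast
    obtain a where a: "a \<in> Phi Q D x" "s \<in> ph n a" using st(1) unfolding Phi_pow_Suc' by blast
    obtain b where b: "b \<in> Phi Q D x'" "t \<in> ph n b" using st(2) unfolding Phi_pow_Suc' by blast
    have "ov a b" by (rule ov_ancestor[OF a(2) b(2) st(3)])
    with a(1) b(1) have "(a, b) \<in> ?P'" by blast
    moreover have "e \<in> ?N n (fst (a, b)) (snd (a, b))" using a(2) b(2) st(3) by (simp add: e)
    ultimately show "e \<in> (\<Union>e\<in>?P'. ?N n (fst e) (snd e))" by (rule UN_I)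
  qed
  then have "card (?N (Suc n) x x') \<le> card (\<Union>e\<in>?P'. ?N n (fst e) (snd e))"
    by (intro card_mono finite_UN_I finP finN)
  also have "\<dots> \<le> (\<Sum>e\<in>?P'. card (?N n (fst e) (snd e)))" by (rule card_UN_le[OF finP(2)])
  also have "\<dots> \<le> (\<Sum>e\<in>?P'. walks (G \<restriction> S) n (cls (fst e) (snd e)))"
  proof (rule sum_mono)
    fix e assume e: "e \<in> ?P'"
    then have ab: "fst e \<in> Phi Q D x" "snd e \<in> Phi Q D x'" "ov (fst e) (snd e)" by auto
    show "card (?N n (fst e) (snd e)) \<le> walks (G \<restriction> S) n (cls (fst e) (snd e))"
    proof (rule Suc.IH[OF level_pair_Phi[OF Suc.prems(1) ab(1,2)] ab(3)])
      fix m a b assume "a \<in> ph m (fst e)" "b \<in> ph m (snd e)" "ov a b"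
      then show "cls a b \<in> S"
        using Suc.prems(3)[of a "Suc m" b] ab(1,2) by (auto simp: Phi_pow_Suc')
    qed
  qed
  also have "\<dots> \<le> (\<Sum>e\<in>?P. walks (G \<restriction> S) n (cls (fst e) (snd e)))"
    using S by (intro sum_mono2 finP) auto
  also have "\<dots> = walks (G \<restriction> S) (Suc n) (cls x x')"
    unfolding walks_Suc_cls[OF assms(1) x] by (simp add: case_prod_beta)
  finally show ?case .
qed

section \<open>Paths to a coincidence and common descendants\<close>

lemma coincidence_class_cls: "coincidence_class (cls x x') \<longleftrightarrow> x = x'"
  by (auto simp: coincidence_class_def cls_def prod_eq_iff)

text \<open>The path is lifted arc by arc to actual pairs of children, so the representatives vary
  in the induction.\<close>

lemma coin_imp_lead:
  assumes "level_pair x x'" "cls x x' \<in> coin_vertices G"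
  shows "\<exists>n. lead n x x'"
proof -
  obtain v where v: "coincidence_class v" "cls x x' \<rightarrow>\<^sup>*\<^bsub>G\<^esub> v"
    using assms(2) by (auto simp: coin_vertices_def)
  have "(cls x x', v) \<in> (arcs_ends G)\<^sup>*"
    using v(2) by (rule reachable_rtranclI)
  then have "level_pair y y' \<longrightarrow> cls x x' = cls y y' \<longrightarrow> (\<exists>n. lead n y y')" for y y'
  proof (induction arbitrary: y y' rule: converse_rtrancl_induct)
    case base
    show ?case
    proof (intro impI)
      assume "level_pair y y'" "v = cls y y'"
      then have "lead 0 y y'" using v(1) by (simp add: coincidence_class_cls lead_def)
      then show "\<exists>n. lead n y y'" by blast
    qed
  next
    case (step u u')
    show ?case
    proof (intro impI)
      assume y: "level_pair y y'" "u = cls y y'"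
      obtain e where e: "e \<in> arcs G" "tail G e = cls y y'" "head G e = u'"
        using step.hyps(1) y(2) by (auto simp: arcs_ends_def arc_to_ends_def)
      then have "cls y y' \<in> verts G" using wf_G by (metis wf_digraph.tail_in_verts)
      then obtain a b where ab: "a \<in> Phi Q D y" "b \<in> Phi Q D y'" "e = po_arc y y' (a, b)"
        using arcs_from_cls[of y y'] e(1,2) by blast
      then have "u' = cls a b" using e(3) by (simp add: po_arc_def head_G)
      then obtain n where "lead n a b" using step.IH level_pair_Phi[OF y(1) ab(1,2)] by blast
      then have "lead (Suc n) y y'" using ab(1,2) unfolding lead_def Phi_pow_Suc' by blast
      then show "\<exists>n. lead n y y'" by blast
    qed
  qed
  with assms(1) show ?thesis by blast
qed

text \<open>The ancestors of a common descendant overlap at every level, so they satisfy the bound R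
  and the path stays in the graph.\<close>

lemma lead_imp_coin:
  assumes "level_pair x x'" "lead n x x'"
  shows "cls x x' \<in> coin_vertices G"
  using assms
proof (induction n arbitrary: x x')
  case 0
  have x: "cls x x' \<in> verts G" using ov_in_verts[OF 0(1) lead_ov[OF 0(2)]] .
  moreover have "coincidence_class (cls x x')" using 0(2) by (simp add: coincidence_class_cls lead_def)
  moreover have "cls x x' \<rightarrow>\<^sup>*\<^bsub>G\<^esub> cls x x'" using wf_digraph.reachable_refl[OF wf_G x] .
  ultimately show ?case unfolding coin_vertices_def by blast
next
  case (Suc n)
  have x: "cls x x' \<in> verts G" using ov_in_verts[OF Suc.prems(1) lead_ov[OF Suc.prems(2)]] .
  obtain c where c: "c \<in> ph (Suc n) x" "c \<in> ph (Suc n) x'" using Suc.prems(2) by (auto simp: lead_def)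
  obtain a where a: "a \<in> Phi Q D x" "c \<in> ph n a" using c(1) unfolding Phi_pow_Suc' by blast
  obtain b where b: "b \<in> Phi Q D x'" "c \<in> ph n b" using c(2) unfolding Phi_pow_Suc' by blast
  have "lead n a b" using a(2) b(2) by (auto simp: lead_def)
  then have ab: "cls a b \<in> coin_vertices G" using Suc.IH level_pair_Phi[OF Suc.prems(1) a(1) b(1)] by blast
  then obtain v where v: "v \<in> verts G" "coincidence_class v" "cls a b \<rightarrow>\<^sup>*\<^bsub>G\<^esub> v" "cls a b \<in> verts G"
    unfolding coin_vertices_def by blast
  let ?e = "po_arc x x' (a, b)"
  have "?e \<in> {e \<in> arcs G. tail G e = cls x x'}"
    unfolding arcs_from_cls[OF x] using a(1) b(1) v(4) by blast
  then have "(cls x x', cls a b) \<in> arcs_ends G"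
    by (auto simp: arcs_ends_def arc_to_ends_def po_arc_def head_G tail_G intro!: image_eqI[of _ _ ?e])
  then have "cls x x' \<rightarrow>\<^sup>*\<^bsub>G\<^esub> v"
    using wf_digraph.adj_reachable_trans[OF wf_G] v(3) by blast
  then show ?case using x v(1,2) unfolding coin_vertices_def by blast
qed

text \<open>After a translation the possible partners of a point are points of the tiling in a ball
  of radius R, hence at most K many.\<close>

lemma card_close_pairs_le:
  "\<exists>K. \<forall>x x' n Z. level_pair x x' \<longrightarrow> Z \<subseteq> ph n x' \<longrightarrow>
    card {(a, b). a \<in> ph n x \<and> b \<in> Z \<and> norm (fst a - fst b) \<le> R} \<le> K * card Z"
proof -
  obtain K where K: "\<forall>p. finite {x \<in> L. norm (fst x - p) \<le> R} \<and> card {x \<in> L. norm (fst x - p) \<le> R} \<le> K"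
    using L_locally_finite by blast
  have "card {(a, b). a \<in> ph n x \<and> b \<in> Z \<and> norm (fst a - fst b) \<le> R} \<le> K * card Z"
    if x: "level_pair x x'" and Z: "Z \<subseteq> ph n x'" for x x' n Z
  proof -
    obtain g where g: "tr g x \<in> L" using level_pair_L[OF x] by blast
    let ?g = "(Q ^^ n) g"
    let ?S = "\<lambda>b. {a \<in> ph n x. norm (fst a - fst b) \<le> R}"
    have S: "card (?S b) \<le> K" for b
    proof -
      have "tr ?g ` ?S b \<subseteq> {c \<in> L. norm (fst c - (?g + fst b)) \<le> R}"
        using ph_L[OF g, of n] by (auto simp: ph_tr)
      then have "card (tr ?g ` ?S b) \<le> card {c \<in> L. norm (fst c - (?g + fst b)) \<le> R}"
        using K by (intro card_mono) blast+
      also have "\<dots> \<le> K" using K by blast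
      finally show ?thesis by (simp add: card_image inj_on_def)
    qed
    have finZ: "finite Z" using Z finite_ph by (rule finite_subset)
    have "{(a, b). a \<in> ph n x \<and> b \<in> Z \<and> norm (fst a - fst b) \<le> R} = (\<Union>b\<in>Z. (\<lambda>a. (a, b)) ` ?S b)"
      by auto
    then have "card {(a, b). a \<in> ph n x \<and> b \<in> Z \<and> norm (fst a - fst b) \<le> R} \<le>
        (\<Sum>b\<in>Z. card ((\<lambda>a. (a, b)) ` ?S b))"
      using card_UN_le[OF finZ] by simp
    also have "\<dots> \<le> (\<Sum>b\<in>Z. K)"
      using S by (intro sum_mono) (simp add: card_image inj_on_def)
    finally show ?thesis by (simp add: mult.commute)
  qed
  then show ?thesis by blast
qed

section \<open>Growth rates of the two subgraphs\<close>

lemma res_coin_subset: "verts G - coin_vertices G \<subseteq> verts G" "coin_vertices G \<subseteq> verts G"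
  by (auto simp: coin_vertices_def)

lemma coin_radius_le: "graph_spectral_radius (coin_subgraph G) \<le> \<beta>"
proof -
  obtain K where K: "\<forall>x x' n Z. level_pair x x' \<longrightarrow> Z \<subseteq> ph n x' \<longrightarrow>
    card {(a, b). a \<in> ph n x \<and> b \<in> Z \<and> norm (fst a - fst b) \<le> R} \<le> K * card Z"
    using card_close_pairs_le by blast
  show ?thesis
    unfolding coin_subgraph_def
  proof (rule graph_spectral_radius_le[OF fin_digraph_induced[OF res_coin_subset(2)] \<beta>_pos])
    fix n v assume "v \<in> verts (G \<restriction> coin_vertices G)"
    then have v: "v \<in> coin_vertices G" by simp
    then have "v \<in> verts G" using res_coin_subset(2) by blast
    then obtain x x' where x: "v = cls x x'" "level_pair x x'" unfolding verts_G by blast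
    have "walks (G \<restriction> coin_vertices G) n v \<le>
        card {(a, b). a \<in> ph n x \<and> b \<in> ph n x' \<and> norm (fst a - fst b) \<le> R}"
      using walks_le_pairs[OF res_coin_subset(2) x(2)] v x(1) by simp
    also have "\<dots> \<le> K * card (ph n x')" using K x(2) by blast
    finally have "real (walks (G \<restriction> coin_vertices G) n v) \<le> real K * real (card (ph n x'))"
      unfolding of_nat_mult[symmetric] by (simp only: of_nat_le_iff)
    also have "\<dots> \<le> real K * (\<kappa> * \<beta> ^ n)"
      using x(2) by (intro mult_left_mono card_ph_le) (auto simp: level_pair_def)
    finally show "real (walks (G \<restriction> coin_vertices G) n v) \<le> (real K * \<kappa>) * \<beta> ^ n" by simp
  qed
qed

lemma between_radius:
  assumes "graph_spectral_radius H < \<beta>"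
  obtains \<gamma> where "0 < \<gamma>" "\<gamma> < \<beta>" "graph_spectral_radius H < \<gamma>"
proof
  \<comment> \<open>The term \<beta> / 2 makes \<gamma> positive without a lower bound on the
    spectral radius.\<close>
  let ?\<gamma> = "max (\<beta> / 2) ((graph_spectral_radius H + \<beta>) / 2)"
  show "0 < ?\<gamma>" "?\<gamma> < \<beta>" "graph_spectral_radius H < ?\<gamma>" using assms \<beta>_pos by (auto simp: less_max_iff_disj)
qed

lemma walks_not_ge:
  assumes "S \<subseteq> verts G" "graph_spectral_radius (G \<restriction> S) < \<beta>" "v \<in> S" "c > 0"
    "\<And>n. n \<ge> m \<Longrightarrow> c * \<beta> ^ n \<le> real (walks (G \<restriction> S) n v)"
  shows False
proof -
  obtain \<gamma> where \<gamma>: "0 < \<gamma>" "\<gamma> < \<beta>" "graph_spectral_radius (G \<restriction> S) < \<gamma>"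
    using between_radius[OF assms(2)] .
  obtain C where C: "\<And>n v. v \<in> verts (G \<restriction> S) \<Longrightarrow> real (walks (G \<restriction> S) n v) \<le> C * \<gamma> ^ n"
    using walks_bound[OF fin_digraph_induced[OF assms(1)] \<gamma>(1,3)] by blast
  have "c * \<beta> ^ m * \<beta> ^ n \<le> C * \<gamma> ^ m * \<gamma> ^ n" for n
    using assms(5)[of "m + n"] C[of v "m + n"] assms(3) by (simp add: power_add mult.assoc)
  moreover have "c * \<beta> ^ m > 0" using assms(4) \<beta>_pos by simp
  ultimately have "\<beta> \<le> \<gamma>" using power_le_imp_le[of "c * \<beta> ^ m" \<gamma> \<beta>] \<gamma>(1) by blast
  with \<gamma>(2) show False by simp
qed

lemma coin_radius_ge: "\<beta> \<le> graph_spectral_radius (coin_subgraph G)"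
proof (rule ccontr)
  assume "\<not> ?thesis"
  then have less: "graph_spectral_radius (G \<restriction> coin_vertices G) < \<beta>" by (simp add: coin_subgraph_def)
  have "B \<noteq> {}"
  proof
    assume "B = {}"
    then have "(UNIV :: (real^'d) set) = {0}" using B_span by simp
    moreover have "axis undefined 1 \<noteq> (0 :: real^'d)" by (simp add: axis_eq_0_iff)
    ultimately show False by blast
  qed
  then obtain \<alpha> where \<alpha>: "\<alpha> \<in> B" by blast
  \<comment> \<open>A vertex has to occur by a translation from \<open>B\<close>; two points of the
    tiling that differ by \<alpha> make the class of (x, x) occur by \<alpha>, with n = 0.\<close>
  then have "\<alpha> \<in> Xi T" using B_Xi by blast
  then obtain x where x: "x \<in> L" "tr \<alpha> x \<in> L" unfolding Xi_iff by blast
  then have "tr ((Q ^^ 0) \<alpha>) x \<in> L" by simp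
  with x(1) \<alpha> have lp: "level_pair x x" unfolding level_pair_def by blast
  have Inv: "cls a b \<in> coin_vertices G" if "a \<in> ph m x" "b \<in> ph m x" "ov a b" for m a b
  proof -
    have "a = b" using L_ov_eq that ph_L[OF x(1)] by blast
    then have "lead 0 a b" by (simp add: lead_def)
    then show ?thesis using lead_imp_coin level_pair_ph[OF lp that(1,2)] by blast
  qed
  have "1 / \<kappa> * \<beta> ^ n \<le> real (walks (G \<restriction> coin_vertices G) n (cls x x))" for n
  proof -
    have "(\<lambda>a. (a, a)) ` ph n x \<subseteq> {(a, b). a \<in> ph n x \<and> b \<in> ph n x \<and> ov a b}"
      by (auto simp: ov_refl)
    moreover have "finite {(a, b). a \<in> ph n x \<and> b \<in> ph n x \<and> ov a b}"
      by (rule finite_subset[of _ "ph n x \<times> ph n x"]) auto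
    ultimately have "card (ph n x) \<le> card {(a, b). a \<in> ph n x \<and> b \<in> ph n x \<and> ov a b}"
      using card_mono[of _ "(\<lambda>a. (a, a)) ` ph n x"] by (simp add: card_image inj_on_def)
    also have "\<dots> \<le> walks (G \<restriction> coin_vertices G) n (cls x x)"
      by (rule pairs_le_walks[OF res_coin_subset(2) lp ov_refl Inv])
    finally show ?thesis using card_ph_ge[OF x(1), of n] by simp
  qed
  moreover have "cls x x \<in> coin_vertices G" using Inv[of x 0 x] ov_refl by simp
  moreover have "1 / \<kappa> > 0" using \<kappa>_pos by simp
  ultimately show False using walks_not_ge[OF res_coin_subset(2) less] by blast
qed

text \<open>For a residual vertex x and x' do not overlap. If a and b are close descendants, a
  overlaps some tile c, which is not below x'. So b is near the boundary of the supertile of x', and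
  \<open>card_near_boundary\<close> bounds the walks.\<close>

lemma res_radius_less:
  assumes coin: "\<And>x x'. level_pair x x' \<Longrightarrow> ov x x' \<Longrightarrow> \<exists>n. lead n x x'"
  shows "graph_spectral_radius (res_subgraph G) < \<beta>"
proof -
  let ?S = "verts G - coin_vertices G"
  obtain K where K: "\<forall>x x' n Z. level_pair x x' \<longrightarrow> Z \<subseteq> ph n x' \<longrightarrow>
    card {(a, b). a \<in> ph n x \<and> b \<in> Z \<and> norm (fst a - fst b) \<le> R} \<le> K * card Z"
    using card_close_pairs_le by blast
  let ?\<rho> = "\<bar>R\<bar> + 2 * tile_radius"
  have "?\<rho> \<ge> 0" using tile_radius_pos by simp
  from card_near_boundary[OF this]
  obtain C \<gamma> where C: "C > 0" "0 < \<gamma>" "\<gamma> < \<beta>" "\<forall>x\<in>L. \<forall>n. real (card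
    {b \<in> ph n x. \<exists>c\<in>L. c \<notin> ph n x \<and> norm (fst b - fst c) \<le> ?\<rho>}) \<le> C * \<gamma> ^ n"
    by (elim exE conjE)
  have "graph_spectral_radius (res_subgraph G) \<le> \<gamma>"
    unfolding res_subgraph_def
  proof (rule graph_spectral_radius_le[OF fin_digraph_induced[OF res_coin_subset(1)] C(2)])
    fix n v assume "v \<in> verts (G \<restriction> ?S)"
    then have v: "v \<in> ?S" by simp
    then obtain x x' where x: "v = cls x x'" "level_pair x x'" unfolding verts_G by blast
    have "x' \<in> L" using x(2) by (simp add: level_pair_def)
    have "\<not> ov x x'" using coin[OF x(2)] lead_imp_coin[OF x(2)] v x(1) by blast
    let ?Z = "{b \<in> ph n x'. \<exists>c\<in>L. c \<notin> ph n x' \<and> norm (fst b - fst c) \<le> ?\<rho>}"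
    have "b \<in> ?Z" if ab: "a \<in> ph n x" "b \<in> ph n x'" "norm (fst a - fst b) \<le> R" for a b
    proof -
      obtain c where c: "c \<in> L" "ov a c"
        using open_meets_L[OF open_tint tint_nonempty, of a] unfolding ov_def by blast
      have "c \<notin> ph n x'" using ov_ancestor[OF ab(1) _ c(2)] \<open>\<not> ov x x'\<close> by blast
      moreover have "norm (fst b - fst c) \<le> ?\<rho>"
      proof -
        have "fst b - fst c = (fst a - fst c) - (fst a - fst b)" by simp
        then have "norm (fst b - fst c) \<le> norm (fst a - fst c) + norm (fst a - fst b)"
          by (simp only: norm_triangle_ineq4)
        then show ?thesis using ov_dist[OF c(2)] ab(3) by linarith
      qed
      ultimately show ?thesis using ab(2) c(1) by blast
    qed
    then have "{(a, b). a \<in> ph n x \<and> b \<in> ph n x' \<and> norm (fst a - fst b) \<le> R} =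
        {(a, b). a \<in> ph n x \<and> b \<in> ?Z \<and> norm (fst a - fst b) \<le> R}" by blast
    moreover have "walks (G \<restriction> ?S) n v \<le>
        card {(a, b). a \<in> ph n x \<and> b \<in> ph n x' \<and> norm (fst a - fst b) \<le> R}"
      using walks_le_pairs[OF res_coin_subset(1) x(2)] v x(1) by simp
    ultimately have "walks (G \<restriction> ?S) n v \<le> card {(a, b). a \<in> ph n x \<and> b \<in> ?Z \<and> norm (fst a - fst b) \<le> R}"
      by simp
    also have "\<dots> \<le> K * card ?Z" using K x(2) by (simp only: Collect_subset simp_thms)
    finally have "real (walks (G \<restriction> ?S) n v) \<le> real K * real (card ?Z)"
      unfolding of_nat_mult[symmetric] by (simp only: of_nat_le_iff)
    also have "\<dots> \<le> real K * (C * \<gamma> ^ n)"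
      using C(4) \<open>x' \<in> L\<close> by (intro mult_left_mono) auto
    finally show "real (walks (G \<restriction> ?S) n v) \<le> (real K * C) * \<gamma> ^ n" by simp
  qed
  with C(3) show ?thesis by simp
qed

text \<open>If an overlap never leads to a coincidence, neither do its overlapping descendants, so
  all their classes are residual. A positive proportion of the descendants of x' takes part in them,
  which gives walks of order \<beta>^n.\<close>

lemma lead_of_res_radius_less:
  assumes less: "graph_spectral_radius (res_subgraph G) < \<beta>" and lp: "level_pair x x'" and ov: "ov x x'"
  shows "\<exists>n. lead n x x'"
proof (rule ccontr)
  assume no: "\<not> ?thesis"
  let ?S = "verts G - coin_vertices G"
  have Inv: "cls a b \<in> ?S" if ab: "a \<in> ph m x" "b \<in> ph m x'" "ov a b" for m a b
  proof -
    have lp': "level_pair a b" by (rule level_pair_ph[OF lp ab(1,2)])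
    have "\<not> lead n a b" for n
    proof
      assume "lead n a b"
      then obtain c where "c \<in> ph n a" "c \<in> ph n b" by (auto simp: lead_def)
      then have "c \<in> ph (m + n) x" "c \<in> ph (m + n) x'" using Phi_pow_trans ab(1,2) by blast+
      then have "lead (m + n) x x'" by (auto simp: lead_def)
      with no show False by blast
    qed
    then have "cls a b \<notin> coin_vertices G" using coin_imp_lead[OF lp'] by blast
    then show ?thesis using ov_in_verts[OF lp' ab(3)] by blast
  qed
  have x': "x' \<in> L" using lp by (simp add: level_pair_def)
  let ?U = "tint x \<inter> tint x'"
  have U: "open ?U" "?U \<noteq> {}" "?U \<subseteq> tint x'" using ov by (auto simp: ov_def open_tint)
  from card_inside_open[OF x' U]
  obtain c m where c: "c > 0" "\<forall>n\<ge>m. c * \<beta> ^ n \<le> real (card {b \<in> ph n x'. tint b \<subseteq> (Q ^^ n) ` ?U})"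
    by (elim exE conjE)
  have "c * \<beta> ^ n \<le> real (walks (G \<restriction> ?S) n (cls x x'))" if n: "n \<ge> m" for n
  proof -
    let ?N = "{(a, b). a \<in> ph n x \<and> b \<in> ph n x' \<and> ov a b}"
    have finN: "finite ?N" by (rule finite_subset[of _ "ph n x \<times> ph n x'"]) auto
    have "{b \<in> ph n x'. tint b \<subseteq> (Q ^^ n) ` ?U} \<subseteq> snd ` ?N"
    proof
      fix b assume "b \<in> {b \<in> ph n x'. tint b \<subseteq> (Q ^^ n) ` ?U}"
      then have b: "b \<in> ph n x'" and bU: "tint b \<subseteq> (Q ^^ n) ` ?U" by blast+
      have "?U \<subseteq> tset x" using tint_subset by blast
      then have bx: "tint b \<subseteq> (Q ^^ n) ` tset x" using bU image_mono order_trans by meson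
      obtain a where "a \<in> ph n x" "ov a b"
        using open_meets_ph[OF open_tint tint_nonempty bx] unfolding ov_def by blast
      with b have "(a, b) \<in> ?N" by blast
      then have "snd (a, b) \<in> snd ` ?N" by (rule imageI)
      then show "b \<in> snd ` ?N" by simp
    qed
    then have "card {b \<in> ph n x'. tint b \<subseteq> (Q ^^ n) ` ?U} \<le> card ?N"
      by (rule surj_card_le[OF finN])
    also have "\<dots> \<le> walks (G \<restriction> ?S) n (cls x x')"
      by (rule pairs_le_walks[OF res_coin_subset(1) lp ov Inv])
    finally show ?thesis using c(2) n by (meson of_nat_le_iff order_trans)
  qed
  moreover have "cls x x' \<in> ?S" using Inv[of x 0 x'] ov by simp
  ultimately show False
    using walks_not_ge[OF res_coin_subset(1) _ _ c(1)] less unfolding res_subgraph_def by blast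
qed

text \<open>Whether and when a pair leads to a coincidence depends only on its class.\<close>

lemma uniform_lead:
  assumes "finite {cls x x' | x x'. P x x'}" "\<And>x x'. P x x' \<Longrightarrow> \<exists>n. lead n x x'"
  shows "\<exists>l>0. \<forall>x x'. P x x' \<longrightarrow> lead l x x'"
proof -
  let ?V = "{cls x x' | x x'. P x x'}"
  have "\<forall>v\<in>?V. \<exists>n. \<forall>x x'. v = cls x x' \<longrightarrow> lead n x x'"
  proof
    fix v assume "v \<in> ?V"
    then obtain y y' where y: "v = cls y y'" "P y y'" by blast
    obtain n where n: "lead n y y'" using assms(2)[OF y(2)] by blast
    have "lead n x x'" if "v = cls x x'" for x x'
    proof -
      have "cls x x' = cls y y'" using that y(1) by simp
      then obtain g where "x = tr g y" "x' = tr g y'" unfolding cls_eq_iff by blast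
      then show ?thesis using n by (simp add: lead_tr)
    qed
    then show "\<exists>n. \<forall>x x'. v = cls x x' \<longrightarrow> lead n x x'" by blast
  qed
  from bchoice[OF this] obtain f where f: "\<forall>v\<in>?V. \<forall>x x'. v = cls x x' \<longrightarrow> lead (f v) x x'"
    by (elim exE)
  let ?l = "Suc (Max (f ` ?V))"
  have "lead ?l x x'" if "P x x'" for x x'
  proof -
    have v: "cls x x' \<in> ?V" using that by blast
    then have "lead (f (cls x x')) x x'" using f by blast
    moreover have "f (cls x x') \<le> ?l" using assms(1) v by (intro le_SucI Max_ge) auto
    ultimately show ?thesis by (rule lead_mono)
  qed
  then show ?thesis by blast
qed

section \<open>Overlap coincidence in terms of pairs\<close>

lemma is_overlap_iff:
  "is_overlap A T (X, y, X') \<longleftrightarrow> X \<in> L \<and> X' \<in> L \<and> y \<in> Xi T \<and> ov (tr (- y) X) X'"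
  by (cases X; cases X') (simp add: ov_def tint_def tset_def)

lemma is_coincidence_iff: "is_coincidence (X, y, X') \<longleftrightarrow> tr (- y) X = X'"
  by (cases X; cases X') (auto simp: translate_cpoint_def)

text \<open>The overlap condition in \<open>Phi_overlap\<close> is automatic at a coincidence: after
  the translation the two tiles agree, and every tile overlaps itself.\<close>

lemma ex_coincidence_iff_lead:
  assumes "is_overlap A T (X, y, X')"
  shows "(\<exists>Y\<in>Phi_overlap Q A D T l (X, y, X'). is_coincidence Y) \<longleftrightarrow> lead l (tr (- y) X) X'"
proof
  let ?y = "(Q ^^ l) y"
  have neg: "(Q ^^ l) (- y) = - ?y" by (simp add: linear_neg[OF linear_Qn])
  note X = assms[unfolded is_overlap_iff]
  {
    assume "\<exists>Y\<in>Phi_overlap Q A D T l (X, y, X'). is_coincidence Y"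
    then obtain b b' where "b \<in> ph l X" "b' \<in> ph l X'" "is_coincidence (b, ?y, b')"
      unfolding Phi_overlap.simps by blast
    then show "lead l (tr (- y) X) X'"
      unfolding is_coincidence_iff lead_def by (auto simp: ph_tr neg)
  }
  {
    assume "lead l (tr (- y) X) X'"
    then obtain b where b: "b \<in> ph l X" "tr (- ?y) b \<in> ph l X'" by (auto simp: lead_def ph_tr neg)
    have "is_overlap A T (b, ?y, tr (- ?y) b)"
      unfolding is_overlap_iff using b X ph_L Q_Xi ov_refl by blast
    then have "(b, ?y, tr (- ?y) b) \<in> Phi_overlap Q A D T l (X, y, X')"
      unfolding Phi_overlap.simps using b by blast
    moreover have "is_coincidence (b, ?y, tr (- ?y) b)" by (simp add: is_coincidence_iff del: is_coincidence.simps)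
    ultimately show "\<exists>Y\<in>Phi_overlap Q A D T l (X, y, X'). is_coincidence Y" by blast
  }
qed

lemma admits_overlap_coincidence_iff:
  "admits_overlap_coincidence Q A D T \<longleftrightarrow>
    (\<exists>l>0. \<forall>x x'. x' \<in> L \<and> (\<exists>y\<in>Xi T. tr y x \<in> L) \<and> ov x x' \<longrightarrow> lead l x x')"
proof -
  have "(\<forall>X. is_overlap A T X \<longrightarrow> (\<exists>Y\<in>Phi_overlap Q A D T l X. is_coincidence Y)) \<longleftrightarrow>
      (\<forall>x x'. x' \<in> L \<and> (\<exists>y\<in>Xi T. tr y x \<in> L) \<and> ov x x' \<longrightarrow> lead l x x')" (is "?P \<longleftrightarrow> ?Q") for l
  proof
    assume P: ?P
    show ?Q
    proof (intro allI impI)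
      fix x x' assume "x' \<in> L \<and> (\<exists>y\<in>Xi T. tr y x \<in> L) \<and> ov x x'"
      then obtain y where y: "x' \<in> L" "y \<in> Xi T" "tr y x \<in> L" "ov x x'" by blast
      then have o: "is_overlap A T (tr y x, y, x')" unfolding is_overlap_iff by simp
      then have "lead l (tr (- y) (tr y x)) x'" using P ex_coincidence_iff_lead[OF o, of l] by blast
      then show "lead l x x'" by simp
    qed
  next
    assume Q: ?Q
    show ?P
    proof (intro allI impI)
      fix Z assume Z: "is_overlap A T Z"
      obtain X y X' where XyX: "Z = (X, y, X')" by (rule prod_cases3)
      have X: "X \<in> L" "X' \<in> L" "y \<in> Xi T" "ov (tr (- y) X) X'"
        using Z unfolding XyX is_overlap_iff by blast+
      have "tr y (tr (- y) X) \<in> L" using X(1) by simp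
      then have "lead l (tr (- y) X) X'" using Q X(2-4) by blast
      then show "\<exists>Y\<in>Phi_overlap Q A D T l Z. is_coincidence Y"
        using ex_coincidence_iff_lead Z unfolding XyX by blast
    qed
  qed
  then show ?thesis unfolding admits_overlap_coincidence_def by simp
qed

lemma overlap_coincidence_iff_radius:
  "admits_overlap_coincidence Q A D T \<longleftrightarrow>
    graph_spectral_radius (res_subgraph G) < graph_spectral_radius (coin_subgraph G)"
proof
  assume "admits_overlap_coincidence Q A D T"
  then obtain l where l: "\<forall>x x'. x' \<in> L \<and> (\<exists>y\<in>Xi T. tr y x \<in> L) \<and> ov x x' \<longrightarrow> lead l x x'"
    unfolding admits_overlap_coincidence_iff by blast
  have "graph_spectral_radius (res_subgraph G) < \<beta>"
  proof (rule res_radius_less)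
    fix x x' assume lp: "level_pair x x'" and ov: "ov x x'"
    have "x' \<in> L" using lp by (simp add: level_pair_def)
    moreover have "\<exists>y\<in>Xi T. tr y x \<in> L" using level_pair_L[OF lp] by blast
    ultimately show "\<exists>n. lead n x x'" using l ov by blast
  qed
  then show "graph_spectral_radius (res_subgraph G) < graph_spectral_radius (coin_subgraph G)"
    using coin_radius_ge by linarith
next
  assume "graph_spectral_radius (res_subgraph G) < graph_spectral_radius (coin_subgraph G)"
  then have less: "graph_spectral_radius (res_subgraph G) < \<beta>" using coin_radius_le by linarith
  \<comment> \<open>\<open>coinciding\<close> asks for one l for all n, and the expansion for one l
    for all of \<open>B\<close>; finiteness of the vertex set provides it.\<close>
  have "\<exists>l>0. \<forall>x x'. level_pair x x' \<and> ov x x' \<longrightarrow> lead l x x'"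
  proof (rule uniform_lead)
    show "finite {cls x x' | x x'. level_pair x x' \<and> ov x x'}"
      by (rule finite_subset[OF _ finite_verts_G]) (use ov_in_verts in blast)
    show "\<exists>n. lead n x x'" if "level_pair x x' \<and> ov x x'" for x x'
      using lead_of_res_radius_less[OF less] that by blast
  qed
  then obtain l where l: "l > 0" "\<forall>x x'. level_pair x x' \<and> ov x x' \<longrightarrow> lead l x x'" by blast
  have coin: "\<forall>b\<in>B. coinciding l b"
    unfolding coinciding_def using l(2) unfolding level_pair_def by blast
  \<comment> \<open>Uniformity over all return vectors does not follow from the graph; it rests on
    \<open>finite_cls\<close>.\<close>
  have "\<exists>l>0. \<forall>x x'. x' \<in> L \<and> (\<exists>y\<in>Xi T. tr y x \<in> L) \<and> ov x x' \<longrightarrow> lead l x x'"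
  proof (rule uniform_lead)
    show "finite {cls x x' | x x'. x' \<in> L \<and> (\<exists>y\<in>Xi T. tr y x \<in> L) \<and> ov x x'}"
      by (rule finite_subset[OF _ finite_cls[of R]]) (use ov_overlap_radius in blast)
    show "\<exists>n. lead n x x'" if "x' \<in> L \<and> (\<exists>y\<in>Xi T. tr y x \<in> L) \<and> ov x x'" for x x'
      using lead_of_coinciding_basis[OF B_indep B_span l(1) coin] that by blast
  qed
  then show "admits_overlap_coincidence Q A D T" unfolding admits_overlap_coincidence_iff .
qed

end

theorem theorem4p1:
  fixes Q :: "real^'d::finite \<Rightarrow> real^'d"
    and A :: "'c::finite \<Rightarrow> (real^'d) set"
    and D :: "'c \<Rightarrow> 'c \<Rightarrow> (real^'d) set"
    and T :: "('d, 'c) tile set"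
    and \<xi> :: "('d, 'c) cpoint"
    and B :: "(real^'d) set"
    and l k :: nat
  assumes "self_affine_tiling Q A D T"
    and "meyer_set (Xi T)"
    and "\<xi> \<in> coloured_points A T"
    and "\<xi> \<in> Phi Q D \<xi>"
    and "B \<subseteq> Xi T"
    and "independent B"
    and "span B = UNIV"
    and "l > 0"
    and "\<And>\<alpha>. \<alpha> \<in> B \<Longrightarrow> translate_cpoint \<alpha> \<xi> \<in> Phi_pow Q D l \<xi>"
    and "k > 0"
    and "onorm (inv_into UNIV Q ^^ k) < 1"
  shows "admits_overlap_coincidence Q A D T \<longleftrightarrow>
    graph_spectral_radius (coin_subgraph (po_graph Q A D T B k)) >
    graph_spectral_radius (res_subgraph (po_graph Q A D T B k))"
proof -
  have "meyer_self_affine Q A D T k"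
    unfolding meyer_self_affine_def by (intro conjI assms(1,2,10,11))
  then interpret meyer_self_affine Q A D T k .
  obtain w \<beta> where w: "\<beta> > 0" "\<forall>i. w i > 0"
    "\<forall>j. (\<Sum>i\<in>UNIV. w i * real (card (D i j))) = \<beta> * w j"
    using ex_weights by (elim exE conjE)
  interpret overlap_graph Q A D T k w \<beta> B
  proof unfold_locales
    show "w i > 0" "(\<Sum>i\<in>UNIV. w i * real (card (D i j))) = \<beta> * w j" for i j
      using w(2,3) by simp_all
  qed (fact w(1) assms(5-7))+
  show ?thesis by (rule overlap_coincidence_iff_radius)
qed

end
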